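(* Let $n\ge 2$ be an integer and let $\vartheta>-1/2$ be a real number. For $\phi\in C(\mathbb{S}^{n-1})$ consider the Dirichlet problem $$\begin{cases}\Delta_{\vartheta}u=0, & \text{in } \mathbb{B}^n,\\ u=\phi, & \text{on } \mathbb{S}^{n-1}.\end{cases}$$ (i) If $\vartheta\le 0$, there exists a Lipschitz continuous function $\phi:\mathbb{S}^{n-1}\to\mathbb{R}$ such that the solution $u$ of this Dirichlet problem is not Lipschitz continuous. (ii) If $\vartheta>0$, then for every Lipschitz continuous function $\phi:\mathbb{S}^{n-1}\to\mathbb{R}$ the solution $u$ of this Dirichlet problem is Lipschitz continuous.
   Context: $\mathbb{B}^n$ is the open unit ball of $\mathbb{R}^n$, and $\mathbb{S}^{n-1}$ is the unit sphere. $|\cdot|$ is the Euclidean norm. For $u\in C^2(\mathbb{B}^n)$, $$\Delta_{\vartheta}u(x):=(1-|x|^2)\left\{\frac{1-|x|^2}{4}\Delta u(x)+\vartheta\sum_{j=1}^n x_j\frac{\partial u}{\partial x_j}(x)+\vartheta\left(\frac n2-1-\vartheta\right)u(x)\right\},$$ where $\Delta$ is the ordinary Laplacian. A solution of the Dirichlet problem is a function that is $C^2$ in $\mathbb{B}^n$, satisfies $\Delta_\vartheta u=0$ there, and extends continuously to the closed ball with boundary values $\phi$. Known fact fixing the meaning of "the solution": when $\vartheta>-1/2$, the solution exists for every $\phi\in C(\mathbb{S}^{n-1})$ and is given by $$u(x)=\mathcal{P}_{\vartheta}[\phi](x)=c_{n,\vartheta}\int_{\mathbb{S}^{n-1}}\frac{(1-|x|^2)^{1+2\vartheta}}{|x-\zeta|^{n+2\vartheta}}\,\phi(\zeta)\,d\sigma(\zeta),\quad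 x\in\mathbb{B}^n,\qquad c_{n,\vartheta}=\frac{\Gamma\left(\frac n2+\vartheta\right)\Gamma(1+\vartheta)}{\Gamma\left(\frac n2\right)\Gamma(1+2\vartheta)},$$ where $\sigma$ is the surface measure on $\mathbb{S}^{n-1}$ normalized so that $\sigma(\mathbb{S}^{n-1})=1$. Lipschitz continuity is with respect to the Euclidean distance: $\phi$ is Lipschitz on $\mathbb{S}^{n-1}$ if $|\phi(\zeta)-\phi(\eta)|\le L|\zeta-\eta|$ for some constant $L$ and all $\zeta,\eta\in\mathbb{S}^{n-1}$, and Lipschitz continuity of $u$ means the analogous condition on $\mathbb{B}^n$. *)

theory Defs
  imports "HOL-Analysis.Analysis"
begin

definition partial_deriv :: "'n::finite \<Rightarrow> (real ^ 'n \<Rightarrow> real) \<Rightarrow> real ^ 'n \<Rightarrow> real" where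
  "partial_deriv j u x = deriv (\<lambda>t. u (x + t *\<^sub>R axis j 1)) 0"

(* Intended for open S only. The existence of the partial derivatives is required
   explicitly because "deriv" is total. *)
primrec C_k_on :: "nat \<Rightarrow> (real ^ 'n::finite) set \<Rightarrow> (real ^ 'n \<Rightarrow> real) \<Rightarrow> bool" where
  "C_k_on 0 S u \<longleftrightarrow> continuous_on S u"
| "C_k_on (Suc k) S u \<longleftrightarrow> continuous_on S u \<and>
     (\<forall>j. (\<forall>x\<in>S. (\<lambda>t. u (x + t *\<^sub>R axis j 1)) field_differentiable (at 0)) \<and>
          C_k_on k S (partial_deriv j u))"

definition laplacian :: "(real ^ 'n::finite \<Rightarrow> real) \<Rightarrow> real ^ 'n \<Rightarrow> real" where
  "laplacian u x = (\<Sum>j\<in>UNIV. partial_deriv j (partial_deriv j u) x)"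

definition Delta_theta :: "real \<Rightarrow> (real ^ 'n::finite \<Rightarrow> real) \<Rightarrow> real ^ 'n \<Rightarrow> real" where
  "Delta_theta \<theta> u x = (1 - (norm x)\<^sup>2) *
     ((1 - (norm x)\<^sup>2) / 4 * laplacian u x
      + \<theta> * (\<Sum>j\<in>UNIV. x $ j * partial_deriv j u x)
      + \<theta> * (real CARD('n) / 2 - 1 - \<theta>) * u x)"

(* Only the values of u on the open ball and of \<phi> on the sphere matter. *)
definition dirichlet_solution ::
    "real \<Rightarrow> (real ^ 'n::finite \<Rightarrow> real) \<Rightarrow> (real ^ 'n \<Rightarrow> real) \<Rightarrow> bool" where
  "dirichlet_solution \<theta> \<phi> u \<longleftrightarrow>
     C_k_on 2 (ball 0 1) u \<and>
     (\<forall>x\<in>ball 0 1. Delta_theta \<theta> u x = 0) \<and>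
     (\<exists>U. continuous_on (cball 0 1) U \<and>
          (\<forall>x\<in>ball 0 1. U x = u x) \<and> (\<forall>\<zeta>\<in>sphere 0 1. U \<zeta> = \<phi> \<zeta>))"

definition lipschitz_continuous_on :: "(real ^ 'n::finite) set \<Rightarrow> (real ^ 'n \<Rightarrow> real) \<Rightarrow> bool" where
  "lipschitz_continuous_on S f \<longleftrightarrow> (\<exists>L. L-lipschitz_on S f)"

end

theory Submission
  imports Defs
begin

text \<open>Write \<open>n\<close> for the dimension, \<open>s = |x|\<^sup>2\<close>, \<open>c = \<theta> (n/2 - 1 - \<theta>)\<close> and
\<open>L u = (1 - s)/4 \<Delta>u + \<theta> x\<cdot>\<nabla>u + c u\<close>. The operator degenerates on the sphere, and the sign of
\<open>\<theta>\<close> decides whether the first-order term pushes solutions to be Lipschitz there.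

Uniqueness is a maximum principle. The coefficient \<open>c\<close> may have either sign, so solutions are
compared with a positive strict supersolution \<open>G\<close>: at an interior positive maximum of \<open>w/G\<close> the
function \<open>w - \<kappa> G\<close> has a maximum with value \<open>0\<close>, so \<open>L\<close> of it is nonpositive there, whereas
\<open>L w \<ge> 0 > L G\<close> (\<open>comparison_principle\<close>). The power \<open>(1 - s)\<close> to \<open>\<theta> + 1/2\<close> is a strict
supersolution for every \<open>\<theta> > -1/2\<close>, but it vanishes on the sphere. Adding to it the radial
solution \<open>h\<close> gives a \<open>G\<close> that is positive on the closed ball (\<open>positive_strict_supersolution\<close>).

The radial solution is \<open>h(x) = g(s)\<close> with \<open>g\<close> equal to \<open>(1 - s)\<close> to the power \<open>1 + 2\<theta>\<close> times the
series \<open>F(n/2 + \<theta>, 1 + \<theta>; n/2; s)\<close>. All coefficients of the series are positive, and comparing them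
with those of the binomial series shows that \<open>g\<close> has a positive limit \<open>\<gamma>\<close> at \<open>1\<close>
(\<open>hypergeometric_profile\<close>). Its equation has the divergence form
\<open>(p g')' = - c p g / (s (1 - s))\<close> with \<open>p(s) = s powr (n/2) * (1 - s) powr (-2\<theta>)\<close>.

For \<open>\<theta> < 0\<close> the right-hand side is positive, hence \<open>p g'\<close> stays above a positive constant and \<open>g'\<close>
grows at least like \<open>(1 - s)\<close> to the power \<open>2\<theta>\<close>. So already the constant data \<open>\<phi> = 1\<close> has a
solution, \<open>h / \<gamma>\<close>, that is not Lipschitz (\<open>constant_data_not_lipschitz\<close>). For \<open>\<theta> = 0\<close> solutions
are harmonic functions, and the real part of \<open>(1 - z) log (1 - z)\<close> with \<open>z = x\<^sub>i + \<i> x\<^sub>k\<close> has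
unbounded gradient at the point \<open>e\<^sub>i\<close> of the sphere. Its restriction to the sphere is Lipschitz, since
there \<open>1 - x\<^sub>i\<close> is half the squared distance to \<open>e\<^sub>i\<close>, which absorbs the logarithm
(\<open>harmonic_lipschitz_failure\<close>).

For \<open>\<theta> > 0\<close> the solution is the Poisson integral \<open>u = 1/\<gamma> * \<integral> K(x, \<zeta>) \<phi>(\<zeta>) d\<sigma>(\<zeta>)\<close>, where \<open>\<sigma>\<close> is
the radial projection of the uniform measure on the ball. The kernel \<open>K\<close> solves the equation, and the
integral of \<open>K\<close> against \<open>\<sigma>\<close> is radial, hence equals \<open>h\<close>; this replaces the evaluation of
the normalizing constant and yields the boundary values (\<open>poisson_solves_dirichlet\<close>). For the gradient
at \<open>x = |x| \<eta>\<close> split \<open>\<phi>(\<zeta>) = (\<phi>(\<zeta>) - \<phi>(\<eta>)) + \<phi>(\<eta>)\<close>. The constant part contributes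
\<open>\<phi>(\<eta>) \<nabla>h\<close>, which is bounded because the divergence form now gives a bounded \<open>g'\<close>. In the other part
\<open>|\<nabla>K|\<close> is at most a constant times \<open>K / (1 - s)\<close>, so it suffices that the Poisson integral of
\<open>|\<zeta> - \<eta>|\<close> is at most a constant times \<open>1 - s\<close> at \<open>x\<close>. That is a comparison with the barrier
\<open>|x - \<eta>| + A (1 - s) + B (1 - s) powr (1 + \<theta>)\<close> (\<open>barrier\<close>): the term with \<open>A\<close> contributes about
\<open>-2 \<theta> A\<close> near the sphere, a gain exactly when \<open>\<theta> > 0\<close>.\<close>

section \<open>Second-order jets and the comparison principle\<close>

lemma partial_deriv_eqI:
  assumes "((\<lambda>t. u (x + t *\<^sub>R axis j 1)) has_real_derivative D) (at 0)"
  shows "partial_deriv j u x = D"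
  unfolding partial_deriv_def using assms by (rule DERIV_imp_deriv)

text \<open>The partial derivatives of the statement are derivatives along lines, so all
calculus below is phrased for functions \<open>t \<mapsto> u (x + t v)\<close>. Their derivative at \<open>0\<close> only sees \<open>u\<close> near \<open>x\<close>.\<close>

lemma has_derivative_along_line_cong:
  fixes f g :: "'a::real_normed_vector \<Rightarrow> real"
  assumes "open S" "x \<in> S" "\<And>y. y \<in> S \<Longrightarrow> f y = g y"
    and "((\<lambda>t. f (x + t *\<^sub>R v)) has_real_derivative D) (at 0)"
  shows "((\<lambda>t. g (x + t *\<^sub>R v)) has_real_derivative D) (at 0)"
proof -
  have "((\<lambda>t. x + t *\<^sub>R v) \<longlongrightarrow> x + 0 *\<^sub>R v) (nhds 0)"
    by (intro tendsto_intros filterlim_ident)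
  then have "\<forall>\<^sub>F t in nhds 0. x + t *\<^sub>R v \<in> S"
    using assms(1,2) by (auto dest: topological_tendstoD)
  then have "\<forall>\<^sub>F t in nhds 0. f (x + t *\<^sub>R v) = g (x + t *\<^sub>R v)"
    by eventually_elim (simp add: assms(3))
  then show ?thesis using assms(4) DERIV_cong_ev[OF refl _ refl] by fastforce
qed

text \<open>A function together with candidates for all its first and second partial derivatives. Carrying
the derivatives along explicitly makes sums, multiples and the operator computable without
manipulating nested uses of \<open>deriv\<close>.\<close>

definition C2_jet ::
    "(real ^ 'n::finite) set \<Rightarrow> (real ^ 'n \<Rightarrow> real) \<Rightarrow> ('n \<Rightarrow> real ^ 'n \<Rightarrow> real) \<Rightarrow>
     ('n \<Rightarrow> 'n \<Rightarrow> real ^ 'n \<Rightarrow> real) \<Rightarrow> bool" where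
  "C2_jet S u u1 u2 \<longleftrightarrow>
     continuous_on S u \<and> (\<forall>j. continuous_on S (u1 j)) \<and> (\<forall>j k. continuous_on S (u2 j k)) \<and>
     (\<forall>x\<in>S. \<forall>j. ((\<lambda>t. u (x + t *\<^sub>R axis j 1)) has_real_derivative u1 j x) (at 0)) \<and>
     (\<forall>x\<in>S. \<forall>j k. ((\<lambda>t. u1 j (x + t *\<^sub>R axis k 1)) has_real_derivative u2 j k x) (at 0))"

lemma C2_jetI:
  assumes "continuous_on S u" "\<And>j. continuous_on S (u1 j)" "\<And>j k. continuous_on S (u2 j k)"
    and "\<And>x j. x \<in> S \<Longrightarrow> ((\<lambda>t. u (x + t *\<^sub>R axis j 1)) has_real_derivative u1 j x) (at 0)"
    and "\<And>x j k. x \<in> S \<Longrightarrow> ((\<lambda>t. u1 j (x + t *\<^sub>R axis k 1)) has_real_derivative u2 j k x) (at 0)"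
  shows "C2_jet S u u1 u2"
  using assms unfolding C2_jet_def by blast

lemma C2_jet_partial_deriv:
  assumes "C2_jet S u u1 u2" "open S" "x \<in> S"
  shows "partial_deriv j u x = u1 j x" "partial_deriv k (partial_deriv j u) x = u2 j k x"
proof -
  have 1: "partial_deriv j u y = u1 j y" if "y \<in> S" for y
    using assms(1) that unfolding C2_jet_def by (intro partial_deriv_eqI) blast
  then show "partial_deriv j u x = u1 j x" using assms(3) .
  have "((\<lambda>t. u1 j (x + t *\<^sub>R axis k 1)) has_real_derivative u2 j k x) (at 0)"
    using assms(1,3) unfolding C2_jet_def by blast
  from has_derivative_along_line_cong[OF assms(2,3) 1[symmetric] this]
  show "partial_deriv k (partial_deriv j u) x = u2 j k x"
    by (rule partial_deriv_eqI)
qed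

text \<open>Together with the converse below this identifies the \<open>C\<^sup>2\<close> functions of the
statement with the functions that admit a jet. Openness of \<open>S\<close> allows the first partial derivative
to be replaced by \<open>u1\<close> under a second derivative.\<close>

lemma C_k_on_2_if_C2_jet:
  assumes J: "C2_jet S u u1 u2" and "open S"
  shows "C_k_on 2 S u"
proof -
  note pd = C2_jet_partial_deriv[OF J \<open>open S\<close>]
  have "continuous_on S (partial_deriv k (partial_deriv j u))" for j k
    using J unfolding C2_jet_def by (subst continuous_on_cong[OF refl pd(2)]) auto
  moreover have "continuous_on S (partial_deriv j u)" for j
    using J unfolding C2_jet_def by (subst continuous_on_cong[OF refl pd(1)]) auto
  moreover have "(\<lambda>t. u (x + t *\<^sub>R axis j 1)) field_differentiable at 0" if "x \<in> S" for j x
    using J that unfolding C2_jet_def field_differentiable_def by blast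
  moreover have "(\<lambda>t. partial_deriv j u (x + t *\<^sub>R axis k 1)) field_differentiable at 0"
    if "x \<in> S" for j k x
  proof -
    have "((\<lambda>t. u1 j (x + t *\<^sub>R axis k 1)) has_real_derivative u2 j k x) (at 0)"
      using J that unfolding C2_jet_def by blast
    then show ?thesis unfolding field_differentiable_def
      using has_derivative_along_line_cong[OF \<open>open S\<close> that, of "u1 j" "partial_deriv j u"] pd(1)
      by metis
  qed
  moreover have "continuous_on S u" using J unfolding C2_jet_def by blast
  ultimately show ?thesis by (simp add: numeral_2_eq_2)
qed

lemma C2_jet_if_C_k_on_2:
  assumes "C_k_on 2 S u"
  shows "C2_jet S u (\<lambda>j. partial_deriv j u) (\<lambda>j k. partial_deriv k (partial_deriv j u))"
  using assms unfolding numeral_2_eq_2 C2_jet_def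
  by (auto simp: partial_deriv_def intro!: DERIV_deriv_iff_field_differentiable[THEN iffD2])

lemma C2_jet_cong:
  assumes "C2_jet S u u1 u2" "open S" "\<And>x. x \<in> S \<Longrightarrow> v x = u x"
  shows "C2_jet S v u1 u2"
  using assms has_derivative_along_line_cong[OF \<open>open S\<close>, of _ u v]
  unfolding C2_jet_def by (metis continuous_on_cong)

lemma C2_jet_subset: "C2_jet S u u1 u2 \<Longrightarrow> T \<subseteq> S \<Longrightarrow> C2_jet T u u1 u2"
  unfolding C2_jet_def by (meson continuous_on_subset subsetD)

lemma C2_jet_add:
  assumes "C2_jet S u u1 u2" "C2_jet S v v1 v2"
  shows "C2_jet S (\<lambda>x. u x + v x) (\<lambda>j x. u1 j x + v1 j x) (\<lambda>j k x. u2 j k x + v2 j k x)"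
  using assms unfolding C2_jet_def by (auto intro!: continuous_intros derivative_intros)

lemma C2_jet_cmult:
  assumes "C2_jet S u u1 u2"
  shows "C2_jet S (\<lambda>x. b * u x) (\<lambda>j x. b * u1 j x) (\<lambda>j k x. b * u2 j k x)"
  using assms unfolding C2_jet_def by (auto intro!: continuous_intros DERIV_cmult)

text \<open>The operator without its outer factor \<open>1 - |x|\<^sup>2\<close>, which is positive in the ball and so
affects neither the equation nor the sign arguments.\<close>

definition L_jet ::
    "real \<Rightarrow> (real ^ 'n::finite \<Rightarrow> real) \<Rightarrow> ('n \<Rightarrow> real ^ 'n \<Rightarrow> real) \<Rightarrow>
     ('n \<Rightarrow> 'n \<Rightarrow> real ^ 'n \<Rightarrow> real) \<Rightarrow> real ^ 'n \<Rightarrow> real" where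
  "L_jet \<theta> u u1 u2 x = (1 - (norm x)\<^sup>2) / 4 * (\<Sum>j\<in>UNIV. u2 j j x)
     + \<theta> * (\<Sum>j\<in>UNIV. x $ j * u1 j x) + \<theta> * (real CARD('n) / 2 - 1 - \<theta>) * u x"

lemma L_jet_add:
  "L_jet \<theta> (\<lambda>x. u x + v x) (\<lambda>j x. u1 j x + v1 j x) (\<lambda>j k x. u2 j k x + v2 j k x) x
   = L_jet \<theta> u u1 u2 x + L_jet \<theta> v v1 v2 x"
  unfolding L_jet_def by (simp add: sum.distrib algebra_simps add_divide_distrib diff_divide_distrib)

lemma L_jet_cmult:
  "L_jet \<theta> (\<lambda>x. b * u x) (\<lambda>j x. b * u1 j x) (\<lambda>j k x. b * u2 j k x) x = b * L_jet \<theta> u u1 u2 x"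
proof -
  have "(\<Sum>j\<in>UNIV. x $ j * (b * u1 j x)) = b * (\<Sum>j\<in>UNIV. x $ j * u1 j x)"
    by (simp add: sum_distrib_left mult_ac)
  then show ?thesis
    unfolding L_jet_def by (simp add: sum_distrib_left[symmetric] algebra_simps)
qed

lemma L_jet_cong: "u x = v x \<Longrightarrow> L_jet \<theta> v u1 u2 x = L_jet \<theta> u u1 u2 x"
  by (simp add: L_jet_def)

lemma L_jet_eq_0_iff_Delta_theta:
  assumes "C2_jet (ball 0 1) u u1 u2" "x \<in> ball 0 1"
  shows "Delta_theta \<theta> u x = 0 \<longleftrightarrow> L_jet \<theta> u u1 u2 x = 0"
proof -
  have "norm x * norm x < 1 * 1" using assms(2) by (intro mult_strict_mono') auto
  then have "1 - (norm x)\<^sup>2 \<noteq> 0" by (simp add: power2_eq_square)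
  then show ?thesis
    unfolding Delta_theta_def L_jet_def laplacian_def
    by (simp add: C2_jet_partial_deriv[OF assms(1) open_ball assms(2)])
qed

text \<open>The second derivative test: if \<open>D\<close> were positive, \<open>\<psi>1\<close> would be positive just to the right
of its zero at \<open>0\<close>, and \<open>\<psi>\<close> would increase there.\<close>

lemma local_max_along_line:
  fixes \<psi> \<psi>1 :: "real \<Rightarrow> real"
  assumes ev: "\<forall>\<^sub>F t in nhds 0. \<psi> t \<le> \<psi> 0"
    and d1: "\<forall>\<^sub>F t in nhds 0. (\<psi> has_real_derivative \<psi>1 t) (at t)"
    and d2: "(\<psi>1 has_real_derivative D) (at 0)"
  shows "\<psi>1 0 = 0" "D \<le> 0"
proof -
  obtain e where e: "e > 0" "\<And>t. \<bar>t\<bar> < e \<Longrightarrow> \<psi> t \<le> \<psi> 0 \<and> (\<psi> has_real_derivative \<psi>1 t) (at t)"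
    using eventually_conj[OF ev d1] unfolding eventually_nhds_metric by (auto simp: dist_real_def)
  show z: "\<psi>1 0 = 0"
    using DERIV_local_max[of \<psi> "\<psi>1 0" 0 e] e by (auto simp: abs_minus_commute)
  show "D \<le> 0"
  proof (rule ccontr)
    assume "\<not> D \<le> 0"
    then obtain d where d: "d > 0" "\<And>h. 0 < h \<Longrightarrow> h < d \<Longrightarrow> \<psi>1 0 < \<psi>1 (0 + h)"
      using DERIV_pos_inc_right[OF d2] by auto
    define b where "b = min d e / 2"
    have b: "0 < b" "b < d" "b < e" using d(1) e(1) by (auto simp: b_def)
    have "\<exists>y. (\<psi> has_real_derivative y) (at t) \<and> 0 < y" if "0 < t" "t < b" for t
      using d(2)[of t] e(2)[of t] z b that by (intro exI[of _ "\<psi>1 t"]) auto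
    moreover have "continuous_on {0..b} \<psi>"
    proof (intro continuous_at_imp_continuous_on ballI)
      fix t assume "t \<in> {0..b}"
      then have "\<bar>t\<bar> < e" using b by auto
      then show "isCont \<psi> t" using e(2) by (blast intro: DERIV_isCont)
    qed
    ultimately have "\<psi> 0 < \<psi> b" 
      using DERIV_pos_imp_increasing_open[of 0 b \<psi>] b(1) by blast
    then show False using e(2)[of b] b by auto
  qed
qed

lemma has_derivative_along_line_shift:
  fixes f :: "'a::real_normed_vector \<Rightarrow> real"
  assumes "((\<lambda>t. f (x + s *\<^sub>R v + t *\<^sub>R v)) has_real_derivative D) (at 0)"
  shows "((\<lambda>t. f (x + t *\<^sub>R v)) has_real_derivative D) (at s)"
proof -
  have "((\<lambda>t. f (x + (t + s) *\<^sub>R v)) has_real_derivative D) (at 0)"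
    using assms by (simp add: algebra_simps)
  then show ?thesis using DERIV_shift[of "\<lambda>t. f (x + t *\<^sub>R v)" D 0 s] by simp
qed

text \<open>At a maximum the gradient vanishes and every pure second derivative is nonpositive. The
zero-order term, whose coefficient has no fixed sign, disappears because the maximal value is \<open>0\<close>.\<close>

lemma L_jet_nonpos_at_max:
  assumes J: "C2_jet S u u1 u2" and "open S" "x \<in> S" "S \<subseteq> ball 0 1"
    and mx: "\<And>y. y \<in> S \<Longrightarrow> u y \<le> u x" and "u x = 0"
  shows "L_jet \<theta> u u1 u2 x \<le> 0"
proof -
  have *: "u1 j x = 0 \<and> u2 j j x \<le> 0" for j
  proof -
    have "((\<lambda>t. x + t *\<^sub>R axis j 1) \<longlongrightarrow> x + 0 *\<^sub>R axis j 1) (nhds 0)"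
      by (intro tendsto_intros filterlim_ident)
    then have ev: "\<forall>\<^sub>F t in nhds 0. x + t *\<^sub>R axis j 1 \<in> S"
      using assms(2,3) by (auto dest: topological_tendstoD)
    have "\<forall>\<^sub>F t in nhds 0. u (x + t *\<^sub>R axis j 1) \<le> u (x + 0 *\<^sub>R axis j 1)"
      using ev by eventually_elim (simp add: mx)
    moreover have "\<forall>\<^sub>F t in nhds 0. ((\<lambda>t. u (x + t *\<^sub>R axis j 1)) has_real_derivative
        u1 j (x + t *\<^sub>R axis j 1)) (at t)"
      using ev
    proof eventually_elim
      case (elim t)
      then have "((\<lambda>s. u ((x + t *\<^sub>R axis j 1) + s *\<^sub>R axis j 1)) has_real_derivative
          u1 j (x + t *\<^sub>R axis j 1)) (at 0)"
        using J unfolding C2_jet_def by blast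
      then show ?case by (rule has_derivative_along_line_shift)
    qed
    moreover have "((\<lambda>t. u1 j (x + t *\<^sub>R axis j 1)) has_real_derivative u2 j j x) (at 0)"
      using J assms(3) by (auto simp: C2_jet_def)
    ultimately show ?thesis
      using local_max_along_line[of "\<lambda>t. u (x + t *\<^sub>R axis j 1)" "\<lambda>t. u1 j (x + t *\<^sub>R axis j 1)"]
      by simp
  qed
  have "norm x < 1" using assms(3,4) by auto
  then have "(norm x)\<^sup>2 \<le> 1" by (simp add: power_le_one)
  moreover have "(\<Sum>j\<in>UNIV. u2 j j x) \<le> 0" using * by (intro sum_nonpos) auto
  ultimately show ?thesis
    unfolding L_jet_def using * assms(6) by (simp add: mult_nonneg_nonpos)
qed

text \<open>Consider a positive maximum \<open>\<kappa>\<close> of \<open>W / G\<close> over the closed ball. It cannot lie on the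
sphere; in the interior \<open>w - \<kappa> G\<close> has a maximum with value \<open>0\<close>, where
\<open>L (w - \<kappa> G) \<ge> - \<kappa> L G > 0\<close> contradicts the previous lemma. The function \<open>W\<close> is the continuous extension of \<open>w\<close> to
the sphere.\<close>

lemma comparison_principle:
  fixes w W G :: "real ^ 'n::finite \<Rightarrow> real"
  assumes r: "0 < r" "r \<le> 1"
    and w: "C2_jet (ball 0 r) w w1 w2" "\<And>x. x \<in> ball 0 r \<Longrightarrow> L_jet \<theta> w w1 w2 x \<ge> 0"
    and W: "continuous_on (cball 0 r) W" "\<And>x. x \<in> ball 0 r \<Longrightarrow> W x = w x"
           "\<And>x. x \<in> sphere 0 r \<Longrightarrow> W x \<le> 0"
    and G: "C2_jet (ball 0 r) G G1 G2" "\<And>x. x \<in> ball 0 r \<Longrightarrow> L_jet \<theta> G G1 G2 x < 0"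
           "continuous_on (cball 0 r) G" "\<And>x. x \<in> cball 0 r \<Longrightarrow> G x > 0"
    and x: "x \<in> ball 0 r"
  shows "w x \<le> 0"
proof (rule ccontr)
  assume "\<not> w x \<le> 0"
  have "continuous_on (cball 0 r) (\<lambda>y. W y / G y)"
    using G(4) by (intro continuous_intros W(1) G(3)) force
  moreover have "cball (0 :: real ^ 'n) r \<noteq> {}" using r(1) by simp
  ultimately obtain z where z: "z \<in> cball 0 r" "\<And>y. y \<in> cball 0 r \<Longrightarrow> W y / G y \<le> W z / G z"
    using continuous_attains_sup[of "cball 0 r" "\<lambda>y. W y / G y"] compact_cball by blast
  \<comment> \<open>the smallest multiple of \<open>G\<close> that lies above \<open>W\<close>\<close>
  define \<kappa> where "\<kappa> = W z / G z"
  have "\<kappa> \<ge> W x / G x" unfolding \<kappa>_def using x by (intro z(2)) auto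
  moreover have "W x / G x > 0" using \<open>\<not> w x \<le> 0\<close> W(2) G(4) x by auto
  ultimately have k: "\<kappa> > 0" by linarith
  have "W z > 0" using k G(4)[OF z(1)] unfolding \<kappa>_def by (simp add: zero_less_divide_iff)
  then have zb: "z \<in> ball 0 r" using W(3)[of z] z(1) by (cases "norm z = r") auto
  define v where "v = (\<lambda>y. w y + (- \<kappa>) * G y)"
  have vz: "v z = 0" unfolding v_def \<kappa>_def using W(2)[OF zb] G(4)[OF z(1)] by simp
  have vle: "v y \<le> v z" if "y \<in> ball 0 r" for y
  proof -
    have "W y / G y \<le> \<kappa>" unfolding \<kappa>_def using that by (intro z(2)) auto
    moreover have "G y > 0" using that by (intro G(4)) auto
    ultimately have "W y \<le> \<kappa> * G y" by (simp add: divide_le_eq)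
    then show ?thesis using W(2)[OF that] vz by (simp add: v_def)
  qed
  have J: "C2_jet (ball 0 r) v (\<lambda>j x. w1 j x + (- \<kappa>) * G1 j x) (\<lambda>j k x. w2 j k x + (- \<kappa>) * G2 j k x)"
    unfolding v_def by (intro C2_jet_add C2_jet_cmult w(1) G(1))
  have "L_jet \<theta> v (\<lambda>j x. w1 j x + (- \<kappa>) * G1 j x) (\<lambda>j k x. w2 j k x + (- \<kappa>) * G2 j k x) z \<le> 0"
    using r by (intro L_jet_nonpos_at_max[OF J open_ball zb _ vle vz]) auto
  moreover have "L_jet \<theta> v (\<lambda>j x. w1 j x + (- \<kappa>) * G1 j x) (\<lambda>j k x. w2 j k x + (- \<kappa>) * G2 j k x) z
      = L_jet \<theta> w w1 w2 z + (- \<kappa>) * L_jet \<theta> G G1 G2 z"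
    unfolding v_def L_jet_add L_jet_cmult ..
  moreover have "(- \<kappa>) * L_jet \<theta> G G1 G2 z > 0" using G(2)[OF zb] k by (simp add: mult_pos_neg)
  ultimately show False using w(2)[OF zb] by linarith
qed

section \<open>Functions of the distance to a point\<close>

lemma sqdist_has_derivative_along_line:
  fixes x a v :: "'a::real_inner"
  shows "((\<lambda>t. (norm (x + t *\<^sub>R v - a))\<^sup>2) has_real_derivative 2 * ((x - a) \<bullet> v)) (at 0)"
proof -
  have "(\<lambda>t. (norm (x + t *\<^sub>R v - a))\<^sup>2)
      = (\<lambda>t. (norm (x - a))\<^sup>2 + t * (2 * ((x - a) \<bullet> v)) + t * t * (norm v)\<^sup>2)"
    by (simp add: power2_norm_eq_inner inner_simps inner_commute algebra_simps fun_eq_iff)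
  then show ?thesis by (auto intro!: derivative_eq_intros)
qed

lemma fun_sqdist_has_derivative_along_line:
  fixes x a v :: "'a::real_inner"
  assumes "(f has_real_derivative D) (at ((norm (x - a))\<^sup>2))"
  shows "((\<lambda>t. f ((norm (x + t *\<^sub>R v - a))\<^sup>2)) has_real_derivative 2 * ((x - a) \<bullet> v) * D) (at 0)"
  using DERIV_chain2[of f D "\<lambda>t. (norm (x + t *\<^sub>R v - a))\<^sup>2" 0, OF _ sqdist_has_derivative_along_line] assms
  by (simp add: mult_ac)

text \<open>The chain rule for \<open>x \<mapsto> f (|x - a|\<^sup>2)\<close>. All explicit functions below, the powers of
\<open>1 - |x|\<^sup>2\<close>, the radial solution and the distance to a boundary point, have this form.\<close>

definition sqdist_jet1 :: "real ^ 'n::finite \<Rightarrow> (real \<Rightarrow> real) \<Rightarrow> 'n \<Rightarrow> real ^ 'n \<Rightarrow> real" where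
  "sqdist_jet1 a f1 j x = 2 * (x - a) $ j * f1 ((norm (x - a))\<^sup>2)"

definition sqdist_jet2 ::
    "real ^ 'n::finite \<Rightarrow> (real \<Rightarrow> real) \<Rightarrow> (real \<Rightarrow> real) \<Rightarrow> 'n \<Rightarrow> 'n \<Rightarrow> real ^ 'n \<Rightarrow> real" where
  "sqdist_jet2 a f1 f2 j k x = 2 * axis k 1 $ j * f1 ((norm (x - a))\<^sup>2)
     + 4 * (x - a) $ j * (x - a) $ k * f2 ((norm (x - a))\<^sup>2)"

lemma C2_jet_fun_sqdist:
  fixes a :: "real ^ 'n::finite"
  assumes f: "\<And>x. x \<in> S \<Longrightarrow> (f has_real_derivative f1 ((norm (x - a))\<^sup>2)) (at ((norm (x - a))\<^sup>2))"
    and f1: "\<And>x. x \<in> S \<Longrightarrow> (f1 has_real_derivative f2 ((norm (x - a))\<^sup>2)) (at ((norm (x - a))\<^sup>2))"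
    and f2: "\<And>x. x \<in> S \<Longrightarrow> isCont f2 ((norm (x - a))\<^sup>2)"
  shows "C2_jet S (\<lambda>x. f ((norm (x - a))\<^sup>2)) (sqdist_jet1 a f1) (sqdist_jet2 a f1 f2)"
  unfolding sqdist_jet1_def[abs_def] sqdist_jet2_def[abs_def]
proof (rule C2_jetI)
  have cont: "continuous_on S (\<lambda>x. g ((norm (x - a))\<^sup>2))"
    if "\<And>x. x \<in> S \<Longrightarrow> isCont g ((norm (x - a))\<^sup>2)" for g :: "real \<Rightarrow> real"
    using that
    by (intro continuous_on_compose2[of "(\<lambda>x. (norm (x - a))\<^sup>2) ` S" g S])
       (auto intro!: continuous_intros continuous_at_imp_continuous_on)
  note conts = cont[OF DERIV_isCont[OF f]] cont[OF DERIV_isCont[OF f1]] cont[OF f2]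
  show "continuous_on S (\<lambda>x. f ((norm (x - a))\<^sup>2))" by (rule conts)
  show "continuous_on S (\<lambda>x. 2 * (x - a) $ j * f1 ((norm (x - a))\<^sup>2))" for j
    by (intro continuous_intros conts)
  show "continuous_on S (\<lambda>x. 2 * axis k 1 $ j * f1 ((norm (x - a))\<^sup>2)
              + 4 * (x - a) $ j * (x - a) $ k * f2 ((norm (x - a))\<^sup>2))" for j k
    by (intro continuous_intros conts)
  fix x assume x: "x \<in> S"
  show "((\<lambda>t. f ((norm (x + t *\<^sub>R axis j 1 - a))\<^sup>2)) has_real_derivative
      2 * (x - a) $ j * f1 ((norm (x - a))\<^sup>2)) (at 0)" for j
    using fun_sqdist_has_derivative_along_line[OF f[OF x], of "axis j 1"] by (simp add: inner_axis)
  have 1: "((\<lambda>t. f1 ((norm (x + t *\<^sub>R axis k 1 - a))\<^sup>2)) has_real_derivative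
      2 * (x - a) $ k * f2 ((norm (x - a))\<^sup>2)) (at 0)" for k
    using fun_sqdist_has_derivative_along_line[OF f1[OF x], of "axis k 1"] by (simp add: inner_axis)
  show "((\<lambda>t. 2 * (x + t *\<^sub>R axis k 1 - a) $ j * f1 ((norm (x + t *\<^sub>R axis k 1 - a))\<^sup>2))
     has_real_derivative 2 * axis k 1 $ j * f1 ((norm (x - a))\<^sup>2)
              + 4 * (x - a) $ j * (x - a) $ k * f2 ((norm (x - a))\<^sup>2)) (at 0)" for j k
    by (rule derivative_eq_intros 1 | simp add: algebra_simps)+
qed

lemma sum_mult_nth_eq_inner: "(\<Sum>j\<in>UNIV. x $ j * y $ j) = (x :: real ^ 'n::finite) \<bullet> y"
  by (simp add: inner_vec_def)

lemma L_jet_fun_sqdist: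
  fixes a :: "real ^ 'n::finite"
  shows "L_jet \<theta> u (sqdist_jet1 a f1) (sqdist_jet2 a f1 f2) x
   = (1 - (norm x)\<^sup>2) / 4 * (2 * real CARD('n) * f1 ((norm (x - a))\<^sup>2)
        + 4 * (norm (x - a))\<^sup>2 * f2 ((norm (x - a))\<^sup>2))
     + 2 * \<theta> * (x \<bullet> (x - a)) * f1 ((norm (x - a))\<^sup>2)
     + \<theta> * (real CARD('n) / 2 - 1 - \<theta>) * u x"
proof -
  have "(\<Sum>j\<in>UNIV. 2 * (axis j 1 :: real ^ 'n) $ j * F + 4 * d $ j * d $ j * E)
     = 2 * real CARD('n) * F + 4 * (\<Sum>j\<in>UNIV. d $ j * d $ j) * E" for d :: "real ^ 'n" and F E
    by (simp add: sum.distrib axis_def sum_distrib_left sum_distrib_right mult_ac)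
  from this[of "f1 ((norm (x - a))\<^sup>2)" "x - a" "f2 ((norm (x - a))\<^sup>2)"]
  have "(\<Sum>j\<in>UNIV. 2 * (axis j 1 :: real ^ 'n) $ j * f1 ((norm (x - a))\<^sup>2)
              + 4 * (x - a) $ j * (x - a) $ j * f2 ((norm (x - a))\<^sup>2))
     = 2 * real CARD('n) * f1 ((norm (x - a))\<^sup>2)
       + 4 * (\<Sum>j\<in>UNIV. (x - a) $ j * (x - a) $ j) * f2 ((norm (x - a))\<^sup>2)" .
  moreover have "(\<Sum>j\<in>UNIV. (x - a) $ j * (x - a) $ j) = (norm (x - a))\<^sup>2"
    by (simp only: sum_mult_nth_eq_inner power2_norm_eq_inner)
  moreover have "(\<Sum>j\<in>UNIV. x $ j * (2 * (x - a) $ j * f1 ((norm (x - a))\<^sup>2)))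
     = 2 * (\<Sum>j\<in>UNIV. x $ j * (x - a) $ j) * f1 ((norm (x - a))\<^sup>2)"
    by (simp only: sum_distrib_left sum_distrib_right mult_ac)
  ultimately show ?thesis
    unfolding L_jet_def sqdist_jet1_def sqdist_jet2_def sum_mult_nth_eq_inner by (simp only: mult_ac)
qed

lemma norm_sq_less_1: "x \<in> ball 0 1 \<Longrightarrow> (norm x)\<^sup>2 < 1"
  by (simp add: power_less_one_iff)

lemma DERIV_one_minus_powr:
  assumes "s < (1::real)"
  shows "((\<lambda>s. (1 - s) powr \<beta>) has_real_derivative - \<beta> * (1 - s) powr (\<beta> - 1)) (at s)"
  using assms by (auto intro!: derivative_eq_intros)

text \<open>This formula is the source of every explicit supersolution: for \<open>0 < \<beta> < 1 + 2 \<theta>\<close> the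
factor of \<open>|x|\<^sup>2\<close> has the right sign, and \<open>\<beta>\<close> is then chosen so that the other factor has it too.\<close>

lemma defect_power_jet:
  fixes \<theta> \<beta> :: real
  obtains u1 and u2 :: "'n::finite \<Rightarrow> 'n \<Rightarrow> real ^ 'n \<Rightarrow> real" where
    "C2_jet (ball 0 1) (\<lambda>x. (1 - (norm x)\<^sup>2) powr \<beta>) u1 u2"
    "\<And>x. x \<in> ball 0 1 \<Longrightarrow> L_jet \<theta> (\<lambda>x. (1 - (norm x)\<^sup>2) powr \<beta>) u1 u2 x
       = - ((1 - (norm x)\<^sup>2) powr (\<beta> - 1) * (\<beta> * (1 + 2 * \<theta> - \<beta>) * (norm x)\<^sup>2
            + (real CARD('n) / 2 * \<beta> - \<theta> * (real CARD('n) / 2 - 1 - \<theta>)) * (1 - (norm x)\<^sup>2)))"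
proof -
  define f f1 f2 where "f = (\<lambda>s::real. (1 - s) powr \<beta>)"
    and "f1 = (\<lambda>s::real. - \<beta> * (1 - s) powr (\<beta> - 1))"
    and "f2 = (\<lambda>s::real. \<beta> * (\<beta> - 1) * (1 - s) powr (\<beta> - 2))"
  have d: "(f has_real_derivative f1 s) (at s)" "(f1 has_real_derivative f2 s) (at s)" "isCont f2 s"
    if "s < 1" for s
    using that unfolding f_def f1_def f2_def
    by (auto intro!: derivative_eq_intros continuous_intros simp: algebra_simps)
  have 1: "(norm (x - 0))\<^sup>2 < 1" if "x \<in> ball 0 1" for x :: "real ^ 'n"
    using norm_sq_less_1[OF that] by simp
  show ?thesis
  proof (rule that)
    have J: "C2_jet (ball (0 :: real ^ 'n) 1) (\<lambda>x. f ((norm (x - 0))\<^sup>2)) (sqdist_jet1 0 f1) (sqdist_jet2 0 f1 f2)"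
      by (rule C2_jet_fun_sqdist) (use d 1 in blast)+
    show "C2_jet (ball (0 :: real ^ 'n) 1) (\<lambda>x. (1 - (norm x)\<^sup>2) powr \<beta>) (sqdist_jet1 0 f1) (sqdist_jet2 0 f1 f2)"
      by (rule C2_jet_cong[OF J]) (simp_all add: f_def)
  next
    fix x :: "real ^ 'n" assume "x \<in> ball 0 1"
    define s where "s = (norm x)\<^sup>2"
    have s: "s < 1" unfolding s_def using 1[OF \<open>x \<in> ball 0 1\<close>] by simp
    define P where "P = (1 - s) powr (\<beta> - 1)"
    have p: "(1 - s) powr \<beta> = (1 - s) * P" "(1 - s) powr (\<beta> - 2) = P / (1 - s)"
      using s by (auto simp: P_def powr_diff power2_eq_square)
    have "L_jet \<theta> (\<lambda>x. (1 - (norm x)\<^sup>2) powr \<beta>) (sqdist_jet1 0 f1) (sqdist_jet2 0 f1 f2) x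
      = (1 - s) / 4 * (2 * real CARD('n) * f1 s + 4 * s * f2 s)
     + 2 * \<theta> * s * f1 s + \<theta> * (real CARD('n) / 2 - 1 - \<theta>) * (1 - s) powr \<beta>"
      unfolding L_jet_fun_sqdist by (simp add: s_def power2_norm_eq_inner)
    also have "\<dots> = - (P * (\<beta> * (1 + 2 * \<theta> - \<beta>) * s
            + (real CARD('n) / 2 * \<beta> - \<theta> * (real CARD('n) / 2 - 1 - \<theta>)) * (1 - s)))"
      unfolding f1_def f2_def p P_def[symmetric] using s by (simp add: field_simps)
    finally show "L_jet \<theta> (\<lambda>x. (1 - (norm x)\<^sup>2) powr \<beta>) (sqdist_jet1 0 f1) (sqdist_jet2 0 f1 f2) x
       = - ((1 - (norm x)\<^sup>2) powr (\<beta> - 1) * (\<beta> * (1 + 2 * \<theta> - \<beta>) * (norm x)\<^sup>2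
            + (real CARD('n) / 2 * \<beta> - \<theta> * (real CARD('n) / 2 - 1 - \<theta>)) * (1 - (norm x)\<^sup>2)))"
      unfolding P_def s_def .
  qed
qed

text \<open>The exponent \<open>\<beta> = \<theta> + 1/2\<close> is half of the critical \<open>1 + 2 \<theta>\<close>. With it the second factor in
the formula above equals \<open>(n - 1)/4 + (\<theta> + 1/2)\<^sup>2\<close>, which is positive whatever the sign of the
zero-order coefficient.\<close>

lemma strict_supersolution:
  fixes \<theta> :: real
  assumes "\<theta> > - 1 / 2"
  obtains u1 and u2 :: "'n::finite \<Rightarrow> 'n \<Rightarrow> real ^ 'n \<Rightarrow> real" where
    "C2_jet (ball 0 1) (\<lambda>x. (1 - (norm x)\<^sup>2) powr (\<theta> + 1 / 2)) u1 u2"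
    "\<And>x. x \<in> ball 0 1 \<Longrightarrow> L_jet \<theta> (\<lambda>x. (1 - (norm x)\<^sup>2) powr (\<theta> + 1 / 2)) u1 u2 x < 0"
proof -
  obtain u1 and u2 :: "'n \<Rightarrow> 'n \<Rightarrow> real ^ 'n \<Rightarrow> real" where u:
    "C2_jet (ball 0 1) (\<lambda>x. (1 - (norm x)\<^sup>2) powr (\<theta> + 1 / 2)) u1 u2"
    "\<And>x. x \<in> ball 0 1 \<Longrightarrow> L_jet \<theta> (\<lambda>x. (1 - (norm x)\<^sup>2) powr (\<theta> + 1 / 2)) u1 u2 x
       = - ((1 - (norm x)\<^sup>2) powr (\<theta> + 1 / 2 - 1) * ((\<theta> + 1 / 2) * (1 + 2 * \<theta> - (\<theta> + 1 / 2)) * (norm x)\<^sup>2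
            + (real CARD('n) / 2 * (\<theta> + 1 / 2) - \<theta> * (real CARD('n) / 2 - 1 - \<theta>)) * (1 - (norm x)\<^sup>2)))"
    using defect_power_jet by blast
  show ?thesis
  proof (rule that[OF u(1)])
    fix x :: "real ^ 'n" assume x: "x \<in> ball 0 1"
    define s where "s = (norm x)\<^sup>2"
    have s: "0 \<le> s" "s < 1" using norm_sq_less_1[OF x] by (auto simp: s_def)
    have n: "real CARD('n) \<ge> 1" by (simp add: Suc_leI)
    have "real CARD('n) / 2 * (\<theta> + 1 / 2) - \<theta> * (real CARD('n) / 2 - 1 - \<theta>)
        = (real CARD('n) - 1) / 4 + (\<theta> + 1 / 2)\<^sup>2"
      by (simp add: power2_eq_square field_simps)
    moreover have "(\<theta> + 1 / 2)\<^sup>2 > 0" using assms by simp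
    moreover have "(real CARD('n) - 1) / 4 \<ge> 0" using n by simp
    ultimately have c: "real CARD('n) / 2 * (\<theta> + 1 / 2) - \<theta> * (real CARD('n) / 2 - 1 - \<theta>) > 0"
      by linarith
    have "(\<theta> + 1 / 2) * (1 + 2 * \<theta> - (\<theta> + 1 / 2)) * s \<ge> 0"
      using assms s by simp
    then have "(\<theta> + 1 / 2) * (1 + 2 * \<theta> - (\<theta> + 1 / 2)) * s
            + (real CARD('n) / 2 * (\<theta> + 1 / 2) - \<theta> * (real CARD('n) / 2 - 1 - \<theta>)) * (1 - s) > 0"
      using c s by (intro add_nonneg_pos mult_pos_pos) auto
    then show "L_jet \<theta> (\<lambda>x. (1 - (norm x)\<^sup>2) powr (\<theta> + 1 / 2)) u1 u2 x < 0"
      unfolding u(2)[OF x] s_def[symmetric] using s by simp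
  qed
qed

text \<open>The distance of \<open>x\<close> to the sphere is \<open>1 - |x|\<close>, and \<open>1 - |x|\<^sup>2\<close> is at most twice that.\<close>

lemma one_minus_norm_sq_le_dist:
  fixes x \<zeta> :: "'a::real_normed_vector"
  assumes "norm x < 1" "norm \<zeta> = 1"
  shows "1 - (norm x)\<^sup>2 \<le> 2 * norm (x - \<zeta>)"
proof -
  have "1 - (norm x)\<^sup>2 = (1 - norm x) * (1 + norm x)" by (simp add: power2_eq_square algebra_simps)
  also have "\<dots> \<le> (1 - norm x) * 2" using assms(1) by (intro mult_left_mono) auto
  also have "\<dots> \<le> norm (x - \<zeta>) * 2"
    using norm_triangle_ineq2[of \<zeta> x] assms(2) by (intro mult_right_mono) (auto simp: norm_minus_commute)
  finally show ?thesis by (simp add: mult.commute)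
qed

section \<open>The radial solution as a hypergeometric series\<close>

text \<open>Each rising factorial \<open>pochhammer z k\<close> is asymptotically
\<open>fact (k - 1) * k powr z / Gamma z\<close>, and the powers of \<open>k\<close> cancel by the balance condition.\<close>

lemma pochhammer_ratio_limit:
  fixes A B C D :: real
  assumes pos: "A > 0" "B > 0" "C > 0" "D > 0" and bal: "A + B = C + D"
  shows "(\<lambda>k. pochhammer A k * pochhammer B k / (pochhammer C k * pochhammer D k))
     \<longlonglongrightarrow> Gamma C * Gamma D / (Gamma A * Gamma B)"
proof -
  have ne: "Gamma A \<noteq> 0" "Gamma B \<noteq> 0" using pos by (metis Gamma_real_pos less_irrefl)+
  have "(\<lambda>k. Gamma_series' C k * Gamma_series' D k / (Gamma_series' A k * Gamma_series' B k))
     \<longlonglongrightarrow> Gamma C * Gamma D / (Gamma A * Gamma B)"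
    by (intro tendsto_intros Gamma_series'_LIMSEQ) (use ne in auto)
  moreover have "\<forall>\<^sub>F k in sequentially.
      Gamma_series' C k * Gamma_series' D k / (Gamma_series' A k * Gamma_series' B k)
      = pochhammer A k * pochhammer B k / (pochhammer C k * pochhammer D k)"
    using eventually_gt_at_top[of 0]
  proof eventually_elim
    case (elim k)
    have "pochhammer A k > 0" "pochhammer B k > 0" "pochhammer C k > 0" "pochhammer D k > 0"
      using pos by (auto intro!: pochhammer_pos)
    moreover have "exp (A * ln (real k)) * exp (B * ln (real k)) = exp (C * ln (real k)) * exp (D * ln (real k))"
      unfolding exp_add[symmetric] using bal by (simp add: distrib_right[symmetric])
    ultimately show ?case
      unfolding Gamma_series'_def by (simp add: field_simps)
  qed
  ultimately show ?thesis by (rule Lim_transform_eventually)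
qed

lemma negative_binomial_series:
  fixes s D :: real
  assumes "\<bar>s\<bar> < 1"
  shows "(\<lambda>k. pochhammer D k / fact k * s ^ k) sums (1 - s) powr (- D)"
proof -
  have "(\<lambda>k. ((- D) gchoose k) * (- s) ^ k) sums (1 + (- s)) powr (- D)"
    by (rule gen_binomial_real) (use assms in simp)
  moreover have "((- D) gchoose k) * (- s) ^ k = pochhammer D k / fact k * s ^ k" for k
    by (simp add: gbinomial_pochhammer power_mult_distrib[symmetric] flip: mult.assoc)
  ultimately show ?thesis by simp
qed

text \<open>An Abelian theorem. Up to finitely many terms, which are killed by the factor
\<open>(1 - s) powr D\<close>, the coefficients \<open>r k * b k\<close> are \<open>\<Lambda> * b k\<close> up to a relative error \<open>\<epsilon>\<close>.\<close>

lemma abelian_limit: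
  fixes b r :: "nat \<Rightarrow> real"
  assumes b: "\<And>k. b k \<ge> 0" and "D > 0"
    and sums: "\<And>s. 0 \<le> s \<Longrightarrow> s < 1 \<Longrightarrow> (\<lambda>k. b k * s ^ k) sums (1 - s) powr (- D)"
    and r: "r \<longlonglongrightarrow> \<Lambda>"
  shows "((\<lambda>s. (1 - s) powr D * (\<Sum>k. r k * b k * s ^ k)) \<longlongrightarrow> \<Lambda>) (at_left 1)"
proof -
  have "(\<lambda>k. r k - \<Lambda>) \<longlonglongrightarrow> 0" using r by (simp add: LIM_zero)
  then have "Bseq (\<lambda>k. r k - \<Lambda>)" by (intro convergent_imp_Bseq convergentI)
  then obtain M where M: "M > 0" "\<And>k. \<bar>r k - \<Lambda>\<bar> \<le> M" by (auto simp: Bseq_def)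
  have main: "\<bar>(1 - s) powr D * (\<Sum>k. r k * b k * s ^ k) - \<Lambda>\<bar> \<le> M * sum b {..<K} * (1 - s) powr D + \<epsilon>"
    if K: "\<And>k. k \<ge> K \<Longrightarrow> \<bar>r k - \<Lambda>\<bar> \<le> \<epsilon>" and s: "0 < s" "s < 1" and e: "\<epsilon> > 0" for K \<epsilon> s
  proof -
    note sb = sums[of s]
    have ab: "\<bar>(r k - \<Lambda>) * b k * s ^ k\<bar> = \<bar>r k - \<Lambda>\<bar> * (b k * s ^ k)" for k
      using b s by (simp add: abs_mult)
    have sM: "summable (\<lambda>k. M * (b k * s ^ k))" using sb s by (intro summable_mult) (auto dest: sums_summable)
    have sa: "summable (\<lambda>k. \<bar>(r k - \<Lambda>) * b k * s ^ k\<bar>)"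
      using b s M unfolding ab
      by (intro summable_comparison_test'[OF sM, of 0]) (auto intro!: mult_right_mono simp: abs_mult)
    have "(\<lambda>k. \<Lambda> * (b k * s ^ k) + (r k - \<Lambda>) * b k * s ^ k) sums
        (\<Lambda> * (1 - s) powr (- D) + (\<Sum>k. (r k - \<Lambda>) * b k * s ^ k))"
      using sb s sa by (intro sums_add sums_mult) (auto intro: summable_rabs_cancel)
    then have eq: "(\<Sum>k. r k * b k * s ^ k) = \<Lambda> * (1 - s) powr (- D) + (\<Sum>k. (r k - \<Lambda>) * b k * s ^ k)"
      by (intro sums_unique[symmetric]) (simp add: algebra_simps)
    have fin: "(\<lambda>k. if k \<in> {..<K} then M * b k else 0) sums (\<Sum>k\<in>{..<K}. M * b k)"
      by (rule sums_If_finite_set) simp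
    have bnd: "(\<lambda>k. (if k \<in> {..<K} then M * b k else 0) + \<epsilon> * (b k * s ^ k)) sums
        (M * sum b {..<K} + \<epsilon> * (1 - s) powr (- D))"
      using fin sb s by (intro sums_add sums_mult) (auto simp: sum_distrib_left)
    have le: "\<bar>r k - \<Lambda>\<bar> * (b k * s ^ k) \<le> (if k \<in> {..<K} then M * b k else 0) + \<epsilon> * (b k * s ^ k)" for k
    proof (cases "k < K")
      case True
      have "\<bar>r k - \<Lambda>\<bar> * (b k * s ^ k) \<le> M * b k"
        using M b[of k] s by (intro mult_mono mult_right_le_one_le) (auto simp: power_le_one)
      moreover have "\<epsilon> * (b k * s ^ k) \<ge> 0" using e b s by simp
      ultimately show ?thesis using True by simp
    next
      case False
      then show ?thesis using K[of k] b s by (simp add: mult_right_mono)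
    qed
    have "\<bar>\<Sum>k. (r k - \<Lambda>) * b k * s ^ k\<bar> \<le> (\<Sum>k. \<bar>(r k - \<Lambda>) * b k * s ^ k\<bar>)"
      using sa by (rule summable_rabs)
    also have "\<dots> \<le> M * sum b {..<K} + \<epsilon> * (1 - s) powr (- D)"
      using suminf_le[OF le _ sums_summable[OF bnd]] sa unfolding ab sums_unique[OF bnd] by simp
    finally have E: "\<bar>\<Sum>k. (r k - \<Lambda>) * b k * s ^ k\<bar> \<le> M * sum b {..<K} + \<epsilon> * (1 - s) powr (- D)" .
    have p1: "(1 - s) powr D * (1 - s) powr (- D) = 1"
      using s by (simp add: powr_minus)
    have "(1 - s) powr D * (\<Sum>k. r k * b k * s ^ k) - \<Lambda>
       = \<Lambda> * ((1 - s) powr D * (1 - s) powr (- D)) + (1 - s) powr D * (\<Sum>k. (r k - \<Lambda>) * b k * s ^ k) - \<Lambda>"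
      unfolding eq by (simp add: algebra_simps)
    also have "\<dots> = (1 - s) powr D * (\<Sum>k. (r k - \<Lambda>) * b k * s ^ k)" unfolding p1 by simp
    also have "\<bar>\<dots>\<bar> \<le> (1 - s) powr D * (M * sum b {..<K} + \<epsilon> * (1 - s) powr (- D))"
      unfolding abs_mult using E by (intro mult_mono) auto
    also have "\<dots> = M * sum b {..<K} * (1 - s) powr D + \<epsilon> * ((1 - s) powr D * (1 - s) powr (- D))"
      by (simp add: algebra_simps)
    finally show ?thesis unfolding p1 by simp
  qed
  show ?thesis
  proof (rule tendstoI)
    fix e :: real assume "e > 0"
    then have e2: "e / 2 > 0" by simp
    obtain K where K: "\<And>k. k \<ge> K \<Longrightarrow> \<bar>r k - \<Lambda>\<bar> \<le> e / 2"
      using LIMSEQ_D[OF r e2] by (metis less_imp_le real_norm_def)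
    have "((\<lambda>s. M * sum b {..<K} * (1 - s) powr D) \<longlongrightarrow> M * sum b {..<K} * 0 powr D) (at_left 1)"
      using \<open>D > 0\<close> by (intro tendsto_eq_intros refl | simp add: eventually_at_filter)+
    then have "\<forall>\<^sub>F s in at_left 1. M * sum b {..<K} * (1 - s) powr D < e / 2"
      using e2 by (intro order_tendstoD) auto
    moreover have "\<forall>\<^sub>F s in at_left (1::real). s \<in> {0<..<1}"
      by (rule eventually_at_leftI[of 0]) auto
    ultimately show "\<forall>\<^sub>F s in at_left 1. dist ((1 - s) powr D * (\<Sum>k. r k * b k * s ^ k)) \<Lambda> < e"
    proof eventually_elim
      case (elim s)
      then show ?case using main[where K = K and \<epsilon> = "e / 2" and s = s] K e2
        by (fastforce simp: dist_real_def)
    qed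
  qed
qed

text \<open>The hypergeometric equation is equivalent to the two-term recursion
\<open>(k + 1) (k + C) a(k + 1) = (k + A) (k + B) a(k)\<close>, read off coefficientwise.\<close>

lemma hypergeometric_series:
  fixes A B C :: real
  assumes pos: "A > 0" "B > 0" "C > 0"
    and a_def: "\<And>k. a k = pochhammer A k * pochhammer B k / (pochhammer C k * fact k)"
    and summ: "\<And>s. \<bar>s\<bar> < 1 \<Longrightarrow> summable (\<lambda>k. a k * s ^ k)"
  defines "G \<equiv> \<lambda>s. \<Sum>k. a k * s ^ k" and "G1 \<equiv> \<lambda>s. \<Sum>k. diffs a k * s ^ k"
    and "G2 \<equiv> \<lambda>s. \<Sum>k. diffs (diffs a) k * s ^ k"
  assumes s: "\<bar>s\<bar> < 1"
  shows "(G has_real_derivative G1 s) (at s)" "(G1 has_real_derivative G2 s) (at s)" "isCont G2 s"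
    "s * (1 - s) * G2 s + (C - (A + B + 1) * s) * G1 s - A * B * G s = 0"
proof -
  have s1: "summable (\<lambda>k. diffs c k * s ^ k)"
    if "\<And>s. \<bar>s\<bar> < 1 \<Longrightarrow> summable (\<lambda>k. c k * s ^ k)" "\<bar>s\<bar> < 1" for c :: "nat \<Rightarrow> real" and s
    using termdiff_converges[of s 1 c] that by auto
  have sa: "\<And>s. \<bar>s\<bar> < 1 \<Longrightarrow> summable (\<lambda>k. diffs a k * s ^ k)" using s1[OF summ] .
  have sb: "\<And>s. \<bar>s\<bar> < 1 \<Longrightarrow> summable (\<lambda>k. diffs (diffs a) k * s ^ k)" using s1[OF sa] .
  have rec: "(real k + 1) * (real k + C) * a (Suc k) = (real k + A) * (real k + B) * a k" for k
  proof -
    have "pochhammer C k > 0" using pos by (intro pochhammer_pos)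
    moreover have "real k + C > 0" using pos by simp
    ultimately show ?thesis
      unfolding a_def pochhammer_Suc fact_Suc
      by (simp add: divide_simps) (simp add: algebra_simps)
  qed
  show "(G has_real_derivative G1 s) (at s)"
    unfolding G_def G1_def using termdiffs_strong'[of 1 a s] summ s by simp
  show "(G1 has_real_derivative G2 s) (at s)"
    unfolding G1_def G2_def using termdiffs_strong'[of 1 "diffs a" s] sa s by simp
  show "isCont G2 s"
    unfolding G2_def using termdiffs_strong'[of 1 "diffs (diffs a)" s] sb s
    by (auto intro: DERIV_isCont)
  have G: "(\<lambda>k. a k * s ^ k) sums G s" using summ[OF s] by (simp add: G_def summable_sums)
  have G1: "(\<lambda>k. diffs a k * s ^ k) sums G1 s" using sa[OF s] by (simp add: G1_def summable_sums)
  have shift: "real k * c k * s ^ (k - Suc 0) * s = real k * c k * s ^ k" for k c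
    by (cases k) auto
  have sG1: "(\<lambda>k. real k * a k * s ^ k) sums (G1 s * s)"
    using sums_mult2[OF diffs_equiv[OF sa[OF s]], of s] unfolding shift G1_def by simp
  have sG2: "(\<lambda>k. real k * diffs a k * s ^ k) sums (G2 s * s)"
    using sums_mult2[OF diffs_equiv[OF sb[OF s]], of s] unfolding shift G2_def by simp
  have ssG2: "(\<lambda>k. (real k - 1) * real k * a k * s ^ k) sums (G2 s * s * s)"
  proof -
    have "(\<lambda>k. (real (Suc k) - 1) * real (Suc k) * a (Suc k) * s ^ Suc k) sums (G2 s * s * s)"
      using sums_mult2[OF sG2, of s] by (simp add: diffs_def mult_ac)
    from sums_Suc[OF this] show ?thesis by simp
  qed
  have "(\<lambda>k. real k * diffs a k * s ^ k + C * (diffs a k * s ^ k)) sums (G2 s * s + C * G1 s)"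
    by (intro sums_add sums_mult sG2 G1)
  moreover have "(\<lambda>k. ((real k - 1) * real k * a k * s ^ k + (A + B + 1) * (real k * a k * s ^ k))
      + A * B * (a k * s ^ k)) sums (G2 s * s * s + (A + B + 1) * (G1 s * s) + A * B * G s)"
    by (intro sums_add sums_mult ssG2 sG1 G)
  moreover have "real k * diffs a k * s ^ k + C * (diffs a k * s ^ k)
     = ((real k - 1) * real k * a k * s ^ k + (A + B + 1) * (real k * a k * s ^ k))
      + A * B * (a k * s ^ k)" for k
  proof -
    have "real k * diffs a k * s ^ k + C * (diffs a k * s ^ k)
       = (real k + 1) * (real k + C) * a (Suc k) * s ^ k"
      by (simp add: diffs_def algebra_simps)
    also have "\<dots> = (real k + A) * (real k + B) * a k * s ^ k" unfolding rec ..
    finally show ?thesis by (simp add: algebra_simps)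
  qed
  ultimately have "G2 s * s + C * G1 s = G2 s * s * s + (A + B + 1) * (G1 s * s) + A * B * G s"
    by (metis (no_types, lifting) sums_cong sums_unique2)
  then show "s * (1 - s) * G2 s + (C - (A + B + 1) * s) * G1 s - A * B * G s = 0"
    by (simp add: algebra_simps)
qed

text \<open>Existence of the radial solution, with \<open>N = n/2\<close>. Its regular expansion at \<open>0\<close> is
\<open>F(- \<theta>, N - 1 - \<theta>; N; s)\<close>, whose coefficients change sign in general. Euler's transformation rewrites it as
\<open>(1 - s) powr (1 + 2 \<theta>)\<close> times \<open>F(N + \<theta>, 1 + \<theta>; N; s)\<close>, a series with positive coefficients, which makes
positivity of \<open>g\<close> and of its limit visible.\<close>

lemma hypergeometric_profile:
  fixes N \<theta> :: real
  assumes N: "N > 0" "N + \<theta> > 0" and th: "\<theta> > - 1 / 2"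
  obtains g g1 g2 :: "real \<Rightarrow> real" and \<gamma> :: real where
    "\<And>s. \<bar>s\<bar> < 1 \<Longrightarrow> (g has_real_derivative g1 s) (at s)"
    "\<And>s. \<bar>s\<bar> < 1 \<Longrightarrow> (g1 has_real_derivative g2 s) (at s)"
    "\<And>s. \<bar>s\<bar> < 1 \<Longrightarrow> isCont g2 s"
    "\<And>s. \<bar>s\<bar> < 1 \<Longrightarrow> (1 - s) * (s * g2 s + N * g1 s) + 2 * \<theta> * s * g1 s + \<theta> * (N - 1 - \<theta>) * g s = 0"
    "g 0 = 1" "\<And>s. 0 \<le> s \<Longrightarrow> s < 1 \<Longrightarrow> g s > 0"
    "\<gamma> > 0" "(g \<longlongrightarrow> \<gamma>) (at_left 1)"
proof -
  \<comment> \<open>\<open>A + B = N + D\<close> is the balance that makes the coefficient ratios converge\<close>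
  define A B D where "A = N + \<theta>" and "B = 1 + \<theta>" and "D = 1 + 2 * \<theta>"
  have pos: "A > 0" "B > 0" "D > 0" using N th by (auto simp: A_def B_def D_def)
  define a where "a = (\<lambda>k. pochhammer A k * pochhammer B k / (pochhammer N k * fact k))"
  define b where "b = (\<lambda>k. pochhammer D k / fact k)"
  define r where "r = (\<lambda>k. pochhammer A k * pochhammer B k / (pochhammer N k * pochhammer D k))"
  define \<gamma> where "\<gamma> = Gamma N * Gamma D / (Gamma A * Gamma B)"
  have gpos: "\<gamma> > 0" using pos N unfolding \<gamma>_def by (simp add: Gamma_real_pos)
  have r: "r \<longlonglongrightarrow> \<gamma>" unfolding r_def \<gamma>_def
    using pos N by (intro pochhammer_ratio_limit) (auto simp: A_def B_def D_def)
  have rb: "a k = r k * b k" for k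
    using pochhammer_pos[OF pos(3), of k] by (simp add: a_def r_def b_def)
  have bpos: "b k > 0" for k using pos by (simp add: b_def pochhammer_pos)
  have apos: "a k > 0" for k using pos N by (simp add: a_def pochhammer_pos)
  have bs: "(\<lambda>k. b k * s ^ k) sums (1 - s) powr (- D)" if "\<bar>s\<bar> < 1" for s
    unfolding b_def using negative_binomial_series[OF that] .
  have "Bseq r" using r by (intro convergent_imp_Bseq convergentI)
  then obtain M where M: "M > 0" "\<And>k. \<bar>r k\<bar> \<le> M" by (auto simp: Bseq_def)
  have summ: "summable (\<lambda>k. a k * s ^ k)" if "\<bar>s\<bar> < 1" for s
  proof (rule summable_comparison_test')
    show "summable (\<lambda>k. M * (b k * \<bar>s\<bar> ^ k))"
      using bs[of "\<bar>s\<bar>"] that by (intro summable_mult) (auto dest: sums_summable)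
    show "norm (a k * s ^ k) \<le> M * (b k * \<bar>s\<bar> ^ k)" for k
      using M(2)[of k] bpos[of k]
      by (simp add: rb abs_mult power_abs mult.assoc mult_right_mono)
  qed
  have aeq: "a k = pochhammer A k * pochhammer B k / (pochhammer N k * fact k)" for k
    by (simp add: a_def)
  define G G1 G2 where "G = (\<lambda>s. \<Sum>k. a k * s ^ k)"
    and "G1 = (\<lambda>s. \<Sum>k. diffs a k * s ^ k)" and "G2 = (\<lambda>s. \<Sum>k. diffs (diffs a) k * s ^ k)"
  have G: "(G has_real_derivative G1 s) (at s)" "(G1 has_real_derivative G2 s) (at s)" "isCont G2 s"
    "s * (1 - s) * G2 s + (N - (A + B + 1) * s) * G1 s - A * B * G s = 0" if "\<bar>s\<bar> < 1" for s
    unfolding G_def G1_def G2_def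
    by (rule hypergeometric_series[OF pos(1,2) N(1) aeq summ that], assumption)+
  define g g1 g2 where "g = (\<lambda>s. (1 - s) powr D * G s)"
    and "g1 = (\<lambda>s. (1 - s) powr D * G1 s - D * (1 - s) powr (D - 1) * G s)"
    and "g2 = (\<lambda>s. (1 - s) powr D * G2 s - 2 * D * (1 - s) powr (D - 1) * G1 s
        + D * (D - 1) * (1 - s) powr (D - 2) * G s)"
  show ?thesis
  proof (rule that)
    fix s :: real assume s: "\<bar>s\<bar> < 1"
    note d = G(1)[OF s] G(2)[OF s]
    have d0: "((\<lambda>s. (1 - s) powr \<beta>) has_real_derivative - \<beta> * (1 - s) powr (\<beta> - 1)) (at s)" for \<beta>
      by (rule DERIV_one_minus_powr) (use s in simp)
    show "(g has_real_derivative g1 s) (at s)"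
      unfolding g_def g1_def by (rule derivative_eq_intros d d0 refl | simp)+
    have d2: "((\<lambda>s. D * (1 - s) powr (D - 1)) has_real_derivative D * (- (D - 1) * (1 - s) powr (D - 1 - 1))) (at s)"
      by (intro DERIV_cmult d0)
    show "(g1 has_real_derivative g2 s) (at s)"
      unfolding g1_def g2_def
      by (rule derivative_eq_intros d d0[of D] d2 refl)+ (simp add: algebra_simps)
    show "isCont g2 s" unfolding g2_def
      using s G(3)[OF s] DERIV_isCont[OF d(1)] DERIV_isCont[OF d(2)]
      by (intro continuous_intros) auto
    define P where "P = (1 - s) powr D"
    have s1: "1 - s \<noteq> 0" using s by auto
    have p: "(1 - s) powr (D - 1) = P / (1 - s)" "(1 - s) powr (D - 2) = P / (1 - s)\<^sup>2"
      using s by (auto simp: P_def powr_diff)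
    define y where "y = 1 - s"
    have ys: "s = 1 - y" "y \<noteq> 0" using s1 by (auto simp: y_def)
    \<comment> \<open>the factor \<open>(1 - s) powr D\<close> turns the hypergeometric equation of \<open>G\<close> into the radial equation of \<open>g\<close>\<close>
    have "(1 - s) * (s * g2 s + N * g1 s) + 2 * \<theta> * s * g1 s + \<theta> * (N - 1 - \<theta>) * g s
      = P * (s * (1 - s) * G2 s + (N - (A + B + 1) * s) * G1 s - A * B * G s)"
    proof -
      have e: "g s = P * G s" "g1 s = P * G1 s - D * (P / y) * G s"
        "g2 s = P * G2 s - 2 * D * (P / y) * G1 s + D * (D - 1) * (P / y\<^sup>2) * G s"
        unfolding g_def g1_def g2_def p by (simp_all add: P_def y_def)
      show ?thesis
        unfolding e y_def[symmetric] A_def B_def D_def using ys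
        by (simp add: divide_simps power2_eq_square) (simp add: algebra_simps)
    qed
    also have "\<dots> = 0" unfolding G(4)[OF s] by simp
    finally show "(1 - s) * (s * g2 s + N * g1 s) + 2 * \<theta> * s * g1 s + \<theta> * (N - 1 - \<theta>) * g s = 0" .
  next
    have "G 0 = a 0" unfolding G_def by (simp add: powser_zero)
    then show "g 0 = 1" by (simp add: g_def a_def)
    show "g s > 0" if "0 \<le> s" "s < 1" for s
    proof -
      have "G s \<ge> (\<Sum>k\<in>{0}. a k * s ^ k)"
        unfolding G_def using that apos summ[of s] by (intro sum_le_suminf) (auto simp: less_imp_le)
      then have "G s > 0" using apos[of 0] by simp
      then show ?thesis using that by (simp add: g_def)
    qed
    show "\<gamma> > 0" by (fact gpos)
    have "((\<lambda>s. (1 - s) powr D * (\<Sum>k. r k * b k * s ^ k)) \<longlongrightarrow> \<gamma>) (at_left 1)"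
      using bs by (intro abelian_limit[OF _ pos(3) _ r] less_imp_le[OF bpos]) auto
    then show "(g \<longlongrightarrow> \<gamma>) (at_left 1)" unfolding g_def G_def rb .
  qed
qed

section \<open>Boundary behaviour of the radial solution\<close>

text \<open>The facts about the radial solution \<open>x \<mapsto> g (|x|\<^sup>2)\<close> that are used from now on; \<open>N\<close> stands for
half the dimension and \<open>\<gamma>\<close> for the boundary value.\<close>

locale profile =
  fixes N \<theta> \<gamma> :: real and g g1 g2 :: "real \<Rightarrow> real"
  assumes N_ge: "N \<ge> 1" and \<theta>_gt: "\<theta> > - 1 / 2"
    and g_deriv: "\<And>s. \<bar>s\<bar> < 1 \<Longrightarrow> (g has_real_derivative g1 s) (at s)"
    and g1_deriv: "\<And>s. \<bar>s\<bar> < 1 \<Longrightarrow> (g1 has_real_derivative g2 s) (at s)"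
    and g2_cont: "\<And>s. \<bar>s\<bar> < 1 \<Longrightarrow> isCont g2 s"
    and g_ode: "\<And>s. \<bar>s\<bar> < 1 \<Longrightarrow>
      (1 - s) * (s * g2 s + N * g1 s) + 2 * \<theta> * s * g1 s + \<theta> * (N - 1 - \<theta>) * g s = 0"
    and g_0: "g 0 = 1" and g_pos: "\<And>s. 0 \<le> s \<Longrightarrow> s < 1 \<Longrightarrow> g s > 0"
    and \<gamma>_pos: "\<gamma> > 0" and g_lim: "(g \<longlongrightarrow> \<gamma>) (at_left 1)"
begin

text \<open>The continuous extension of the profile to \<open>s = 1\<close>.\<close>

definition gbar :: "real \<Rightarrow> real" where "gbar s = (if s < 1 then g s else \<gamma>)"

lemma gbar_pos: "0 \<le> s \<Longrightarrow> gbar s > 0"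
  using g_pos \<gamma>_pos by (simp add: gbar_def)

lemma continuous_on_gbar: "continuous_on {0..1} gbar"
proof (rule continuous_on_eq_continuous_within[THEN iffD2], intro ballI)
  fix s :: real assume s: "s \<in> {0..1}"
  show "continuous (at s within {0..1}) gbar"
  proof (cases "s < 1")
    case True
    then have "\<forall>\<^sub>F t in nhds s. t < 1" by (rule eventually_nhds_in_open[of "{..<1}", simplified, rotated]) simp
    then have "\<forall>\<^sub>F t in nhds s. gbar t = g t" by eventually_elim (simp add: gbar_def)
    moreover have "isCont g s" using True s by (intro DERIV_isCont[OF g_deriv]) auto
    ultimately have "isCont gbar s" by (simp add: isCont_cong)
    then show ?thesis by (rule continuous_at_imp_continuous_at_within)
  next
    case False
    then have "s = 1" using s by auto
    have "\<forall>\<^sub>F t in at_left 1. g t = gbar t"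
      by (auto simp: eventually_at_filter gbar_def)
    then have "(gbar \<longlongrightarrow> \<gamma>) (at_left 1)" using g_lim by (rule Lim_transform_eventually[rotated])
    then show ?thesis
      unfolding continuous_within \<open>s = 1\<close> by (simp add: at_within_Icc_at_left gbar_def)
  qed
qed

text \<open>The divergence form of the radial equation; \<open>s powr N * (1 - s) powr (- 2 \<theta>)\<close> is its integrating factor.\<close>

lemma flux_derivative:
  assumes "0 < s" "s < 1"
  shows "((\<lambda>s. s powr N * (1 - s) powr (- 2 * \<theta>) * g1 s) has_real_derivative
     - (\<theta> * (N - 1 - \<theta>)) * g s * (s powr N * (1 - s) powr (- 2 * \<theta>)) / (s * (1 - s))) (at s)"
proof -
  have d1: "((\<lambda>s. s powr N) has_real_derivative N * s powr (N - 1)) (at s)"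
    using assms by (auto intro!: derivative_eq_intros)
  have d2: "((\<lambda>s. (1 - s) powr (- 2 * \<theta>)) has_real_derivative - (- 2 * \<theta>) * (1 - s) powr (- 2 * \<theta> - 1)) (at s)"
    using assms by (intro DERIV_one_minus_powr)
  have d3: "(g1 has_real_derivative g2 s) (at s)" using assms by (intro g1_deriv) auto
  define P where "P = s powr N"
  define Q where "Q = (1 - s) powr (- 2 * \<theta>)"
  have p: "s powr (N - 1) = P / s" "(1 - s) powr (- 2 * \<theta> - 1) = Q / (1 - s)"
    using assms by (auto simp: P_def Q_def powr_diff)
  have "(s powr N * (- (- 2 * \<theta>) * (1 - s) powr (- 2 * \<theta> - 1)) + N * s powr (N - 1) * (1 - s) powr (- 2 * \<theta>)) * g1 s
      + g2 s * (s powr N * (1 - s) powr (- 2 * \<theta>))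
     = P * Q / (s * (1 - s)) * ((1 - s) * (s * g2 s + N * g1 s) + 2 * \<theta> * s * g1 s)"
    unfolding p P_def[symmetric] Q_def[symmetric] using assms by (simp add: field_simps)
  also have "(1 - s) * (s * g2 s + N * g1 s) + 2 * \<theta> * s * g1 s = - (\<theta> * (N - 1 - \<theta>)) * g s"
    using g_ode[of s] assms by (simp add: algebra_simps)
  finally have eq: "(s powr N * (- (- 2 * \<theta>) * (1 - s) powr (- 2 * \<theta> - 1)) + N * s powr (N - 1) * (1 - s) powr (- 2 * \<theta>)) * g1 s
      + g2 s * (s powr N * (1 - s) powr (- 2 * \<theta>))
     = - (\<theta> * (N - 1 - \<theta>)) * g s * (s powr N * (1 - s) powr (- 2 * \<theta>)) / (s * (1 - s))"
    unfolding P_def Q_def by (simp add: algebra_simps)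
  show ?thesis
    unfolding eq[symmetric] by (intro DERIV_mult' DERIV_mult d1 d2 d3 derivative_eq_intros | simp add: algebra_simps)+
qed

text \<open>For negative \<open>\<theta>\<close> the zero-order coefficient \<open>\<theta> (N - 1 - \<theta>)\<close> is negative, so the flux increases
from its value \<open>0\<close> at \<open>s = 0\<close> and is at least \<open>\<kappa> = F (1/2) > 0\<close> on the right half. Dividing by the
integrating factor gives the growth of \<open>g1\<close>.\<close>

lemma g1_blowup:
  assumes "\<theta> < 0"
  obtains \<kappa> where "\<kappa> > 0" "\<And>s. 1 / 2 \<le> s \<Longrightarrow> s < 1 \<Longrightarrow> g1 s \<ge> \<kappa> * (1 - s) powr (2 * \<theta>)"
proof -
  define F where "F = (\<lambda>s. s powr N * (1 - s) powr (- 2 * \<theta>) * g1 s)"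
  have c: "- (\<theta> * (N - 1 - \<theta>)) > 0" using assms N_ge by (auto simp: mult_neg_pos)
  have F: "\<exists>y. (F has_real_derivative y) (at s) \<and> y > 0" if "0 < s" "s < 1" for s
  proof (intro exI conjI)
    show "(F has_real_derivative - (\<theta> * (N - 1 - \<theta>)) * g s * (s powr N * (1 - s) powr (- 2 * \<theta>)) / (s * (1 - s))) (at s)"
      unfolding F_def using flux_derivative[OF that] .
    show "0 < - (\<theta> * (N - 1 - \<theta>)) * g s * (s powr N * (1 - s) powr (- 2 * \<theta>)) / (s * (1 - s))"
      using that c g_pos[of s] by (intro divide_pos_pos mult_pos_pos) auto
  qed
  have cont1: "continuous_on {0..1/2} g1"
    by (intro continuous_at_imp_continuous_on ballI DERIV_isCont[OF g1_deriv]) auto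
  have "continuous_on {0..1/2} F"
    unfolding F_def using N_ge by (intro continuous_intros continuous_on_powr' cont1) auto
  moreover have "\<exists>y. (F has_real_derivative y) (at s) \<and> y > 0" if "0 < s" "s < 1/2" for s
    using that by (intro F) auto
  ultimately have "F 0 < F (1/2)" using DERIV_pos_imp_increasing_open[of 0 "1/2" F] by simp
  then have F12: "F (1/2) > 0" using N_ge by (simp add: F_def)
  show ?thesis
  proof (rule that[OF F12])
    fix s :: real assume s: "1/2 \<le> s" "s < 1"
    have "F (1/2) \<le> F s"
    proof (rule DERIV_nonneg_imp_nondecreasing[OF s(1)])
      fix t :: real assume "1/2 \<le> t" "t \<le> s"
      then show "\<exists>y. (F has_real_derivative y) (at t) \<and> 0 \<le> y"
        using F[of t] s by (auto dest: less_imp_le)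
    qed
    also have "F s \<le> (1 - s) powr (- 2 * \<theta>) * g1 s"
    proof -
      have "F s > 0" using \<open>F (1/2) \<le> F s\<close> F12 by simp
      moreover have "s powr N * (1 - s) powr (- 2 * \<theta>) > 0" using s by simp
      ultimately have "g1 s > 0" unfolding F_def by (rule zero_less_mult_pos)
      moreover have "s powr N \<le> 1" using s N_ge by (simp add: powr_le1)
      ultimately show ?thesis unfolding F_def
        by (intro mult_right_mono mult_left_le_one_le) auto
    qed
    finally have "F (1/2) * (1 - s) powr (2 * \<theta>) \<le> (1 - s) powr (- 2 * \<theta>) * g1 s * (1 - s) powr (2 * \<theta>)"
      by (intro mult_right_mono) auto
    also have "\<dots> = g1 s" using s by (simp add: powr_minus field_simps)
    finally show "F (1/2) * (1 - s) powr (2 * \<theta>) \<le> g1 s" .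
  qed
qed

text \<open>On \<open>[1/2, 1)\<close> the derivative of the flux \<open>F\<close> is at most a constant times
\<open>(1 - s) powr (- 2 \<theta> - 1)\<close>, which has the antiderivative \<open>E\<close>. Thus \<open>E - F\<close> and \<open>E + F\<close> are nondecreasing, the flux is
of the order of \<open>(1 - s) powr (- 2 \<theta>)\<close>, and this is the order of the integrating factor.\<close>

lemma g1_bounded:
  assumes "\<theta> > 0"
  obtains B where "\<And>s. 0 \<le> s \<Longrightarrow> s < 1 \<Longrightarrow> \<bar>g1 s\<bar> \<le> B"
proof -
  define F where "F = (\<lambda>s. s powr N * (1 - s) powr (- 2 * \<theta>) * g1 s)"
  define c where "c = \<theta> * (N - 1 - \<theta>)"
  have "compact (gbar ` {0..1})" by (intro compact_continuous_image continuous_on_gbar compact_Icc)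
  then obtain M where M: "M > 0" "\<And>s. s \<in> {0..1} \<Longrightarrow> \<bar>gbar s\<bar> \<le> M"
    using compact_imp_bounded bounded_pos by (metis imageI real_norm_def)
  define C where "C = 2 * \<bar>c\<bar> * M"
  have C: "C \<ge> 0" using M by (simp add: C_def)
  define E where "E = (\<lambda>s. C / (2 * \<theta>) * (1 - s) powr (- 2 * \<theta>))"
  have E: "(E has_real_derivative C * (1 - s) powr (- 2 * \<theta> - 1)) (at s)" if "s < 1" for s
    unfolding E_def using DERIV_cmult[OF DERIV_one_minus_powr[OF that, of "- 2 * \<theta>"], of "C / (2 * \<theta>)"] assms by simp
  have F: "\<exists>D. (F has_real_derivative D) (at s) \<and> \<bar>D\<bar> \<le> C * (1 - s) powr (- 2 * \<theta> - 1)"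
    if s: "1/2 \<le> s" "s < 1" for s
  proof (intro exI conjI)
    show "(F has_real_derivative - c * g s * (s powr N * (1 - s) powr (- 2 * \<theta>)) / (s * (1 - s))) (at s)"
      unfolding F_def c_def using s by (intro flux_derivative) auto
    have g: "0 < g s" "g s \<le> M" using M(2)[of s] s g_pos[of s] by (auto simp: gbar_def)
    have "\<bar>- c * g s * (s powr N * (1 - s) powr (- 2 * \<theta>)) / (s * (1 - s))\<bar>
        = \<bar>c\<bar> * g s * (s powr N / s) * ((1 - s) powr (- 2 * \<theta>) / (1 - s))"
      using s g by (simp add: abs_mult)
    also have "\<dots> \<le> \<bar>c\<bar> * M * 2 * ((1 - s) powr (- 2 * \<theta>) / (1 - s))"
    proof (intro mult_right_mono mult_mono mult_left_mono)
      have "s powr N \<le> 1" using s N_ge by (simp add: powr_le1)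
      then show "s powr N / s \<le> 2" using s by (simp add: divide_le_eq)
    qed (use s g M in auto)
    also have "(1 - s) powr (- 2 * \<theta>) / (1 - s) = (1 - s) powr (- 2 * \<theta> - 1)"
      using s by (simp add: powr_diff)
    finally show "\<bar>- c * g s * (s powr N * (1 - s) powr (- 2 * \<theta>)) / (s * (1 - s))\<bar>
        \<le> C * (1 - s) powr (- 2 * \<theta> - 1)" unfolding C_def by (simp add: mult_ac)
  qed
  define B1 where "B1 = 2 powr N * (\<bar>F (1/2)\<bar> + C / (2 * \<theta>))"
  have b1: "\<bar>g1 s\<bar> \<le> B1" if s: "1/2 \<le> s" "s < 1" for s
  proof -
    have "E (1/2) - F (1/2) \<le> E s - F s"
    proof (rule DERIV_nonneg_imp_nondecreasing[OF s(1)])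
      fix t assume "1/2 \<le> t" "t \<le> s"
      then obtain D where "(F has_real_derivative D) (at t)" "\<bar>D\<bar> \<le> C * (1 - t) powr (- 2 * \<theta> - 1)"
        using F[of t] s by auto
      then show "\<exists>y. ((\<lambda>x. E x - F x) has_real_derivative y) (at t) \<and> 0 \<le> y"
        using E[of t] \<open>t \<le> s\<close> s by (intro exI[of _ "C * (1 - t) powr (- 2 * \<theta> - 1) - D"]) (auto intro!: DERIV_diff)
    qed
    moreover have "E (1/2) + F (1/2) \<le> E s + F s"
    proof (rule DERIV_nonneg_imp_nondecreasing[OF s(1)])
      fix t assume "1/2 \<le> t" "t \<le> s"
      then obtain D where "(F has_real_derivative D) (at t)" "\<bar>D\<bar> \<le> C * (1 - t) powr (- 2 * \<theta> - 1)"
        using F[of t] s by auto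
      then show "\<exists>y. ((\<lambda>x. E x + F x) has_real_derivative y) (at t) \<and> 0 \<le> y"
        using E[of t] \<open>t \<le> s\<close> s by (intro exI[of _ "C * (1 - t) powr (- 2 * \<theta> - 1) + D"]) (auto intro!: DERIV_add)
    qed
    moreover have "E (1/2) \<ge> 0" using C assms by (simp add: E_def)
    ultimately have "\<bar>F s\<bar> \<le> \<bar>F (1/2)\<bar> + E s" by linarith
    moreover have "\<bar>F s\<bar> = s powr N * (1 - s) powr (- 2 * \<theta>) * \<bar>g1 s\<bar>" using s by (simp add: F_def abs_mult)
    ultimately have 1: "s powr N * (1 - s) powr (- 2 * \<theta>) * \<bar>g1 s\<bar> \<le> \<bar>F (1/2)\<bar> + E s" by simp
    have q: "(1 - s) powr (2 * \<theta>) * (1 - s) powr (- 2 * \<theta>) = 1" using s by (simp add: powr_minus)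
    have q1: "(1 - s) powr (2 * \<theta>) \<le> 1" using s assms by (simp add: powr_le1)
    have "s powr N * \<bar>g1 s\<bar> = (1 - s) powr (2 * \<theta>) * (s powr N * (1 - s) powr (- 2 * \<theta>) * \<bar>g1 s\<bar>)"
      using q by (metis (no_types, opaque_lifting) mult.assoc mult.commute mult.left_neutral)
    also have "\<dots> \<le> (1 - s) powr (2 * \<theta>) * (\<bar>F (1/2)\<bar> + E s)"
      using 1 by (intro mult_left_mono) auto
    also have "\<dots> = (1 - s) powr (2 * \<theta>) * \<bar>F (1/2)\<bar> + C / (2 * \<theta>) * ((1 - s) powr (2 * \<theta>) * (1 - s) powr (- 2 * \<theta>))"
      by (simp add: E_def algebra_simps)
    also have "\<dots> \<le> \<bar>F (1/2)\<bar> + C / (2 * \<theta>)"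
      unfolding q using q1 by (auto intro: mult_left_le_one_le)
    finally have 2: "s powr N * \<bar>g1 s\<bar> \<le> \<bar>F (1/2)\<bar> + C / (2 * \<theta>)" .
    have "1 \<le> 2 powr N * s powr N"
      using s N_ge by (simp add: powr_mult[symmetric] ge_one_powr_ge_zero)
    then have "\<bar>g1 s\<bar> \<le> 2 powr N * s powr N * \<bar>g1 s\<bar>" by (simp add: mult_le_cancel_right1)
    also have "\<dots> = 2 powr N * (s powr N * \<bar>g1 s\<bar>)" by simp
    also have "\<dots> \<le> B1" unfolding B1_def using 2 by (intro mult_left_mono) auto
    finally show ?thesis .
  qed
  have "continuous_on {0..1/2} g1"
    by (intro continuous_at_imp_continuous_on ballI DERIV_isCont[OF g1_deriv]) auto
  then have "compact (g1 ` {0..1/2})" by (intro compact_continuous_image compact_Icc)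
  then obtain B0 where B0: "\<And>s. s \<in> {0..1/2} \<Longrightarrow> \<bar>g1 s\<bar> \<le> B0"
    using compact_imp_bounded bounded_pos by (metis imageI real_norm_def)
  show ?thesis
  proof (rule that[of "max B0 B1"])
    fix s :: real assume "0 \<le> s" "s < 1"
    then show "\<bar>g1 s\<bar> \<le> max B0 B1" using B0[of s] b1[of s] by (cases "s \<le> 1/2") auto
  qed
qed

end

lemma profile_exists:
  assumes "\<theta> > - 1 / 2" "N \<ge> 1"
  obtains \<gamma> g g1 g2 where "profile N \<theta> \<gamma> g g1 g2"
proof -
  have N: "N > 0" "N + \<theta> > 0" using assms by auto
  show ?thesis
    by (rule hypergeometric_profile[OF N assms(1)], rule that, unfold_locales) (use assms in auto)
qed

section \<open>Uniqueness, and negative parameters\<close>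

text \<open>The hypothesis that \<open>u\<close> solves the Dirichlet problem, in the form in which the comparison
principle consumes it.\<close>

lemma dirichlet_solution_jet:
  assumes "dirichlet_solution \<theta> \<phi> u"
  obtains u1 u2 U where "C2_jet (ball 0 1) u u1 u2" "\<And>x. x \<in> ball 0 1 \<Longrightarrow> L_jet \<theta> u u1 u2 x = 0"
    "continuous_on (cball 0 1) U" "\<And>x. x \<in> ball 0 1 \<Longrightarrow> U x = u x"
    "\<And>\<zeta>. \<zeta> \<in> sphere 0 1 \<Longrightarrow> U \<zeta> = \<phi> \<zeta>"
proof -
  note J = C2_jet_if_C_k_on_2[of "ball 0 1" u]
  have C: "C_k_on 2 (ball 0 1) u" and D: "\<forall>x\<in>ball 0 1. Delta_theta \<theta> u x = 0"
    using assms unfolding dirichlet_solution_def by blast+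
  show ?thesis
    using that[OF J[OF C]] assms D L_jet_eq_0_iff_Delta_theta[OF J[OF C]]
    unfolding dirichlet_solution_def by blast
qed

lemma dirichlet_solutionI:
  assumes "C2_jet (ball 0 1) u u1 u2" "\<And>x. x \<in> ball 0 1 \<Longrightarrow> L_jet \<theta> u u1 u2 x = 0"
    "continuous_on (cball 0 1) U" "\<And>x. x \<in> ball 0 1 \<Longrightarrow> U x = u x"
    "\<And>\<zeta>. \<zeta> \<in> sphere 0 1 \<Longrightarrow> U \<zeta> = \<phi> \<zeta>"
  shows "dirichlet_solution \<theta> \<phi> u"
  unfolding dirichlet_solution_def
  using C_k_on_2_if_C2_jet[OF assms(1)] L_jet_eq_0_iff_Delta_theta[OF assms(1)] assms(2-) by auto

lemma profile_jet:
  fixes \<theta> :: real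
  assumes "profile (real CARD('n::finite) / 2) \<theta> \<gamma> g g1 g2"
  obtains u1 and u2 :: "'n \<Rightarrow> 'n \<Rightarrow> real ^ 'n \<Rightarrow> real" where
    "C2_jet (ball 0 1) (\<lambda>x. g ((norm x)\<^sup>2)) u1 u2"
    "\<And>x. x \<in> ball 0 1 \<Longrightarrow> L_jet \<theta> (\<lambda>x. g ((norm x)\<^sup>2)) u1 u2 x = 0"
proof -
  interpret profile "real CARD('n) / 2" \<theta> \<gamma> g g1 g2 by fact
  have 1: "\<bar>(norm (x - 0))\<^sup>2\<bar> < 1" if "x \<in> ball 0 1" for x :: "real ^ 'n"
    using norm_sq_less_1[OF that] by simp
  note J = C2_jet_fun_sqdist[of "ball (0 :: real ^ 'n) 1" g g1 0 g2, OF g_deriv[OF 1] g1_deriv[OF 1] g2_cont[OF 1]]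
  show ?thesis
  proof (rule that)
    show "C2_jet (ball (0 :: real ^ 'n) 1) (\<lambda>x. g ((norm x)\<^sup>2)) (sqdist_jet1 0 g1) (sqdist_jet2 0 g1 g2)"
      by (rule C2_jet_cong[OF J]) simp_all
  next
    fix x :: "real ^ 'n" assume "x \<in> ball 0 1"
    then have "(1 - (norm x)\<^sup>2) * ((norm x)\<^sup>2 * g2 ((norm x)\<^sup>2) + real CARD('n) / 2 * g1 ((norm x)\<^sup>2))
      + 2 * \<theta> * (norm x)\<^sup>2 * g1 ((norm x)\<^sup>2) + \<theta> * (real CARD('n) / 2 - 1 - \<theta>) * g ((norm x)\<^sup>2) = 0"
      using g_ode[of "(norm x)\<^sup>2"] 1[of x] by simp
    then show "L_jet \<theta> (\<lambda>x. g ((norm x)\<^sup>2)) (sqdist_jet1 0 g1) (sqdist_jet2 0 g1 g2) x = 0"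
      unfolding L_jet_fun_sqdist unfolding diff_0_right power2_norm_eq_inner[symmetric]
      by (simp add: field_simps)
  qed
qed

lemma continuous_on_gbar_norm_sq:
  assumes "profile N \<theta> \<gamma> g g1 g2"
  shows "continuous_on (cball (0 :: real ^ 'n::finite) 1) (\<lambda>x. profile.gbar \<gamma> g ((norm x)\<^sup>2))"
proof -
  have "(norm x)\<^sup>2 \<in> {0..1}" if "x \<in> cball 0 1" for x :: "real ^ 'n"
    using that by (simp add: power_le_one)
  then show ?thesis
    by (intro continuous_on_compose2[OF profile.continuous_on_gbar[OF assms], of _ "\<lambda>x. (norm x)\<^sup>2"])
       (auto intro!: continuous_intros)
qed

lemma continuous_on_defect_power:
  assumes "\<beta> > 0"
  shows "continuous_on (cball (0 :: real ^ 'n::finite) 1) (\<lambda>x. (1 - (norm x)\<^sup>2) powr \<beta>)"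
  using assms by (intro continuous_on_powr' continuous_intros) (auto simp: power_le_one)

text \<open>The radial solution is positive up to the sphere but only satisfies \<open>L h = 0\<close>; the
power of \<open>1 - |x|\<^sup>2\<close> is strict but vanishes on the sphere. The sum has both properties.\<close>

lemma positive_strict_supersolution:
  fixes \<theta> :: real
  assumes "CARD('n::finite) \<ge> 2" "\<theta> > - 1 / 2"
  obtains G :: "real ^ 'n \<Rightarrow> real" and G1 G2 where
    "C2_jet (ball 0 1) G G1 G2" "\<And>x. x \<in> ball 0 1 \<Longrightarrow> L_jet \<theta> G G1 G2 x < 0"
    "continuous_on (cball 0 1) G" "\<And>x. x \<in> cball 0 1 \<Longrightarrow> G x > 0"
proof -
  have N: "real CARD('n) / 2 \<ge> 1" using assms(1) by simp
  obtain \<gamma> g g1 g2 where P: "profile (real CARD('n) / 2) \<theta> \<gamma> g g1 g2"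
    using profile_exists[OF assms(2) N] by blast
  interpret profile "real CARD('n) / 2" \<theta> \<gamma> g g1 g2 by (fact P)
  obtain h1 and h2 :: "'n \<Rightarrow> 'n \<Rightarrow> real ^ 'n \<Rightarrow> real" where h:
    "C2_jet (ball 0 1) (\<lambda>x. g ((norm x)\<^sup>2)) h1 h2"
    "\<And>x. x \<in> ball 0 1 \<Longrightarrow> L_jet \<theta> (\<lambda>x. g ((norm x)\<^sup>2)) h1 h2 x = 0"
    using profile_jet[OF P] by blast
  obtain H1 and H2 :: "'n \<Rightarrow> 'n \<Rightarrow> real ^ 'n \<Rightarrow> real" where H:
    "C2_jet (ball 0 1) (\<lambda>x. (1 - (norm x)\<^sup>2) powr (\<theta> + 1 / 2)) H1 H2"
    "\<And>x. x \<in> ball 0 1 \<Longrightarrow> L_jet \<theta> (\<lambda>x. (1 - (norm x)\<^sup>2) powr (\<theta> + 1 / 2)) H1 H2 x < 0"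
    using strict_supersolution[OF assms(2)] by blast
  define G where "G = (\<lambda>x :: real ^ 'n. gbar ((norm x)\<^sup>2) + (1 - (norm x)\<^sup>2) powr (\<theta> + 1 / 2))"
  have eq: "G x = g ((norm x)\<^sup>2) + (1 - (norm x)\<^sup>2) powr (\<theta> + 1 / 2)" if "x \<in> ball 0 1" for x
    using norm_sq_less_1[OF that] by (simp add: G_def gbar_def)
  show ?thesis
  proof (rule that)
    show "C2_jet (ball 0 1) G (\<lambda>j x. h1 j x + H1 j x) (\<lambda>j k x. h2 j k x + H2 j k x)"
      by (rule C2_jet_cong[OF C2_jet_add[OF h(1) H(1)]]) (simp_all add: eq)
    show "L_jet \<theta> G (\<lambda>j x. h1 j x + H1 j x) (\<lambda>j k x. h2 j k x + H2 j k x) x < 0"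
      if "x \<in> ball 0 1" for x
      using h(2)[OF that] H(2)[OF that]
      by (subst L_jet_cong[of "\<lambda>x. g ((norm x)\<^sup>2) + (1 - (norm x)\<^sup>2) powr (\<theta> + 1 / 2)"])
         (simp_all add: eq[OF that] L_jet_add)
    show "continuous_on (cball 0 1) G"
      unfolding G_def using assms
      by (intro continuous_on_add continuous_on_gbar_norm_sq[OF P] continuous_on_defect_power) auto
    show "G x > 0" if "x \<in> cball 0 1" for x
      unfolding G_def by (intro add_pos_nonneg gbar_pos) auto
  qed
qed

lemma maximum_principle:
  fixes w W :: "real ^ 'n::finite \<Rightarrow> real"
  assumes "CARD('n) \<ge> 2" "\<theta> > - 1 / 2"
    and "C2_jet (ball 0 1) w w1 w2" "\<And>x. x \<in> ball 0 1 \<Longrightarrow> L_jet \<theta> w w1 w2 x \<ge> 0"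
    and "continuous_on (cball 0 1) W" "\<And>x. x \<in> ball 0 1 \<Longrightarrow> W x = w x"
        "\<And>x. x \<in> sphere 0 1 \<Longrightarrow> W x \<le> 0"
    and "x \<in> ball 0 1"
  shows "w x \<le> 0"
proof -
  obtain G :: "real ^ 'n \<Rightarrow> real" and G1 G2 where
    "C2_jet (ball 0 1) G G1 G2" "\<And>x. x \<in> ball 0 1 \<Longrightarrow> L_jet \<theta> G G1 G2 x < 0"
    "continuous_on (cball 0 1) G" "\<And>x. x \<in> cball 0 1 \<Longrightarrow> G x > 0"
    using positive_strict_supersolution[OF assms(1,2)] by blast
  then show ?thesis using comparison_principle[of 1 w w1 w2 \<theta> W G G1 G2 x] assms(3-) by simp
qed

lemma dirichlet_solution_le:
  fixes u v :: "real ^ 'n::finite \<Rightarrow> real"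
  assumes n: "CARD('n) \<ge> 2" and th: "\<theta> > - 1 / 2"
    and u: "dirichlet_solution \<theta> \<phi> u" and v: "dirichlet_solution \<theta> \<psi> v"
    and le: "\<And>\<zeta>. \<zeta> \<in> sphere 0 1 \<Longrightarrow> \<phi> \<zeta> \<le> \<psi> \<zeta>" and x: "x \<in> ball 0 1"
  shows "u x \<le> v x"
proof -
  obtain u1 u2 U where U: "C2_jet (ball 0 1) u u1 u2" "\<And>x. x \<in> ball 0 1 \<Longrightarrow> L_jet \<theta> u u1 u2 x = 0"
    "continuous_on (cball 0 1) U" "\<And>x. x \<in> ball 0 1 \<Longrightarrow> U x = u x"
    "\<And>\<zeta>. \<zeta> \<in> sphere 0 1 \<Longrightarrow> U \<zeta> = \<phi> \<zeta>"
    using dirichlet_solution_jet[OF u] by blast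
  obtain v1 v2 V where V: "C2_jet (ball 0 1) v v1 v2" "\<And>x. x \<in> ball 0 1 \<Longrightarrow> L_jet \<theta> v v1 v2 x = 0"
    "continuous_on (cball 0 1) V" "\<And>x. x \<in> ball 0 1 \<Longrightarrow> V x = v x"
    "\<And>\<zeta>. \<zeta> \<in> sphere 0 1 \<Longrightarrow> V \<zeta> = \<psi> \<zeta>"
    using dirichlet_solution_jet[OF v] by blast
  have "u x + (- 1) * v x \<le> 0"
  proof (rule maximum_principle[OF n th C2_jet_add[OF U(1) C2_jet_cmult[OF V(1), of "- 1"]]])
    show "0 \<le> L_jet \<theta> (\<lambda>x. u x + - 1 * v x) (\<lambda>j x. u1 j x + - 1 * v1 j x) (\<lambda>j k x. u2 j k x + - 1 * v2 j k x) x"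
      if "x \<in> ball 0 1" for x
      unfolding L_jet_add L_jet_cmult U(2)[OF that] V(2)[OF that] by simp
    show "continuous_on (cball 0 1) (\<lambda>x. U x + (- 1) * V x)"
      by (intro continuous_intros U(3) V(3))
  qed (use U(4,5) V(4,5) le x in auto)
  then show ?thesis by simp
qed

lemma dirichlet_solution_unique:
  fixes u v :: "real ^ 'n::finite \<Rightarrow> real"
  assumes "CARD('n) \<ge> 2" "\<theta> > - 1 / 2" "dirichlet_solution \<theta> \<phi> u" "dirichlet_solution \<theta> \<phi> v"
    and "x \<in> ball 0 1"
  shows "u x = v x"
  using dirichlet_solution_le[OF assms(1-4) _ assms(5)] dirichlet_solution_le[OF assms(1,2,4,3) _ assms(5)]
  by force

text \<open>The tool for refuting Lipschitz continuity: it turns an unbounded derivative along a line into a contradiction.\<close>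

lemma lipschitz_on_derivative_bound:
  fixes u :: "'a::real_normed_vector \<Rightarrow> real"
  assumes L: "L-lipschitz_on S u" and "open S" "x \<in> S"
    and d: "((\<lambda>t. u (x + t *\<^sub>R v)) has_real_derivative D) (at 0)"
  shows "\<bar>D\<bar> \<le> L * norm v"
proof -
  have "((\<lambda>t. x + t *\<^sub>R v) \<longlongrightarrow> x + 0 *\<^sub>R v) (at 0)" by (intro tendsto_intros)
  then have "\<forall>\<^sub>F t in at 0. x + t *\<^sub>R v \<in> S"
    using assms(2,3) by (auto dest: topological_tendstoD)
  then have "\<forall>\<^sub>F t in at 0. norm ((u (x + t *\<^sub>R v) - u (x + 0 *\<^sub>R v)) / (t - 0)) \<le> L * norm v"
    using eventually_neq_at_within[of 0 0 UNIV]
  proof eventually_elim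
    case (elim t)
    have "\<bar>u (x + t *\<^sub>R v) - u x\<bar> \<le> L * norm (t *\<^sub>R v)"
      using lipschitz_onD[OF L elim(1) \<open>x \<in> S\<close>] by (simp add: dist_norm)
    then show ?case using elim(2) by (simp add: divide_le_eq mult_ac)
  qed
  then have "norm D \<le> L * norm v"
    using d unfolding has_field_derivative_iff by (intro Lim_norm_ubound[OF trivial_limit_at]) auto
  then show ?thesis by simp
qed

text \<open>The solution is the radial one, divided by its boundary value; by uniqueness every solution
with this data has its unbounded radial derivative.\<close>

lemma constant_data_not_lipschitz:
  fixes \<theta> :: real
  assumes n: "CARD('n::finite) \<ge> 2" and th: "- 1 / 2 < \<theta>" "\<theta> < 0"
  shows "\<exists>u :: real ^ 'n \<Rightarrow> real. dirichlet_solution \<theta> (\<lambda>_. 1) u"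
    and "dirichlet_solution \<theta> (\<lambda>_. 1) (u :: real ^ 'n \<Rightarrow> real) \<Longrightarrow> \<not> lipschitz_continuous_on (ball 0 1) u"
proof -
  have N: "real CARD('n) / 2 \<ge> 1" using assms(1) by simp
  obtain \<gamma> g g1 g2 where P: "profile (real CARD('n) / 2) \<theta> \<gamma> g g1 g2"
    using profile_exists[OF th(1) N] by blast
  interpret profile "real CARD('n) / 2" \<theta> \<gamma> g g1 g2 by (fact P)
  obtain h1 and h2 :: "'n \<Rightarrow> 'n \<Rightarrow> real ^ 'n \<Rightarrow> real" where h:
    "C2_jet (ball 0 1) (\<lambda>x. g ((norm x)\<^sup>2)) h1 h2"
    "\<And>x. x \<in> ball 0 1 \<Longrightarrow> L_jet \<theta> (\<lambda>x. g ((norm x)\<^sup>2)) h1 h2 x = 0"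
    using profile_jet[OF P] by blast
  have sol: "dirichlet_solution \<theta> (\<lambda>_. 1) (\<lambda>x :: real ^ 'n. (1 / \<gamma>) * g ((norm x)\<^sup>2))"
  proof (rule dirichlet_solutionI[OF C2_jet_cmult[OF h(1)]])
    show "L_jet \<theta> (\<lambda>x. (1 / \<gamma>) * g ((norm x)\<^sup>2)) (\<lambda>j x. (1 / \<gamma>) * h1 j x) (\<lambda>j k x. (1 / \<gamma>) * h2 j k x) x = 0"
      if "x \<in> ball 0 1" for x
      unfolding L_jet_cmult h(2)[OF that] by simp
    show "continuous_on (cball (0 :: real ^ 'n) 1) (\<lambda>x. (1 / \<gamma>) * gbar ((norm x)\<^sup>2))"
      by (intro continuous_intros continuous_on_gbar_norm_sq[OF P])
    show "(1 / \<gamma>) * gbar ((norm x)\<^sup>2) = (1 / \<gamma>) * g ((norm x)\<^sup>2)" if "x \<in> ball 0 1" for x :: "real ^ 'n"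
      using norm_sq_less_1[OF that] by (simp add: gbar_def)
    show "(1 / \<gamma>) * gbar ((norm \<zeta>)\<^sup>2) = 1" if "\<zeta> \<in> sphere 0 1" for \<zeta> :: "real ^ 'n"
      using that \<gamma>_pos by (simp add: gbar_def)
  qed
  then show "\<exists>u :: real ^ 'n \<Rightarrow> real. dirichlet_solution \<theta> (\<lambda>_. 1) u" by blast
  assume u: "dirichlet_solution \<theta> (\<lambda>_. 1) u"
  show "\<not> lipschitz_continuous_on (ball 0 1) u"
  proof
    assume "lipschitz_continuous_on (ball 0 1) u"
    then obtain L where L: "L-lipschitz_on (ball 0 1) u" unfolding lipschitz_continuous_on_def by blast
    have L': "L-lipschitz_on (ball (0 :: real ^ 'n) 1) (\<lambda>x. (1 / \<gamma>) * g ((norm x)\<^sup>2))"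
      by (rule lipschitz_on_transform[OF L]) (rule dirichlet_solution_unique[OF n th(1) sol u])
    obtain \<kappa> where \<kappa>: "\<kappa> > 0" "\<And>s. 1 / 2 \<le> s \<Longrightarrow> s < 1 \<Longrightarrow> g1 s \<ge> \<kappa> * (1 - s) powr (2 * \<theta>)"
      using g1_blowup[OF th(2)] by blast
    define M where "M = L * \<gamma> / \<kappa> + 1"
    have "L \<ge> 0" using L by (rule lipschitz_on_nonneg)
    then have M: "M \<ge> 1" using \<kappa>(1) \<gamma>_pos by (simp add: M_def)
    \<comment> \<open>so close to the sphere that \<open>y powr (2 * \<theta>)\<close> is at least \<open>M\<close>, the exponent being negative\<close>
    define y where "y = min (1/2) (M powr (1 / (2 * \<theta>)))"
    have y: "0 < y" "y \<le> 1/2" using M by (auto simp: y_def)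
    have "(M powr (1 / (2 * \<theta>))) powr (2 * \<theta>) \<le> y powr (2 * \<theta>)"
      using y th by (intro powr_mono2') (auto simp: y_def)
    then have My: "M \<le> y powr (2 * \<theta>)" using M th by (simp add: powr_powr)
    define s where "s = 1 - y"
    have s: "1/2 \<le> s" "s < 1" using y by (auto simp: s_def)
    define t where "t = sqrt s"
    have t: "t\<^sup>2 = s" "t \<ge> 1/2" "t < 1"
    proof -
      show "t\<^sup>2 = s" using s by (simp add: t_def)
      have "(1/2)\<^sup>2 \<le> s" using s by (simp add: power2_eq_square)
      then show "t \<ge> 1/2" unfolding t_def by (rule real_le_rsqrt)
      show "t < 1" using s by (simp add: t_def)
    qed
    obtain k :: 'n where True by simp
    define x :: "real ^ 'n" where "x = t *\<^sub>R axis k 1"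
    have xb: "x \<in> ball 0 1" and nx: "(norm (x - 0))\<^sup>2 = s" using t by (auto simp: x_def)
    have "(g has_real_derivative g1 s) (at ((norm (x - 0))\<^sup>2))"
      unfolding nx using s by (intro g_deriv) auto
    from DERIV_cmult[OF fun_sqdist_has_derivative_along_line[OF this, of "axis k 1"], of "1 / \<gamma>"]
    have "((\<lambda>\<tau>. (1 / \<gamma>) * g ((norm (x + \<tau> *\<^sub>R axis k 1))\<^sup>2)) has_real_derivative (1 / \<gamma>) * (2 * t * g1 s)) (at 0)"
      by (simp add: x_def inner_axis)
    from lipschitz_on_derivative_bound[OF L' open_ball xb this]
    have "\<bar>(1 / \<gamma>) * (2 * t * g1 s)\<bar> \<le> L" unfolding norm_axis_1 by simp
    then have "(1 / \<gamma>) * (2 * t * g1 s) \<le> L" by linarith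
    then have "2 * t * g1 s \<le> L * \<gamma>" using \<gamma>_pos by (simp add: divide_le_eq)
    moreover have "g1 s \<ge> \<kappa> * M" using \<kappa>(2)[OF s] My \<kappa>(1) unfolding s_def
      by (smt (verit) mult_left_mono)
    moreover have "\<kappa> * M > L * \<gamma>" using \<kappa>(1) by (simp add: M_def field_simps)
    moreover have "\<kappa> * M > 0" using \<kappa> M by simp
    ultimately have "2 * t * g1 s < g1 s" "g1 s > 0" by linarith+
    then show False using t(2) mult_right_mono[of 1 "2 * t" "g1 s"] by simp
  qed
qed

section \<open>Parameter zero: a harmonic function\<close>

lemma two_coordinates_le_norm:
  fixes v :: "real ^ 'n::finite"
  assumes "i \<noteq> k"
  shows "(v $ i)\<^sup>2 + (v $ k)\<^sup>2 \<le> (norm v)\<^sup>2"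
proof -
  have "(\<Sum>j\<in>{i, k}. (v $ j)\<^sup>2) \<le> (\<Sum>j\<in>UNIV. (v $ j)\<^sup>2)"
    by (intro sum_mono2) auto
  then show ?thesis using assms by (simp add: norm_vec_def L2_set_def sum_nonneg)
qed

text \<open>The real part of \<open>(1 - z) log (1 - z)\<close> at \<open>z = x\<^sub>i + \<i> x\<^sub>k\<close>. With the conventions
\<open>ln 0 = 0\<close> and \<open>b / 0 = 0\<close> the formula has the correct value \<open>0\<close> at the singular boundary point as well, so
the same function serves as solution, extension and boundary data.\<close>

definition log_data :: "'n::finite \<Rightarrow> 'n \<Rightarrow> real ^ 'n \<Rightarrow> real" where
  "log_data i k x = (1 - x $ i) * (ln ((1 - x $ i)\<^sup>2 + (x $ k)\<^sup>2) / 2) - x $ k * arctan (x $ k / (1 - x $ i))"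

lemma DERIV_ln_modulus:
  assumes "a > 0"
  shows "((\<lambda>t. ln ((a - t * p)\<^sup>2 + (b + t * q)\<^sup>2) / 2) has_real_derivative
      (b * q - a * p) / (a\<^sup>2 + b\<^sup>2)) (at 0)"
proof -
  have "a\<^sup>2 + b\<^sup>2 > 0" using assms by (simp add: add_pos_nonneg)
  then have "(ln has_real_derivative 1 / (a\<^sup>2 + b\<^sup>2)) (at ((a - 0 * p)\<^sup>2 + (b + 0 * q)\<^sup>2))"
    using DERIV_ln_divide[of "a\<^sup>2 + b\<^sup>2"] by simp
  moreover have "((\<lambda>t. (a - t * p)\<^sup>2 + (b + t * q)\<^sup>2) has_real_derivative 2 * (b * q - a * p)) (at 0)"
    by (auto intro!: derivative_eq_intros)
  ultimately have "((\<lambda>t. ln ((a - t * p)\<^sup>2 + (b + t * q)\<^sup>2) / 2) has_real_derivative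
      1 / (a\<^sup>2 + b\<^sup>2) * (2 * (b * q - a * p)) / 2) (at 0)"
    by (intro DERIV_cdivide DERIV_chain2[of ln])
  moreover have "1 / R * (2 * X) / 2 = X / R" for R X :: real by simp
  ultimately show ?thesis by metis
qed

lemma DERIV_arctan_quotient:
  assumes "a > 0"
  shows "((\<lambda>t. arctan ((b + t * q) / (a - t * p))) has_real_derivative
      (a * q + b * p) / (a\<^sup>2 + b\<^sup>2)) (at 0)"
proof -
  have "a\<^sup>2 + b\<^sup>2 > 0" using assms by (simp add: add_pos_nonneg)
  moreover have "((\<lambda>t. (b + t * q) / (a - t * p)) has_real_derivative (a * q + b * p) / a\<^sup>2) (at 0)"
    using assms by (auto intro!: derivative_eq_intros simp: power2_eq_square)
  ultimately show ?thesis using assms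
    by (auto intro!: derivative_eq_intros simp: divide_simps add_nonneg_eq_0_iff)
      (simp add: algebra_simps power2_eq_square)
qed

text \<open>The complex derivative of \<open>(1 - z) log (1 - z)\<close> is \<open>- log (1 - z) - 1\<close>; the formula is the real
part of its product with \<open>v\<^sub>i + \<i> v\<^sub>k\<close>.\<close>

lemma DERIV_log_data:
  fixes x v :: "real ^ 'n::finite"
  assumes "x $ i < 1"
  shows "((\<lambda>t. log_data i k (x + t *\<^sub>R v)) has_real_derivative
     - v $ i * (ln ((1 - x $ i)\<^sup>2 + (x $ k)\<^sup>2) / 2 + 1) - v $ k * arctan (x $ k / (1 - x $ i))) (at 0)"
proof -
  define a b p q where "a = 1 - x $ i" and "b = x $ k" and "p = v $ i" and "q = v $ k"
  have a: "a > 0" using assms by (simp add: a_def)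
  have ab: "a\<^sup>2 + b\<^sup>2 > 0" using a by (simp add: add_pos_nonneg)
  have "((\<lambda>t. a - t * p) has_real_derivative - p) (at 0)" "((\<lambda>t. b + t * q) has_real_derivative q) (at 0)"
    by (auto intro!: derivative_eq_intros)
  from DERIV_diff[OF DERIV_mult[OF this(1) DERIV_ln_modulus[OF a, of p b q]]
    DERIV_mult[OF this(2) DERIV_arctan_quotient[OF a, of b q p]]]
  have "((\<lambda>t. (a - t * p) * (ln ((a - t * p)\<^sup>2 + (b + t * q)\<^sup>2) / 2) - (b + t * q) * arctan ((b + t * q) / (a - t * p)))
    has_real_derivative
      (a * ((b * q - a * p) / (a\<^sup>2 + b\<^sup>2)) - p * (ln (a\<^sup>2 + b\<^sup>2) / 2))
      - (b * ((a * q + b * p) / (a\<^sup>2 + b\<^sup>2)) + q * arctan (b / a))) (at 0)"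
    by (simp add: algebra_simps)
  moreover have "(a * ((b * q - a * p) / (a\<^sup>2 + b\<^sup>2)) - p * (ln (a\<^sup>2 + b\<^sup>2) / 2))
      - (b * ((a * q + b * p) / (a\<^sup>2 + b\<^sup>2)) + q * arctan (b / a))
      = - p * (ln (a\<^sup>2 + b\<^sup>2) / 2 + 1) - q * arctan (b / a)"
  proof -
    have "a * ((b * q - a * p) / (a\<^sup>2 + b\<^sup>2)) - b * ((a * q + b * p) / (a\<^sup>2 + b\<^sup>2)) = - p * ((a\<^sup>2 + b\<^sup>2) / (a\<^sup>2 + b\<^sup>2))"
      using ab by (simp add: divide_simps) (simp add: power2_eq_square algebra_simps)
    also have "\<dots> = - p" using ab by (metis divide_self less_irrefl mult_1_right)
    finally show ?thesis by (simp add: algebra_simps)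
  qed
  ultimately have "((\<lambda>t. (a - t * p) * (ln ((a - t * p)\<^sup>2 + (b + t * q)\<^sup>2) / 2) - (b + t * q) * arctan ((b + t * q) / (a - t * p)))
    has_real_derivative - p * (ln (a\<^sup>2 + b\<^sup>2) / 2 + 1) - q * arctan (b / a)) (at 0)" by (simp only:)
  moreover have "log_data i k (x + t *\<^sub>R v)
      = (a - t * p) * (ln ((a - t * p)\<^sup>2 + (b + t * q)\<^sup>2) / 2) - (b + t * q) * arctan ((b + t * q) / (a - t * p))" for t
    by (simp add: log_data_def a_def b_def p_def q_def diff_diff_eq)
  ultimately show ?thesis unfolding a_def b_def p_def q_def by simp
qed

lemma log_data_jet:
  fixes i k :: "'n::finite"
  assumes "i \<noteq> k"
  obtains u1 u2 where "C2_jet (ball 0 1) (log_data i k) u1 u2"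
    "\<And>x. x \<in> ball 0 1 \<Longrightarrow> L_jet 0 (log_data i k) u1 u2 x = 0"
proof -
  have lt1: "x $ i < 1" if "x \<in> ball 0 1" for x :: "real ^ 'n"
    using that component_le_norm_cart[of x i] by simp
  have ne: "(1 - x $ i)\<^sup>2 + (x $ k)\<^sup>2 > 0" if "x \<in> ball 0 1" for x :: "real ^ 'n"
    using lt1[OF that] by (simp add: add_pos_nonneg)
  define u1 where "u1 = (\<lambda>(j :: 'n) (x :: real ^ 'n). - axis j 1 $ i * (ln ((1 - x $ i)\<^sup>2 + (x $ k)\<^sup>2) / 2 + 1)
      - axis j 1 $ k * arctan (x $ k / (1 - x $ i)))"
  define u2 where "u2 = (\<lambda>(j :: 'n) (l :: 'n) (x :: real ^ 'n).
      - axis j 1 $ i * ((x $ k * axis l 1 $ k - (1 - x $ i) * axis l 1 $ i) / ((1 - x $ i)\<^sup>2 + (x $ k)\<^sup>2))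
      - axis j 1 $ k * (((1 - x $ i) * axis l 1 $ k + x $ k * axis l 1 $ i) / ((1 - x $ i)\<^sup>2 + (x $ k)\<^sup>2)))"
  show ?thesis
  proof (rule that)
    have *: "1 - x $ i \<noteq> 0" "(1 - x $ i)\<^sup>2 + (x $ k)\<^sup>2 \<noteq> 0" if "x \<in> ball 0 1" for x :: "real ^ 'n"
      using lt1[OF that] ne[OF that] by auto
    show "C2_jet (ball 0 1) (log_data i k) u1 u2"
    proof (rule C2_jetI)
      show "continuous_on (ball 0 1) (log_data i k)"
        unfolding log_data_def by (intro continuous_intros ballI *) auto
      show "continuous_on (ball 0 1) (u1 j)" for j
        unfolding u1_def by (intro continuous_intros ballI *) auto
      show "continuous_on (ball 0 1) (u2 j l)" for j l
        unfolding u2_def by (intro continuous_intros ballI *) auto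
      fix x :: "real ^ 'n" assume x: "x \<in> ball 0 1"
      show "((\<lambda>t. log_data i k (x + t *\<^sub>R axis j 1)) has_real_derivative u1 j x) (at 0)" for j
        unfolding u1_def using DERIV_log_data[OF lt1[OF x], of k "axis j 1"] by simp
      have a: "1 - x $ i > 0" using lt1[OF x] by simp
      show "((\<lambda>t. u1 j (x + t *\<^sub>R axis l 1)) has_real_derivative u2 j l x) (at 0)" for j l
      proof -
        have "((\<lambda>t. - axis j 1 $ i * (ln ((1 - x $ i - t * axis l 1 $ i)\<^sup>2 + (x $ k + t * axis l 1 $ k)\<^sup>2) / 2 + 1)
          - axis j 1 $ k * arctan ((x $ k + t * axis l 1 $ k) / (1 - x $ i - t * axis l 1 $ i))) has_real_derivative
          - axis j 1 $ i * ((x $ k * axis l 1 $ k - (1 - x $ i) * axis l 1 $ i) / ((1 - x $ i)\<^sup>2 + (x $ k)\<^sup>2) + 0)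
          - axis j 1 $ k * (((1 - x $ i) * axis l 1 $ k + x $ k * axis l 1 $ i) / ((1 - x $ i)\<^sup>2 + (x $ k)\<^sup>2))) (at 0)"
          by (intro DERIV_diff DERIV_cmult DERIV_add DERIV_ln_modulus[OF a] DERIV_arctan_quotient[OF a] DERIV_const)
        then show ?thesis unfolding u1_def u2_def by (simp add: algebra_simps)
      qed
    qed
    show "L_jet 0 (log_data i k) u1 u2 x = 0" if "x \<in> ball 0 1" for x
    proof -
      have "u2 j j x = (if j = i then (1 - x $ i) / ((1 - x $ i)\<^sup>2 + (x $ k)\<^sup>2) else 0)
          - (if j = k then (1 - x $ i) / ((1 - x $ i)\<^sup>2 + (x $ k)\<^sup>2) else 0)" for j
      proof -
        have ax: "axis j (1 :: real) $ m = (if j = m then 1 else 0)" for m by (simp add: axis_def)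
        show ?thesis unfolding u2_def ax using assms by (cases "j = i"; cases "j = k") (simp_all add: minus_divide_left)
      qed
      then have "(\<Sum>j\<in>UNIV. u2 j j x) = 0" by (simp add: sum_subtractf)
      then show ?thesis by (simp add: L_jet_def)
    qed
  qed
qed

lemma abs_arctan_le_2: "\<bar>arctan y\<bar> \<le> 2"
  using arctan_bounded[of y] pi_less_4 by (auto simp: abs_le_iff)

text \<open>On the closed ball \<open>x\<^sub>i = 1\<close> forces \<open>x = e\<^sub>i\<close> in the relevant coordinates. There the function
is dominated by \<open>\<rho> |ln \<rho>| + 2 \<rho>\<close>, where \<open>\<rho> = |1 - z|\<close>, and the inequality \<open>\<rho> |ln \<rho>| \<le> 2 sqrt \<rho>\<close> for
\<open>\<rho> < 1\<close> shows that this tends to \<open>0\<close>.\<close>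

lemma continuous_on_log_data:
  fixes i k :: "'n::finite"
  assumes "i \<noteq> k"
  shows "continuous_on (cball 0 1) (log_data i k)"
proof (rule continuous_on_eq_continuous_within[THEN iffD2], intro ballI)
  fix x :: "real ^ 'n" assume x: "x \<in> cball 0 1"
  have le: "\<bar>x $ i\<bar> \<le> 1" using x component_le_norm_cart[of x i] by simp
  show "continuous (at x within cball 0 1) (log_data i k)"
  proof (cases "x $ i = 1")
    case False
    then have "1 - x $ i > 0" using le by auto
    then have "1 - x $ i \<noteq> 0" "(1 - x $ i)\<^sup>2 + (x $ k)\<^sup>2 \<noteq> 0" by (auto simp: add_nonneg_eq_0_iff)
    then have "isCont (log_data i k) x" unfolding log_data_def
      by (intro continuous_intros) auto
    then show ?thesis by (rule continuous_at_imp_continuous_at_within)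
  next
    case True
    have "(x $ i)\<^sup>2 + (x $ k)\<^sup>2 \<le> 1"
      using two_coordinates_le_norm[OF assms, of x] x power_le_one[of "norm x" 2] by simp
    then have xk: "x $ k = 0" using True by simp
    define \<rho> where "\<rho> = (\<lambda>y :: real ^ 'n. sqrt ((1 - y $ i)\<^sup>2 + (y $ k)\<^sup>2))"
    have \<rho>x: "\<rho> x = 0" by (simp add: \<rho>_def True xk)
    have \<rho>c: "isCont \<rho> x" unfolding \<rho>_def by (intro continuous_intros)
    then have lim: "(\<rho> \<longlongrightarrow> 0) (at x)" unfolding isCont_def \<rho>x .
    have bound: "\<bar>log_data i k y\<bar> \<le> 2 * sqrt (\<rho> y) + 2 * \<rho> y" if "\<rho> y < 1" for y
    proof -
      have r0: "\<rho> y \<ge> 0" by (simp add: \<rho>_def)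
      have le1: "\<bar>1 - y $ i\<bar> \<le> \<rho> y" "\<bar>y $ k\<bar> \<le> \<rho> y"
        unfolding \<rho>_def by (auto intro: real_le_rsqrt simp: abs_le_square_iff)
      have l: "ln ((1 - y $ i)\<^sup>2 + (y $ k)\<^sup>2) / 2 = ln (\<rho> y)" unfolding \<rho>_def by (simp add: ln_sqrt)
      have "\<rho> y * \<bar>ln (\<rho> y)\<bar> \<le> 2 * sqrt (\<rho> y)"
      proof (cases "\<rho> y = 0")
        case False
        then have p: "\<rho> y > 0" using r0 by simp
        define s where "s = sqrt (\<rho> y)"
        have s: "s > 0" "\<rho> y = s * s" using p by (auto simp: s_def)
        have "s < 1" using that s mult_mono[of 1 s 1 s] by (cases "s < 1") auto
        then have ls: "ln s < 0" using s by simp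
        have "ln (1 / s) \<le> 1 / s" using s by (intro ln_bound) simp
        then have 1: "s * (- ln s) \<le> 1" using s by (simp add: ln_div field_simps)
        have "\<bar>ln (\<rho> y)\<bar> = 2 * (- ln s)" using s ls by (simp add: ln_mult)
        then have "\<rho> y * \<bar>ln (\<rho> y)\<bar> = 2 * s * (s * (- ln s))" using s(2) by simp
        also have "\<dots> \<le> 2 * s * 1" using 1 s(1) by (intro mult_left_mono) auto
        finally show ?thesis by (simp add: s_def)
      qed simp
      moreover have "\<bar>(1 - y $ i) * ln (\<rho> y)\<bar> \<le> \<rho> y * \<bar>ln (\<rho> y)\<bar>"
        unfolding abs_mult using le1 by (intro mult_right_mono) auto
      moreover have "\<bar>y $ k * arctan (y $ k / (1 - y $ i))\<bar> \<le> \<rho> y * 2"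
        unfolding abs_mult using le1 abs_arctan_le_2 r0 by (intro mult_mono) auto
      ultimately show ?thesis unfolding log_data_def l by linarith
    qed
    have "((\<lambda>y. 2 * sqrt (\<rho> y) + 2 * \<rho> y) \<longlongrightarrow> 2 * sqrt 0 + 2 * 0) (at x)"
      by (intro tendsto_intros lim)
    then have lim2: "((\<lambda>y. 2 * sqrt (\<rho> y) + 2 * \<rho> y) \<longlongrightarrow> 0) (at x)" by simp
    have "\<forall>\<^sub>F y in at x. \<rho> y < 1" using lim by (rule order_tendstoD) simp
    then have "\<forall>\<^sub>F y in at x. norm (log_data i k y) \<le> 2 * sqrt (\<rho> y) + 2 * \<rho> y"
      by eventually_elim (simp add: bound)
    then have "((log_data i k) \<longlongrightarrow> 0) (at x)" using lim2 by (rule Lim_null_comparison)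
    moreover have "log_data i k x = 0" by (simp add: log_data_def True xk)
    ultimately have "isCont (log_data i k) x" by (simp add: isCont_def)
    then show ?thesis by (rule continuous_at_imp_continuous_at_within)
  qed
qed

text \<open>The angular part \<open>b arctan (b / a)\<close> is homogeneous of degree one, so its gradient is bounded on
the convex set \<open>a > 0\<close>.\<close>

lemma arctan_part_lipschitz:
  fixes x y :: "real ^ 'n::finite"
  assumes "i \<noteq> k" "x $ i < 1" "y $ i < 1"
  shows "\<bar>y $ k * arctan (y $ k / (1 - y $ i)) - x $ k * arctan (x $ k / (1 - x $ i))\<bar> \<le> 4 * norm (y - x)"
proof -
  define v where "v = y - x"
  define T where "T = (\<lambda>z :: real ^ 'n. z $ k * arctan (z $ k / (1 - z $ i)))"
  have vi: "\<bar>v $ i\<bar> \<le> norm v" "\<bar>v $ k\<bar> \<le> norm v" by (rule component_le_norm_cart)+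
  have "norm (T (x + 0 *\<^sub>R v) - T (x + 1 *\<^sub>R v)) \<le> 4 * norm v * norm (0 - 1 :: real)"
  proof (rule field_differentiable_bound[where S = "{0..1 :: real}"])
    fix t :: real assume t: "t \<in> {0..1}"
    define z where "z = x + t *\<^sub>R v"
    have "z $ i = (1 - t) * x $ i + t * y $ i" by (simp add: z_def v_def algebra_simps)
    also have "\<dots> < 1" using t assms(2,3) by (intro convex_bound_lt) auto
    finally have a: "1 - z $ i > 0" by simp
    have "((\<lambda>s. (z $ k + s * v $ k) * arctan ((z $ k + s * v $ k) / (1 - z $ i - s * v $ i))) has_real_derivative
        z $ k * (((1 - z $ i) * v $ k + z $ k * v $ i) / ((1 - z $ i)\<^sup>2 + (z $ k)\<^sup>2))
        + v $ k * arctan (z $ k / (1 - z $ i))) (at 0)"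
      by (rule derivative_eq_intros DERIV_arctan_quotient[OF a] refl | simp)+
    then have "((\<lambda>s. T (z + s *\<^sub>R v)) has_real_derivative
        z $ k * (((1 - z $ i) * v $ k + z $ k * v $ i) / ((1 - z $ i)\<^sup>2 + (z $ k)\<^sup>2))
        + v $ k * arctan (z $ k / (1 - z $ i))) (at 0)"
      unfolding T_def by (simp add: algebra_simps)
    then have "((\<lambda>s. T (x + s *\<^sub>R v)) has_real_derivative
        z $ k * (((1 - z $ i) * v $ k + z $ k * v $ i) / ((1 - z $ i)\<^sup>2 + (z $ k)\<^sup>2))
        + v $ k * arctan (z $ k / (1 - z $ i))) (at t)"
      unfolding z_def by (rule has_derivative_along_line_shift)
    then show "((\<lambda>s. T (x + s *\<^sub>R v)) has_field_derivative
        z $ k * (((1 - z $ i) * v $ k + z $ k * v $ i) / ((1 - z $ i)\<^sup>2 + (z $ k)\<^sup>2))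
        + v $ k * arctan (z $ k / (1 - z $ i))) (at t within {0..1})"
      by (rule has_field_derivative_at_within)
    define a b where "a = 1 - z $ i" and "b = z $ k"
    have r: "a\<^sup>2 + b\<^sup>2 > 0" using a by (simp add: a_def add_pos_nonneg)
    have "\<bar>b * ((a * v $ k + b * v $ i) / (a\<^sup>2 + b\<^sup>2))\<bar> = \<bar>(b * a) * v $ k + b\<^sup>2 * v $ i\<bar> / (a\<^sup>2 + b\<^sup>2)"
      using r by (simp add: abs_mult[symmetric] power2_eq_square algebra_simps)
    also have "\<dots> \<le> ((a\<^sup>2 + b\<^sup>2) * norm v + (a\<^sup>2 + b\<^sup>2) * norm v) / (a\<^sup>2 + b\<^sup>2)"
    proof (intro divide_right_mono order_trans[OF abs_triangle_ineq] add_mono)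
      have "\<bar>b * a\<bar> \<le> a\<^sup>2 + b\<^sup>2"
      proof -
        have "2 * (\<bar>a\<bar> * \<bar>b\<bar>) \<le> a\<^sup>2 + b\<^sup>2" using sum_squares_bound[of "\<bar>a\<bar>" "\<bar>b\<bar>"] by simp
        moreover have "\<bar>a\<bar> * \<bar>b\<bar> \<ge> 0" by simp
        ultimately show ?thesis unfolding abs_mult[of b a] mult.commute[of "\<bar>b\<bar>"] by linarith
      qed
      then show "\<bar>b * a * v $ k\<bar> \<le> (a\<^sup>2 + b\<^sup>2) * norm v"
        unfolding abs_mult[of "b * a"] using vi by (intro mult_mono) auto
      show "\<bar>b\<^sup>2 * v $ i\<bar> \<le> (a\<^sup>2 + b\<^sup>2) * norm v"
        unfolding abs_mult using vi by (intro mult_mono) auto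
    qed (use r in auto)
    also have "\<dots> = (a\<^sup>2 + b\<^sup>2) * (2 * norm v) / (a\<^sup>2 + b\<^sup>2)" by (simp add: algebra_simps)
    also have "\<dots> = 2 * norm v" using r by (metis nonzero_mult_div_cancel_left less_irrefl)
    finally have 1: "\<bar>b * ((a * v $ k + b * v $ i) / (a\<^sup>2 + b\<^sup>2))\<bar> \<le> 2 * norm v" .
    have 2: "\<bar>v $ k * arctan (b / a)\<bar> \<le> norm v * 2"
      unfolding abs_mult using vi abs_arctan_le_2 by (intro mult_mono) auto
    show "norm (z $ k * (((1 - z $ i) * v $ k + z $ k * v $ i) / ((1 - z $ i)\<^sup>2 + (z $ k)\<^sup>2))
        + v $ k * arctan (z $ k / (1 - z $ i))) \<le> 4 * norm v"
      using order_trans[OF abs_triangle_ineq add_mono[OF 1 2]] unfolding a_def b_def real_norm_def by simp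
  qed auto
  then show ?thesis unfolding T_def by (simp add: v_def abs_minus_commute)
qed

text \<open>On the sphere \<open>1 - x\<^sub>i = d\<^sup>2 / 2\<close>, where \<open>d\<close> is the distance to \<open>e\<^sub>i\<close>, and
\<open>d\<^sup>2 / 2 \<le> \<rho> \<le> d\<close> for \<open>\<rho> = |1 - z|\<close>. So the logarithmic part is \<open>d\<^sup>2 / 2 * ln \<rho>\<close>. Its increments consist of
those of \<open>d\<^sup>2\<close>, controlled by \<open>d |ln \<rho>| \<le> 4\<close>, and those of \<open>ln \<rho>\<close>, controlled because the
prefactor \<open>d\<^sup>2 / 2\<close>, taken at the point closer to \<open>e\<^sub>i\<close>, is at most \<open>\<rho>\<close> at both points.\<close>

lemma log_data_lipschitz_on_sphere:
  fixes i k :: "'n::finite"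
  assumes ik: "i \<noteq> k"
  shows "9-lipschitz_on (sphere 0 1) (log_data i k)"
proof (rule lipschitz_onI)
  define e :: "real ^ 'n" where "e = axis i 1"
  define \<rho> where "\<rho> = (\<lambda>x :: real ^ 'n. norm (Complex (1 - x $ i) (x $ k)))"
  define d where "d = (\<lambda>x :: real ^ 'n. norm (x - e))"
  have d2: "1 - x $ i = (d x)\<^sup>2 / 2" if "x \<in> sphere 0 1" for x
    using that unfolding d_def e_def
    by (simp add: power2_norm_eq_inner inner_simps inner_commute inner_axis inner_axis') (simp add: norm_eq_1)
  have \<rho>_ge: "(d x)\<^sup>2 / 2 \<le> \<rho> x" if "x \<in> sphere 0 1" for x
    using complex_Re_le_cmod[of "Complex (1 - x $ i) (x $ k)"] unfolding \<rho>_def d2[OF that, symmetric] by simp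
  have \<rho>_diff: "\<bar>\<rho> y - \<rho> x\<bar> \<le> norm (y - x)" for x y
  proof -
    have "\<bar>\<rho> y - \<rho> x\<bar> \<le> norm (Complex (1 - y $ i) (y $ k) - Complex (1 - x $ i) (x $ k))"
      unfolding \<rho>_def by (rule norm_triangle_ineq3)
    also have "\<dots> = sqrt (((y - x) $ i)\<^sup>2 + ((y - x) $ k)\<^sup>2)"
      by (simp add: cmod_def power2_commute[of "x $ i"])
    also have "\<dots> \<le> sqrt ((norm (y - x))\<^sup>2)"
      using two_coordinates_le_norm[OF ik] by (intro real_sqrt_le_mono)
    finally show ?thesis by simp
  qed
  have \<rho>_le: "\<rho> x \<le> d x" for x
  proof -
    have "\<rho> e = 0" using ik by (simp add: \<rho>_def e_def axis_def cmod_def)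
    then show ?thesis using \<rho>_diff[of x e] by (simp add: d_def)
  qed
  have d_le: "d x \<le> 2" if "x \<in> sphere 0 1" for x
    using norm_triangle_ineq4[of x e] that unfolding d_def e_def by simp
  have dln: "d x * \<bar>ln (\<rho> x)\<bar> \<le> 4" if x: "x \<in> sphere 0 1" for x
  proof (cases "d x = 0")
    case False
    then have d: "d x > 0" by (simp add: d_def)
    then have \<rho>: "\<rho> x > 0" using \<rho>_ge[OF x] by (metis half_gt_zero less_le_trans zero_less_power)
    have "ln (\<rho> x) \<le> ln 2" using \<rho> \<rho>_le[of x] d_le[OF x] by simp
    also have "\<dots> \<le> 1" using ln_2_less_1 by simp
    finally have "d x * ln (\<rho> x) \<le> d x * 1" using d by (intro mult_left_mono) auto
    then have u: "d x * ln (\<rho> x) \<le> 4" using d_le[OF x] by simp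
    have "ln ((d x)\<^sup>2 / 2) \<le> ln (\<rho> x)" using \<rho> \<rho>_ge[OF x] d by simp
    then have "- ln (\<rho> x) \<le> ln 2 - 2 * ln (d x)" using d by (simp add: ln_div ln_realpow)
    also have "\<dots> \<le> 1 + 2 * ln (1 / d x)" using d ln_2_less_1 by (simp add: ln_div)
    also have "\<dots> \<le> 1 + 2 * (1 / d x)" using ln_bound[of "1 / d x"] d by simp
    finally have "d x * (- ln (\<rho> x)) \<le> d x * (1 + 2 * (1 / d x))"
      using d by (intro mult_left_mono) auto
    also have "\<dots> = d x + 2" using d by (simp add: field_simps)
    finally have "d x * (- ln (\<rho> x)) \<le> 4" using d_le[OF x] by simp
    then show ?thesis using u d by (simp add: abs_if)
  qed simp
  have main: "\<bar>(d y)\<^sup>2 / 2 * ln (\<rho> y) - (d x)\<^sup>2 / 2 * ln (\<rho> x)\<bar> \<le> 5 * norm (y - x)"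
    if x: "x \<in> sphere 0 1" and y: "y \<in> sphere 0 1" and le: "d x \<le> d y" for x y
  proof -
    have dd: "\<bar>d y - d x\<bar> \<le> norm (y - x)" unfolding d_def using norm_triangle_ineq3[of "y - e" "x - e"] by simp
    have "\<bar>((d y)\<^sup>2 - (d x)\<^sup>2) / 2 * ln (\<rho> y)\<bar> = \<bar>d y - d x\<bar> * ((d y + d x) / 2 * \<bar>ln (\<rho> y)\<bar>)"
      by (simp add: power2_eq_square square_diff_square_factored abs_mult d_def)
    also have "\<dots> \<le> norm (y - x) * (d y * \<bar>ln (\<rho> y)\<bar>)"
      using le dd by (intro mult_mono mult_right_mono) (auto simp: d_def)
    also have "\<dots> \<le> norm (y - x) * 4" using dln[OF y] by (intro mult_left_mono) auto
    finally have 1: "\<bar>((d y)\<^sup>2 - (d x)\<^sup>2) / 2 * ln (\<rho> y)\<bar> \<le> 4 * norm (y - x)" by simp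
    have 2: "\<bar>(d x)\<^sup>2 / 2 * (ln (\<rho> y) - ln (\<rho> x))\<bar> \<le> norm (y - x)"
    proof (cases "d x = 0")
      case False
      then have dx: "d x > 0" by (simp add: d_def)
      define m where "m = (d x)\<^sup>2 / 2"
      have m: "m > 0" "m \<le> \<rho> x" using dx \<rho>_ge[OF x] by (auto simp: m_def)
      have "m \<le> (d y)\<^sup>2 / 2" using le dx by (simp add: m_def power_mono)
      then have m2: "m \<le> \<rho> y" using \<rho>_ge[OF y] by simp
      have *: "m * (ln p - ln q) \<le> \<bar>p - q\<bar>" if "m \<le> p" "m \<le> q" for p q
      proof -
        have pq: "p > 0" "q > 0" using m that by auto
        have "ln p - ln q = ln (p / q)" using pq by (simp add: ln_div)
        also have "\<dots> \<le> p / q - 1" using pq by (intro ln_le_minus_one) simp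
        also have "\<dots> = (p - q) / q" using pq by (simp add: field_simps)
        also have "\<dots> \<le> \<bar>p - q\<bar> / q" using pq by (simp add: divide_right_mono)
        also have "\<dots> \<le> \<bar>p - q\<bar> / m" using m pq that by (intro divide_left_mono) auto
        finally show ?thesis using m by (simp add: field_simps)
      qed
      have "\<bar>m * (ln (\<rho> y) - ln (\<rho> x))\<bar> \<le> \<bar>\<rho> y - \<rho> x\<bar>"
        using *[OF m2 m(2)] *[OF m(2) m2] by (auto simp: abs_le_iff algebra_simps)
      then show ?thesis using \<rho>_diff[of y x] unfolding m_def by linarith
    qed simp
    have "(d y)\<^sup>2 / 2 * ln (\<rho> y) - (d x)\<^sup>2 / 2 * ln (\<rho> x)
      = ((d y)\<^sup>2 - (d x)\<^sup>2) / 2 * ln (\<rho> y) + (d x)\<^sup>2 / 2 * (ln (\<rho> y) - ln (\<rho> x))"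
      by (simp add: field_simps)
    then show ?thesis using 1 2 by linarith
  qed
  have T: "\<bar>y $ k * arctan (y $ k / (1 - y $ i)) - x $ k * arctan (x $ k / (1 - x $ i))\<bar> \<le> 4 * norm (y - x)"
    if "x \<in> sphere 0 1" "y \<in> sphere 0 1" for x y
  proof -
    have edge: "z $ i < 1 \<or> z $ i = 1 \<and> z $ k = 0" if "z \<in> sphere 0 1" for z :: "real ^ 'n"
      using that two_coordinates_le_norm[OF ik, of z] component_le_norm_cart[of z i]
      by (cases "z $ i = 1") auto
    have b: "\<bar>(y - x) $ k * arctan r\<bar> \<le> 4 * norm (y - x)" for r
    proof -
      have "\<bar>(y - x) $ k * arctan r\<bar> \<le> norm (y - x) * 2"
        unfolding abs_mult by (intro mult_mono component_le_norm_cart abs_arctan_le_2) auto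
      also have "\<dots> \<le> 4 * norm (y - x)" by simp
      finally show ?thesis .
    qed
    consider "x $ i < 1" "y $ i < 1" | "x $ k = 0" | "y $ k = 0"
      using edge[OF \<open>x \<in> sphere 0 1\<close>] edge[OF \<open>y \<in> sphere 0 1\<close>] by blast
    then show ?thesis
    proof cases
      case 1
      then show ?thesis by (rule arctan_part_lipschitz[OF ik])
    next
      case 2
      then show ?thesis using b[of "y $ k / (1 - y $ i)"] by simp
    next
      case 3
      then show ?thesis using b[of "x $ k / (1 - x $ i)"] by simp
    qed
  qed
  have eq: "log_data i k x = (d x)\<^sup>2 / 2 * ln (\<rho> x) - x $ k * arctan (x $ k / (1 - x $ i))"
    if "x \<in> sphere 0 1" for x
    using d2[OF that] by (simp add: log_data_def \<rho>_def cmod_def ln_sqrt)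
  fix x y :: "real ^ 'n" assume x: "x \<in> sphere 0 1" and y: "y \<in> sphere 0 1"
  have "\<bar>(d y)\<^sup>2 / 2 * ln (\<rho> y) - (d x)\<^sup>2 / 2 * ln (\<rho> x)\<bar> \<le> 5 * norm (y - x)"
    using main[OF x y] main[OF y x] by (cases "d x \<le> d y") (auto simp: abs_minus_commute norm_minus_commute)
  then show "dist (log_data i k x) (log_data i k y) \<le> 9 * dist x y"
    using T[OF x y] unfolding eq[OF x] eq[OF y] dist_norm by (simp add: norm_minus_commute[of x])
qed simp

lemma harmonic_lipschitz_failure:
  assumes n: "CARD('n::finite) \<ge> 2"
  obtains \<phi> :: "real ^ 'n \<Rightarrow> real" where "lipschitz_continuous_on (sphere 0 1) \<phi>"
    "\<exists>u. dirichlet_solution 0 \<phi> u"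
    "\<And>u. dirichlet_solution 0 \<phi> u \<Longrightarrow> \<not> lipschitz_continuous_on (ball 0 1) u"
proof -
  obtain i k :: 'n where ik: "i \<noteq> k" using n card_le_Suc0_iff_eq[of "UNIV :: 'n set"] by auto
  obtain u1 u2 where J: "C2_jet (ball 0 1) (log_data i k) u1 u2"
    "\<And>x. x \<in> ball 0 1 \<Longrightarrow> L_jet 0 (log_data i k) u1 u2 x = 0"
    using log_data_jet[OF ik] by blast
  have sol: "dirichlet_solution 0 (log_data i k) (log_data i k)"
    by (rule dirichlet_solutionI[OF J continuous_on_log_data[OF ik]]) auto
  show ?thesis
  proof (rule that)
    show "lipschitz_continuous_on (sphere 0 1) (log_data i k)"
      unfolding lipschitz_continuous_on_def using log_data_lipschitz_on_sphere[OF ik] by blast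
    show "\<exists>u. dirichlet_solution 0 (log_data i k) u" using sol by blast
    fix u assume u: "dirichlet_solution 0 (log_data i k) u"
    show "\<not> lipschitz_continuous_on (ball 0 1) u"
    proof
      assume "lipschitz_continuous_on (ball 0 1) u"
      then obtain L where L: "L-lipschitz_on (ball 0 1) u" unfolding lipschitz_continuous_on_def by blast
      have L': "L-lipschitz_on (ball 0 1) (log_data i k)"
        by (rule lipschitz_on_transform[OF L]) (rule dirichlet_solution_unique[OF n _ sol u], simp)
      have L0: "L \<ge> 0" using L by (rule lipschitz_on_nonneg)
      \<comment> \<open>the radial derivative at depth \<open>y\<close> is \<open>- ln y - 1\<close>, which is \<open>L + 1\<close> for this choice\<close>
      define y where "y = exp (- (L + 2))"
      have y: "0 < y" "y < 1" using L0 by (auto simp: y_def)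
      define x :: "real ^ 'n" where "x = (1 - y) *\<^sub>R axis i 1"
      have x: "x \<in> ball 0 1" using y by (simp add: x_def)
      have xc: "x $ i = 1 - y" "x $ k = 0" using ik by (auto simp: x_def axis_def)
      have "((\<lambda>t. log_data i k (x + t *\<^sub>R axis i 1)) has_real_derivative - (ln (y\<^sup>2) / 2 + 1)) (at 0)"
        using DERIV_log_data[of x i k "axis i 1"] xc y ik by (simp add: axis_def)
      from lipschitz_on_derivative_bound[OF L' open_ball x this]
      have "\<bar>ln (y\<^sup>2) / 2 + 1\<bar> \<le> L" unfolding norm_axis_1 by (metis abs_minus_cancel mult.right_neutral)
      moreover have "ln (y\<^sup>2) / 2 + 1 = - (L + 1)" using y by (simp add: ln_realpow) (simp add: y_def)
      ultimately show False by simp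
    qed
  qed
qed

section \<open>A rotation-invariant probability measure on the sphere\<close>

lemma nn_integral_lborel_shift:
  fixes h :: "'a::euclidean_space \<Rightarrow> ennreal"
  assumes "h \<in> borel_measurable borel"
  shows "(\<integral>\<^sup>+y. h (c + y) \<partial>lborel) = (\<integral>\<^sup>+y. h y \<partial>lborel)"
proof -
  have "(\<integral>\<^sup>+y. h y \<partial>lborel) = (\<integral>\<^sup>+y. h y \<partial>distr lborel borel ((+) c))"
    by (simp only: lborel_distr_plus)
  also have "\<dots> = (\<integral>\<^sup>+y. h (c + y) \<partial>lborel)"
    using assms by (intro nn_integral_distr) auto
  finally show ?thesis ..
qed

lemma nn_integral_lborel_reflect:
  fixes h :: "'a::euclidean_space \<Rightarrow> ennreal"
  assumes [measurable]: "h \<in> borel_measurable borel"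
  shows "(\<integral>\<^sup>+y. h (c - y) \<partial>lborel) = (\<integral>\<^sup>+y. h y \<partial>lborel)"
proof -
  have "(lborel :: 'a measure) = distr lborel borel (\<lambda>y. c + (- 1) *\<^sub>R y)"
    using lborel_affine[of "- 1" c] by (simp add: density_1 one_ennreal_def[symmetric])
  then have "(\<integral>\<^sup>+y. h y \<partial>lborel) = (\<integral>\<^sup>+y. h y \<partial>distr lborel borel (\<lambda>y. c + (- 1) *\<^sub>R y))"
    by (simp only:)
  also have "\<dots> = (\<integral>\<^sup>+y. h (c + (- 1) *\<^sub>R y) \<partial>lborel)"
    by (intro nn_integral_distr) auto
  finally show ?thesis by simp
qed

text \<open>Weil's argument for the uniqueness of Haar measure, applied to Lebesgue measure \<open>\<lambda>\<close> and its
image under \<open>T\<close>. Shift the variable \<open>y\<close> by \<open>T x\<close> in \<open>\<lambda>(T\<^sup>-\<^sup>1 A) \<lambda>(B)\<close>, exchange the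
integrals, and shift \<open>x\<close> back by the preimage of \<open>y\<close>; the product becomes \<open>\<lambda>(A) \<lambda>(T\<^sup>-\<^sup>1 B)\<close>. For \<open>B\<close>
the unit ball, which \<open>T\<close> preserves, this can be divided by \<open>\<lambda>(B)\<close>.\<close>

lemma emeasure_lborel_orthogonal_vimage:
  fixes T :: "'a::euclidean_space \<Rightarrow> 'a"
  assumes T: "orthogonal_transformation T" and A[measurable]: "A \<in> sets borel"
  shows "emeasure lborel (T -` A) = emeasure lborel A"
proof -
  have lin: "linear T" using T by (rule orthogonal_transformation_linear)
  have [measurable]: "T \<in> borel_measurable borel"
    using lin by (intro borel_measurable_continuous_onI) (simp add: linear_continuous_on linear_conv_bounded_linear)
  define f b :: "'a \<Rightarrow> ennreal" where "f = indicator A" and "b = indicator (ball 0 1)"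
  have [measurable]: "f \<in> borel_measurable borel" "b \<in> borel_measurable borel"
    by (auto simp: f_def b_def intro!: borel_measurable_indicator)
  have bT: "b (T x) = b x" for x
    using orthogonal_transformation_norm[OF T, of x] by (simp add: b_def indicator_def)
  define \<beta> where "\<beta> = (\<integral>\<^sup>+y. b y \<partial>lborel)"
  have \<beta>: "\<beta> = emeasure lborel (ball (0 :: 'a) 1)" by (simp add: \<beta>_def b_def)
  have "(\<integral>\<^sup>+x. f (T x) \<partial>lborel) * \<beta> = (\<integral>\<^sup>+x. f (T x) * \<beta> \<partial>lborel)"
    by (simp add: nn_integral_multc)
  also have "\<dots> = (\<integral>\<^sup>+x. (\<integral>\<^sup>+y. f (T x) * b (T x + y) \<partial>lborel) \<partial>lborel)"
    unfolding \<beta>_def by (simp add: nn_integral_cmult nn_integral_lborel_shift)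
  also have "\<dots> = (\<integral>\<^sup>+y. (\<integral>\<^sup>+x. f (T x) * b (T x + y) \<partial>lborel) \<partial>lborel)"
    by (rule lborel_pair.Fubini'[symmetric]) measurable
  also have "\<dots> = (\<integral>\<^sup>+y. (\<integral>\<^sup>+x. f (T x - y) * b (T x) \<partial>lborel) \<partial>lborel)"
  proof (rule nn_integral_cong)
    fix y :: 'a
    obtain z where z: "y = T z" using orthogonal_transformation_surj[OF T] by (rule surjE)
    have "T (- z + x) = T x - y" for x
      unfolding z using lin by (simp add: linear_diff)
    then show "(\<integral>\<^sup>+x. f (T x) * b (T x + y) \<partial>lborel) = (\<integral>\<^sup>+x. f (T x - y) * b (T x) \<partial>lborel)"
      using nn_integral_lborel_shift[of "\<lambda>x. f (T x) * b (T x + y)" "- z"] by simp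
  qed
  also have "\<dots> = (\<integral>\<^sup>+x. (\<integral>\<^sup>+y. f (T x - y) * b (T x) \<partial>lborel) \<partial>lborel)"
    by (rule lborel_pair.Fubini') measurable
  also have "\<dots> = (\<integral>\<^sup>+x. (\<integral>\<^sup>+y. f y \<partial>lborel) * b (T x) \<partial>lborel)"
    by (simp add: nn_integral_multc nn_integral_lborel_reflect)
  also have "\<dots> = (\<integral>\<^sup>+y. f y \<partial>lborel) * \<beta>"
    unfolding bT \<beta>_def by (simp add: nn_integral_cmult)
  finally have eq: "(\<integral>\<^sup>+x. f (T x) \<partial>lborel) * \<beta> = (\<integral>\<^sup>+y. f y \<partial>lborel) * \<beta>" .
  have "\<beta> \<noteq> 0" "\<beta> \<noteq> \<infinity>"
    using emeasure_lborel_ball_finite[of "0 :: 'a" 1] content_ball_pos[of 1 "0 :: 'a"]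
    by (auto simp: \<beta> measure_def)
  then have "(\<integral>\<^sup>+x. f (T x) \<partial>lborel) = (\<integral>\<^sup>+y. f y \<partial>lborel)"
    using eq by (metis ennreal_mult_divide_eq infinity_ennreal_def mult_divide_eq_ennreal)
  moreover have "(\<integral>\<^sup>+x. f (T x) \<partial>lborel) = emeasure lborel (T -` A)"
  proof -
    have "T -` A \<in> sets lborel" using measurable_sets[of T borel borel A] by simp
    moreover have "f (T x) = indicator (T -` A) x" for x by (simp add: f_def indicator_def)
    ultimately show ?thesis by simp
  qed
  ultimately show ?thesis by (simp add: f_def)
qed

lemma uniform_ball_measure_orthogonal_invariant:
  fixes T :: "'a::euclidean_space \<Rightarrow> 'a"
  assumes T: "orthogonal_transformation T"
  shows "distr (uniform_measure lborel (ball 0 1)) borel T = uniform_measure lborel (ball 0 1)"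
proof (rule measure_eqI)
  have lin: "linear T" using T by (rule orthogonal_transformation_linear)
  have meas[measurable]: "T \<in> borel_measurable borel"
    using lin by (intro borel_measurable_continuous_onI) (simp add: linear_continuous_on linear_conv_bounded_linear)
  show "sets (distr (uniform_measure lborel (ball 0 1)) borel T) = sets (uniform_measure lborel (ball 0 1))" by simp
  fix A assume "A \<in> sets (distr (uniform_measure lborel (ball 0 1)) borel T)"
  then have A[measurable]: "A \<in> sets borel" by simp
  have tb: "T -` A \<in> sets borel" using measurable_sets[OF meas A] by simp
  have "ball 0 1 \<inter> T -` A = T -` (ball 0 1 \<inter> A)"
    by (auto simp: orthogonal_transformation_norm[OF T])
  then have "emeasure lborel (ball 0 1 \<inter> T -` A) = emeasure lborel (ball 0 1 \<inter> A)"
    using emeasure_lborel_orthogonal_vimage[OF T, of "ball 0 1 \<inter> A"] A by simp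
  then show "emeasure (distr (uniform_measure lborel (ball 0 1)) borel T) A = emeasure (uniform_measure lborel (ball 0 1)) A"
    using A tb by (simp add: emeasure_distr)
qed

text \<open>The normalized surface measure, characterized by the two properties that the proof needs: total
mass one and rotation invariance. The sphere itself is the underlying space, so that functions
continuous on the sphere are measurable however they behave elsewhere.\<close>

locale sphere_measure = finite_measure \<sigma> for \<sigma> :: "(real ^ 'n::finite) measure" +
  assumes sets_eq: "sets \<sigma> = sets (restrict_space borel (sphere 0 1))"
    and total: "measure \<sigma> (space \<sigma>) = 1"
    and rotation_invariant: "\<And>T f. orthogonal_transformation T \<Longrightarrow> continuous_on (sphere 0 1) f \<Longrightarrow>
        (\<integral>\<zeta>. f (T \<zeta>) \<partial>\<sigma>) = (\<integral>\<zeta>. f \<zeta> \<partial>\<sigma> :: real)"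
begin

lemma space_eq: "space \<sigma> = sphere 0 1"
  using sets_eq_imp_space_eq[OF sets_eq] by (simp add: space_restrict_space)

lemma borel_measurable_if_continuous:
  "continuous_on (sphere 0 1) f \<Longrightarrow> f \<in> borel_measurable \<sigma>"
  using borel_measurable_continuous_on_restrict measurable_cong_sets[OF sets_eq refl] by blast

lemma integrable_if_continuous:
  fixes f :: "real ^ 'n \<Rightarrow> real"
  assumes "continuous_on (sphere 0 1) f"
  shows "integrable \<sigma> f"
proof -
  have "compact (f ` sphere 0 1)" using assms by (intro compact_continuous_image compact_sphere)
  then obtain B where "\<And>\<zeta>. \<zeta> \<in> sphere 0 1 \<Longrightarrow> \<bar>f \<zeta>\<bar> \<le> B"
    using compact_imp_bounded bounded_pos by (metis imageI real_norm_def)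
  then show ?thesis
    by (intro integrable_const_bound[of _ B] borel_measurable_if_continuous assms AE_I2) (simp add: space_eq)
qed

lemma continuous_on_section:
  assumes "continuous_on (S \<times> sphere 0 1) (\<lambda>(x, \<zeta>). F x \<zeta>)" "x \<in> S"
  shows "continuous_on (sphere 0 1) (F x)"
proof -
  have "continuous_on (sphere 0 1) (\<lambda>\<zeta>. (x, \<zeta>))"
    by (intro continuous_on_Pair continuous_on_const continuous_on_id)
  from continuous_on_compose2[OF assms(1) this] show ?thesis using assms(2) by auto
qed

lemma dominated_limit:
  assumes "\<And>k. continuous_on (sphere 0 1) (f k)" "continuous_on (sphere 0 1) g"
    and "\<And>k \<zeta>. \<zeta> \<in> sphere 0 1 \<Longrightarrow> \<bar>f k \<zeta>\<bar> \<le> B"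
    and "\<And>\<zeta>. \<zeta> \<in> sphere 0 1 \<Longrightarrow> (\<lambda>k. f k \<zeta>) \<longlonglongrightarrow> (g \<zeta> :: real)"
  shows "(\<lambda>k. \<integral>\<zeta>. f k \<zeta> \<partial>\<sigma>) \<longlonglongrightarrow> (\<integral>\<zeta>. g \<zeta> \<partial>\<sigma>)"
  by (rule integral_dominated_convergence[where w = "\<lambda>_. B"])
     (use assms in \<open>auto intro!: borel_measurable_if_continuous AE_I2 simp: space_eq\<close>)

lemma bounded_on_compact_times_sphere:
  fixes F :: "real ^ 'n \<Rightarrow> real ^ 'n \<Rightarrow> real"
  assumes "continuous_on (S \<times> sphere 0 1) (\<lambda>(x, \<zeta>). F x \<zeta>)" "compact K" "K \<subseteq> S"
  obtains B where "\<And>x \<zeta>. x \<in> K \<Longrightarrow> \<zeta> \<in> sphere 0 1 \<Longrightarrow> \<bar>F x \<zeta>\<bar> \<le> B"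
proof -
  have "continuous_on (K \<times> sphere 0 1) (\<lambda>(x, \<zeta>). F x \<zeta>)"
    using assms by (intro continuous_on_subset[OF assms(1)]) auto
  then have "compact ((\<lambda>(x, \<zeta>). F x \<zeta>) ` (K \<times> sphere 0 1))"
    using assms(2) by (intro compact_continuous_image compact_Times) auto
  then obtain B where B: "\<And>z. z \<in> (\<lambda>(x, \<zeta>). F x \<zeta>) ` (K \<times> sphere 0 1) \<Longrightarrow> norm z \<le> B"
    using compact_imp_bounded bounded_pos by metis
  show ?thesis using B by (intro that[of B]) force
qed

lemma continuous_on_integral:
  fixes F :: "real ^ 'n \<Rightarrow> real ^ 'n \<Rightarrow> real"
  assumes F: "continuous_on (S \<times> sphere 0 1) (\<lambda>(x, \<zeta>). F x \<zeta>)"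
  shows "continuous_on S (\<lambda>x. \<integral>\<zeta>. F x \<zeta> \<partial>\<sigma>)"
  unfolding continuous_on_sequentially comp_def
proof (intro allI ballI impI, elim conjE)
  fix X x assume x: "x \<in> S" and X: "\<forall>k. X k \<in> S" and lim: "X \<longlonglongrightarrow> x"
  have "insert x (range X) \<subseteq> S" using x X by auto
  then obtain B where B: "\<And>y \<zeta>. y \<in> insert x (range X) \<Longrightarrow> \<zeta> \<in> sphere 0 1 \<Longrightarrow> \<bar>F y \<zeta>\<bar> \<le> B"
    using bounded_on_compact_times_sphere[OF F compact_sequence_with_limit[OF lim]] by blast
  show "(\<lambda>k. \<integral>\<zeta>. F (X k) \<zeta> \<partial>\<sigma>) \<longlonglongrightarrow> (\<integral>\<zeta>. F x \<zeta> \<partial>\<sigma>)"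
  proof (rule dominated_limit[where B = B])
    fix \<zeta> :: "real ^ 'n" assume z: "\<zeta> \<in> sphere 0 1"
    have "continuous_on S (\<lambda>y. (y, \<zeta>))"
      by (intro continuous_on_Pair continuous_on_const continuous_on_id)
    moreover have "(\<lambda>y. (y, \<zeta>)) ` S \<subseteq> S \<times> sphere 0 1" using z by auto
    ultimately have "continuous_on S (\<lambda>y. F y \<zeta>)" using continuous_on_compose2[OF F] by fastforce
    then show "(\<lambda>k. F (X k) \<zeta>) \<longlonglongrightarrow> F x \<zeta>"
      using x X lim unfolding continuous_on_sequentially comp_def by blast
  qed (use continuous_on_section[OF F] X x B in auto)
qed

text \<open>Differentiation under the integral sign. On a short segment through \<open>x\<close>, which is compact,
\<open>F1\<close> is bounded, so by the mean value theorem the difference quotients are dominated by a constant.\<close>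

lemma DERIV_integral_along_line:
  fixes F F1 :: "real ^ 'n \<Rightarrow> real ^ 'n \<Rightarrow> real"
  assumes S: "open S" "x \<in> S"
    and F: "continuous_on (S \<times> sphere 0 1) (\<lambda>(x, \<zeta>). F x \<zeta>)"
    and F1: "continuous_on (S \<times> sphere 0 1) (\<lambda>(x, \<zeta>). F1 x \<zeta>)"
    and d: "\<And>y \<zeta>. y \<in> S \<Longrightarrow> \<zeta> \<in> sphere 0 1 \<Longrightarrow>
        ((\<lambda>t. F (y + t *\<^sub>R v) \<zeta>) has_real_derivative F1 y \<zeta>) (at 0)"
  shows "((\<lambda>t. \<integral>\<zeta>. F (x + t *\<^sub>R v) \<zeta> \<partial>\<sigma>) has_real_derivative (\<integral>\<zeta>. F1 x \<zeta> \<partial>\<sigma>)) (at 0)"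
proof -
  have "((\<lambda>t. x + t *\<^sub>R v) \<longlongrightarrow> x + 0 *\<^sub>R v) (nhds 0)"
    by (intro tendsto_intros filterlim_ident)
  then have "\<forall>\<^sub>F t in nhds 0. x + t *\<^sub>R v \<in> S"
    using S by (auto dest: topological_tendstoD)
  then obtain e where e: "e > 0" "\<And>t. \<bar>t\<bar> < e \<Longrightarrow> x + t *\<^sub>R v \<in> S"
    unfolding eventually_nhds_metric by (auto simp: dist_real_def)
  define \<delta> where "\<delta> = e / 2"
  have \<delta>: "\<delta> > 0" "\<And>t. t \<in> {- \<delta>..\<delta>} \<Longrightarrow> x + t *\<^sub>R v \<in> S"
    using e by (auto simp: \<delta>_def)
  define K where "K = (\<lambda>t. x + t *\<^sub>R v) ` {- \<delta>..\<delta>}"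
  have "compact K" unfolding K_def by (intro compact_continuous_image continuous_intros compact_Icc)
  then obtain B where B: "\<And>y \<zeta>. y \<in> K \<Longrightarrow> \<zeta> \<in> sphere 0 1 \<Longrightarrow> \<bar>F1 y \<zeta>\<bar> \<le> B"
    using bounded_on_compact_times_sphere[OF F1, of K] \<delta>(2) unfolding K_def by blast
  have dt: "((\<lambda>t. F (x + t *\<^sub>R v) \<zeta>) has_real_derivative F1 (x + t *\<^sub>R v) \<zeta>) (at t)"
    if "t \<in> {- \<delta>..\<delta>}" "\<zeta> \<in> sphere 0 1" for t \<zeta>
    using has_derivative_along_line_shift[of "\<lambda>y. F y \<zeta>", OF d[OF \<delta>(2)[OF that(1)] that(2)]] .
  have quot: "\<bar>(F (x + t *\<^sub>R v) \<zeta> - F x \<zeta>) / t\<bar> \<le> B"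
    if "t \<in> {- \<delta>..\<delta>}" "t \<noteq> 0" "\<zeta> \<in> sphere 0 1" for t \<zeta>
  proof -
    have "norm (F (x + t *\<^sub>R v) \<zeta> - F (x + 0 *\<^sub>R v) \<zeta>) \<le> B * norm (t - 0)"
    proof (rule field_differentiable_bound[of "{- \<delta>..\<delta>}" _ "\<lambda>t. F1 (x + t *\<^sub>R v) \<zeta>"])
      fix s assume s: "s \<in> {- \<delta>..\<delta>}"
      show "((\<lambda>t. F (x + t *\<^sub>R v) \<zeta>) has_field_derivative F1 (x + s *\<^sub>R v) \<zeta>) (at s within {- \<delta>..\<delta>})"
        using dt[OF s that(3)] by (rule has_field_derivative_at_within)
      show "norm (F1 (x + s *\<^sub>R v) \<zeta>) \<le> B" unfolding real_norm_def using s by (intro B that(3)) (auto simp: K_def)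
    qed (use that \<delta> in auto)
    then show ?thesis using that(2) by (simp add: divide_le_eq)
  qed
  note secF = continuous_on_section[OF F] and secF1 = continuous_on_section[OF F1]
  have "((\<lambda>t. ((\<integral>\<zeta>. F (x + t *\<^sub>R v) \<zeta> \<partial>\<sigma>) - (\<integral>\<zeta>. F x \<zeta> \<partial>\<sigma>)) / t) \<longlongrightarrow> (\<integral>\<zeta>. F1 x \<zeta> \<partial>\<sigma>)) (at 0)"
    unfolding tendsto_at_iff_sequentially comp_def
  proof (intro allI impI)
    fix X :: "nat \<Rightarrow> real" assume X: "\<forall>k. X k \<in> UNIV - {0}" "X \<longlonglongrightarrow> 0"
    obtain m where m: "\<And>k. k \<ge> m \<Longrightarrow> \<bar>X k\<bar> < \<delta>"
      using LIMSEQ_D[OF X(2) \<delta>(1)] by auto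
    define Y where "Y = (\<lambda>k. X (k + m))"
    have Y: "Y k \<in> {- \<delta>..\<delta>}" "Y k \<noteq> 0" for k
      using m[of "k + m"] X(1) by (auto simp: Y_def abs_less_iff)
    have Y0: "Y \<longlonglongrightarrow> 0" unfolding Y_def using X(2) by (rule LIMSEQ_ignore_initial_segment)
    have "(\<lambda>k. \<integral>\<zeta>. (F (x + Y k *\<^sub>R v) \<zeta> - F x \<zeta>) / Y k \<partial>\<sigma>) \<longlonglongrightarrow> (\<integral>\<zeta>. F1 x \<zeta> \<partial>\<sigma>)"
    proof (rule dominated_limit[where B = B])
      show "continuous_on (sphere 0 1) (\<lambda>\<zeta>. (F (x + Y k *\<^sub>R v) \<zeta> - F x \<zeta>) / Y k)" for k
        using Y[of k] \<delta>(2) S(2) by (intro continuous_intros secF) auto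
      show "continuous_on (sphere 0 1) (F1 x)" using S(2) by (rule secF1)
      show "\<bar>(F (x + Y k *\<^sub>R v) \<zeta> - F x \<zeta>) / Y k\<bar> \<le> B" if "\<zeta> \<in> sphere 0 1" for k \<zeta>
        using quot[OF Y that] .
      fix \<zeta> :: "real ^ 'n" assume z: "\<zeta> \<in> sphere 0 1"
      have "((\<lambda>t. (F (x + t *\<^sub>R v) \<zeta> - F (x + 0 *\<^sub>R v) \<zeta>) / (t - 0)) \<longlongrightarrow> F1 x \<zeta>) (at 0)"
        using d[OF S(2) z] unfolding has_field_derivative_iff .
      then show "(\<lambda>k. (F (x + Y k *\<^sub>R v) \<zeta> - F x \<zeta>) / Y k) \<longlonglongrightarrow> F1 x \<zeta>"
        using Y Y0 unfolding tendsto_at_iff_sequentially comp_def by simp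
    qed
    moreover have "(\<integral>\<zeta>. (F (x + Y k *\<^sub>R v) \<zeta> - F x \<zeta>) / Y k \<partial>\<sigma>)
        = ((\<integral>\<zeta>. F (x + Y k *\<^sub>R v) \<zeta> \<partial>\<sigma>) - (\<integral>\<zeta>. F x \<zeta> \<partial>\<sigma>)) / Y k" for k
    proof -
      have "integrable \<sigma> (F (x + Y k *\<^sub>R v))" "integrable \<sigma> (F x)"
        using \<delta>(2)[OF Y(1)[of k]] S(2) by (auto intro!: integrable_if_continuous secF)
      then show ?thesis by simp
    qed
    ultimately have "(\<lambda>k. ((\<integral>\<zeta>. F (x + Y k *\<^sub>R v) \<zeta> \<partial>\<sigma>) - (\<integral>\<zeta>. F x \<zeta> \<partial>\<sigma>)) / Y k) \<longlonglongrightarrow> (\<integral>\<zeta>. F1 x \<zeta> \<partial>\<sigma>)"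
      by (simp only:)
    then show "(\<lambda>k. ((\<integral>\<zeta>. F (x + X k *\<^sub>R v) \<zeta> \<partial>\<sigma>) - (\<integral>\<zeta>. F x \<zeta> \<partial>\<sigma>)) / X k) \<longlonglongrightarrow> (\<integral>\<zeta>. F1 x \<zeta> \<partial>\<sigma>)"
      unfolding Y_def by (rule LIMSEQ_offset)
  qed
  then show ?thesis unfolding has_field_derivative_iff by simp
qed

end

text \<open>The image of the uniform measure on the unit ball under radial projection. An orthogonal map
commutes with the projection away from the origin, so invariance of Lebesgue measure carries over.
The value of the projection at the origin, a null set, is arbitrary.\<close>

lemma sphere_measure_exists:
  obtains \<sigma> :: "(real ^ 'n::finite) measure" where "sphere_measure \<sigma>"
proof -
  define \<mu> :: "(real ^ 'n) measure" where "\<mu> = uniform_measure lborel (ball 0 1)"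
  obtain k :: 'n where True by simp
  define P where "P = (\<lambda>y :: real ^ 'n. if y = 0 then axis k 1 else y /\<^sub>R norm y)"
  have Pn: "norm (P y) = 1" for y by (simp add: P_def)
  have sets_\<mu>[measurable_cong]: "sets \<mu> = sets borel" by (simp add: \<mu>_def)
  have "P \<in> borel_measurable \<mu>" unfolding P_def by measurable
  then have Pm: "P \<in> measurable \<mu> (restrict_space borel (sphere 0 1))"
    by (intro measurable_restrict_space2) (auto simp: Pn)
  define \<sigma> where "\<sigma> = distr \<mu> (restrict_space borel (sphere 0 1)) P"
  have e1: "emeasure \<mu> (space \<mu>) = 1"
  proof -
    have "emeasure lborel (ball (0 :: real ^ 'n) 1) \<noteq> 0" "emeasure lborel (ball (0 :: real ^ 'n) 1) \<noteq> \<infinity>"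
      using emeasure_lborel_ball_finite[of "0 :: real ^ 'n" 1] content_ball_pos[of 1 "0 :: real ^ 'n"]
      by (auto simp: measure_def)
    then show ?thesis unfolding \<mu>_def by (simp add: ennreal_divide_self less_top)
  qed
  have AE0: "AE y in \<mu>. y \<noteq> 0"
  proof -
    have "AE y in lborel. y \<noteq> (0 :: real ^ 'n)" by (rule AE_lborel_singleton)
    then show ?thesis unfolding \<mu>_def by (intro AE_uniform_measureI) auto
  qed
  show ?thesis
  proof (rule that, intro sphere_measure.intro sphere_measure_axioms.intro finite_measureI)
    have es: "emeasure \<sigma> (space \<sigma>) = 1"
    proof -
      have "P -` sphere 0 1 \<inter> space \<mu> = space \<mu>" by (auto simp: Pn)
      then show ?thesis
        unfolding \<sigma>_def using Pm e1
        by (simp add: emeasure_distr space_restrict_space sets_restrict_space_iff)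
    qed
    show "emeasure \<sigma> (space \<sigma>) \<noteq> \<infinity>" using es by simp
    show "measure \<sigma> (space \<sigma>) = 1" using es by (simp add: measure_def)
    show "sets \<sigma> = sets (restrict_space borel (sphere 0 1))" by (simp add: \<sigma>_def)
    fix T :: "real ^ 'n \<Rightarrow> real ^ 'n" and f :: "real ^ 'n \<Rightarrow> real"
    assume T: "orthogonal_transformation T" and f: "continuous_on (sphere 0 1) f"
    have lin: "linear T" using T by (rule orthogonal_transformation_linear)
    have cont: "continuous_on A T" for A
      using lin by (simp add: linear_continuous_on linear_conv_bounded_linear)
    have Tm[measurable]: "T \<in> borel_measurable borel" using cont by (rule borel_measurable_continuous_onI)
    have fm: "f \<in> borel_measurable (restrict_space borel (sphere 0 1))"
      using f by (rule borel_measurable_continuous_on_restrict)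
    have "continuous_on (sphere 0 1) (\<lambda>\<zeta>. f (T \<zeta>))"
      using T by (intro continuous_on_compose2[OF f] cont) (auto simp: orthogonal_transformation_norm)
    then have fTm: "(\<lambda>\<zeta>. f (T \<zeta>)) \<in> borel_measurable (restrict_space borel (sphere 0 1))"
      by (rule borel_measurable_continuous_on_restrict)
    have fP: "(\<lambda>y. f (P y)) \<in> borel_measurable \<mu>" using measurable_compose[OF Pm fm] .
    then have fPb: "(\<lambda>y. f (P y)) \<in> borel_measurable borel"
      using measurable_cong_sets[OF sets_\<mu> refl] by blast
    have "(\<integral>\<zeta>. f (T \<zeta>) \<partial>\<sigma>) = (\<integral>y. f (T (P y)) \<partial>\<mu>)"
      unfolding \<sigma>_def by (rule integral_distr[OF Pm fTm])
    also have "\<dots> = (\<integral>y. f (P (T y)) \<partial>\<mu>)"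
    proof (rule integral_cong_AE)
      show "(\<lambda>y. f (T (P y))) \<in> borel_measurable \<mu>" using measurable_compose[OF Pm fTm] .
      show "(\<lambda>y. f (P (T y))) \<in> borel_measurable \<mu>" using measurable_compose[OF Tm fPb] measurable_cong_sets[OF sets_\<mu> refl] by blast
      show "AE y in \<mu>. f (T (P y)) = f (P (T y))"
        using AE0
      proof eventually_elim
        case (elim y)
        then have "T y \<noteq> 0" using orthogonal_transformation_norm[OF T, of y] by auto
        then show ?case using elim orthogonal_transformation_norm[OF T, of y]
          by (simp add: P_def linear_scale[OF lin])
      qed
    qed
    also have "\<dots> = (\<integral>y. f (P y) \<partial>(distr \<mu> borel T))"
      using fPb by (intro integral_distr[symmetric]) (auto simp: measurable_cong_sets[OF sets_\<mu> refl])
    also have "distr \<mu> borel T = \<mu>" unfolding \<mu>_def by (rule uniform_ball_measure_orthogonal_invariant[OF T])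
    also have "(\<integral>y. f (P y) \<partial>\<mu>) = (\<integral>\<zeta>. f \<zeta> \<partial>\<sigma>)"
      unfolding \<sigma>_def by (rule integral_distr[OF Pm fm, symmetric])
    finally show "(\<integral>\<zeta>. f (T \<zeta>) \<partial>\<sigma>) = (\<integral>\<zeta>. f \<zeta> \<partial>\<sigma>)" .
  qed
qed

section \<open>The Poisson kernel\<close>

text \<open>The kernel of the Poisson integral up to its normalizing constant, as a function of the squared
distances so that the chain rule above applies.\<close>

definition poisson_kernel :: "real \<Rightarrow> real ^ 'n::finite \<Rightarrow> real ^ 'n \<Rightarrow> real" where
  "poisson_kernel \<theta> x \<zeta> = (1 - (norm x)\<^sup>2) powr (1 + 2 * \<theta>)
     * ((norm (x - \<zeta>))\<^sup>2) powr (- (real CARD('n) / 2 + \<theta>))"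

text \<open>The logarithmic derivative of the kernel in \<open>x\<close> along \<open>v\<close>, followed by its derivative along \<open>w\<close>.
In these terms the first two derivatives of \<open>K\<close> are \<open>K * k\<^sub>v\<close> and \<open>K * (k\<^sub>v * k\<^sub>w + k\<^sub>v\<^sub>w)\<close>.\<close>

definition poisson_kernel_log1 :: "real \<Rightarrow> real ^ 'n::finite \<Rightarrow> real ^ 'n \<Rightarrow> real ^ 'n \<Rightarrow> real" where
  "poisson_kernel_log1 \<theta> v x \<zeta> = - 2 * (1 + 2 * \<theta>) * (x \<bullet> v) / (1 - (norm x)\<^sup>2)
     - 2 * (real CARD('n) / 2 + \<theta>) * ((x - \<zeta>) \<bullet> v) / (norm (x - \<zeta>))\<^sup>2"

definition poisson_kernel_log2 :: "real \<Rightarrow> real ^ 'n::finite \<Rightarrow> real ^ 'n \<Rightarrow> real ^ 'n \<Rightarrow> real ^ 'n \<Rightarrow> real" where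
  "poisson_kernel_log2 \<theta> v w x \<zeta> =
     - 2 * (1 + 2 * \<theta>) * ((v \<bullet> w) / (1 - (norm x)\<^sup>2) + 2 * (x \<bullet> v) * (x \<bullet> w) / (1 - (norm x)\<^sup>2)\<^sup>2)
     - 2 * (real CARD('n) / 2 + \<theta>) * ((v \<bullet> w) / (norm (x - \<zeta>))\<^sup>2
         - 2 * ((x - \<zeta>) \<bullet> v) * ((x - \<zeta>) \<bullet> w) / ((norm (x - \<zeta>))\<^sup>2)\<^sup>2)"

lemma ball_sphere_neq: "x \<in> ball 0 1 \<Longrightarrow> \<zeta> \<in> sphere 0 1 \<Longrightarrow> x \<noteq> \<zeta>"
  by auto

lemma kernel_pos:
  assumes "x \<in> ball 0 1" "\<zeta> \<in> sphere 0 1"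
  shows "poisson_kernel \<theta> x \<zeta> > 0"
proof -
  have "(norm (x - \<zeta>))\<^sup>2 > 0" using ball_sphere_neq[OF assms] by simp
  then show ?thesis using norm_sq_less_1[OF assms(1)] by (simp add: poisson_kernel_def)
qed

lemma DERIV_kernel:
  fixes x \<zeta> v :: "real ^ 'n::finite"
  assumes x: "x \<in> ball 0 1" and z: "\<zeta> \<in> sphere 0 1"
  shows "((\<lambda>t. poisson_kernel \<theta> (x + t *\<^sub>R v) \<zeta>) has_real_derivative poisson_kernel \<theta> x \<zeta> * poisson_kernel_log1 \<theta> v x \<zeta>) (at 0)"
proof -
  define a m where "a = 1 + 2 * \<theta>" and "m = real CARD('n) / 2 + \<theta>"
  have s: "(norm x)\<^sup>2 < 1" by (rule norm_sq_less_1[OF x])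
  have q: "(norm (x - \<zeta>))\<^sup>2 > 0" using ball_sphere_neq[OF x z] by simp
  have "((\<lambda>s. (1 - s) powr a) has_real_derivative - a * (1 - (norm (x - 0))\<^sup>2) powr (a - 1)) (at ((norm (x - 0))\<^sup>2))"
    using s by (intro DERIV_one_minus_powr) simp
  from fun_sqdist_has_derivative_along_line[OF this, of v]
  have dA: "((\<lambda>t. (1 - (norm (x + t *\<^sub>R v))\<^sup>2) powr a) has_real_derivative
      2 * (x \<bullet> v) * (- a * (1 - (norm x)\<^sup>2) powr (a - 1))) (at 0)" by simp
  have "((\<lambda>s. s powr (- m)) has_real_derivative - m * ((norm (x - \<zeta>))\<^sup>2) powr (- m - 1)) (at ((norm (x - \<zeta>))\<^sup>2))"
    using q by (auto intro!: derivative_eq_intros)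
  from fun_sqdist_has_derivative_along_line[OF this, of v]
  have dB: "((\<lambda>t. ((norm (x + t *\<^sub>R v - \<zeta>))\<^sup>2) powr (- m)) has_real_derivative
      2 * ((x - \<zeta>) \<bullet> v) * (- m * ((norm (x - \<zeta>))\<^sup>2) powr (- m - 1))) (at 0)" .
  define A B where "A = (1 - (norm x)\<^sup>2) powr a" and "B = ((norm (x - \<zeta>))\<^sup>2) powr (- m)"
  have p: "(1 - (norm x)\<^sup>2) powr (a - 1) = A / (1 - (norm x)\<^sup>2)"
      "((norm (x - \<zeta>))\<^sup>2) powr (- m - 1) = B / (norm (x - \<zeta>))\<^sup>2"
    using s q by (simp_all add: A_def B_def powr_diff del: zero_less_power2)
  have "2 * (x \<bullet> v) * (- a * (1 - (norm x)\<^sup>2) powr (a - 1)) * B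
      + 2 * ((x - \<zeta>) \<bullet> v) * (- m * ((norm (x - \<zeta>))\<^sup>2) powr (- m - 1)) * A
      = A * B * poisson_kernel_log1 \<theta> v x \<zeta>"
  proof -
    have "2 * X * (- a * (A / Y)) * B + 2 * Z * (- m * (B / Q)) * A = A * B * (- 2 * a * X / Y - 2 * m * Z / Q)"
      for X Y Z Q :: real by (simp add: algebra_simps)
    then show ?thesis unfolding p unfolding poisson_kernel_log1_def a_def[symmetric] m_def[symmetric] .
  qed
  then show ?thesis
    using DERIV_mult[OF dA dB] unfolding poisson_kernel_def A_def B_def a_def[symmetric] m_def[symmetric] by simp
qed

lemma DERIV_kernel_log1:
  fixes x \<zeta> v w :: "real ^ 'n::finite"
  assumes x: "x \<in> ball 0 1" and z: "\<zeta> \<in> sphere 0 1"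
  shows "((\<lambda>t. poisson_kernel_log1 \<theta> v (x + t *\<^sub>R w) \<zeta>) has_real_derivative poisson_kernel_log2 \<theta> v w x \<zeta>) (at 0)"
proof -
  have s: "1 - (norm x)\<^sup>2 \<noteq> 0" using norm_sq_less_1[OF x] by simp
  have q: "(norm (x - \<zeta>))\<^sup>2 \<noteq> 0" using ball_sphere_neq[OF x z] by simp
  have d1: "((\<lambda>t. 1 - (norm (x + t *\<^sub>R w))\<^sup>2) has_real_derivative - 2 * (x \<bullet> w)) (at 0)"
    using DERIV_diff[OF DERIV_const sqdist_has_derivative_along_line[of x w 0]] by simp
  note d2 = sqdist_has_derivative_along_line[of x w \<zeta>]
  have d3: "((\<lambda>t. (x + t *\<^sub>R w) \<bullet> v) has_real_derivative v \<bullet> w) (at 0)"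
    by (auto simp: inner_simps inner_commute intro!: derivative_eq_intros)
  have d4: "((\<lambda>t. (x + t *\<^sub>R w - \<zeta>) \<bullet> v) has_real_derivative v \<bullet> w) (at 0)"
    by (auto simp: inner_simps inner_commute intro!: derivative_eq_intros)
  have e1: "((\<lambda>t. ((x + t *\<^sub>R w) \<bullet> v) / (1 - (norm (x + t *\<^sub>R w))\<^sup>2)) has_real_derivative
      (v \<bullet> w) / (1 - (norm x)\<^sup>2) + 2 * (x \<bullet> v) * (x \<bullet> w) / (1 - (norm x)\<^sup>2)\<^sup>2) (at 0)"
  proof -
    have "((v \<bullet> w) * Q - X * (- 2 * Y)) / (Q * Q) = (v \<bullet> w) / Q + 2 * X * Y / Q\<^sup>2" if "Q \<noteq> 0" for X Y Q :: real
      using that by (simp add: add_divide_distrib power2_eq_square)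
    from this[OF s] show ?thesis using DERIV_divide[OF d3 d1] s by simp
  qed
  have e2: "((\<lambda>t. ((x + t *\<^sub>R w - \<zeta>) \<bullet> v) / (norm (x + t *\<^sub>R w - \<zeta>))\<^sup>2) has_real_derivative
      (v \<bullet> w) / (norm (x - \<zeta>))\<^sup>2 - 2 * ((x - \<zeta>) \<bullet> v) * ((x - \<zeta>) \<bullet> w) / ((norm (x - \<zeta>))\<^sup>2)\<^sup>2) (at 0)"
  proof -
    have "((v \<bullet> w) * Q - X * (2 * Y)) / (Q * Q) = (v \<bullet> w) / Q - 2 * X * Y / Q\<^sup>2" if "Q \<noteq> 0" for X Y Q :: real
      using that by (simp add: diff_divide_distrib power2_eq_square)
    from this[OF q] show ?thesis using DERIV_divide[OF d4 d2] q by simp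
  qed
  have "((\<lambda>t. - 2 * (1 + 2 * \<theta>) * (((x + t *\<^sub>R w) \<bullet> v) / (1 - (norm (x + t *\<^sub>R w))\<^sup>2))
      - 2 * (real CARD('n) / 2 + \<theta>) * (((x + t *\<^sub>R w - \<zeta>) \<bullet> v) / (norm (x + t *\<^sub>R w - \<zeta>))\<^sup>2))
      has_real_derivative poisson_kernel_log2 \<theta> v w x \<zeta>) (at 0)"
    unfolding poisson_kernel_log2_def by (intro DERIV_diff DERIV_cmult e1 e2)
  then show ?thesis unfolding poisson_kernel_log1_def by (simp only: times_divide_eq_right)
qed

lemma continuous_on_kernel:
  "continuous_on (ball 0 1 \<times> sphere 0 1) (\<lambda>(x, \<zeta>). poisson_kernel \<theta> x \<zeta>)"
  "continuous_on (ball 0 1 \<times> sphere 0 1) (\<lambda>(x, \<zeta>). poisson_kernel_log1 \<theta> v x \<zeta>)"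
  "continuous_on (ball 0 1 \<times> sphere 0 1) (\<lambda>(x, \<zeta>). poisson_kernel_log2 \<theta> v w x \<zeta>)"
proof -
  have 1: "1 - (norm (fst p))\<^sup>2 \<noteq> 0" if "p \<in> ball 0 1 \<times> sphere 0 1" for p :: "(real ^ 'n) \<times> (real ^ 'n)"
    using norm_sq_less_1[of "fst p"] that by auto
  have 2: "(norm (fst p - snd p))\<^sup>2 \<noteq> 0" if "p \<in> ball 0 1 \<times> sphere 0 1" for p :: "(real ^ 'n) \<times> (real ^ 'n)"
    using that by auto
  have 3: "(1 - (norm (fst p))\<^sup>2)\<^sup>2 \<noteq> 0" if "p \<in> ball 0 1 \<times> sphere 0 1" for p :: "(real ^ 'n) \<times> (real ^ 'n)"
    using 1[OF that] by simp
  have 4: "((norm (fst p - snd p))\<^sup>2)\<^sup>2 \<noteq> 0" if "p \<in> ball 0 1 \<times> sphere 0 1" for p :: "(real ^ 'n) \<times> (real ^ 'n)"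
    using 2[OF that] by simp
  show "continuous_on (ball 0 1 \<times> sphere 0 1) (\<lambda>(x, \<zeta>). poisson_kernel \<theta> x \<zeta>)"
    unfolding poisson_kernel_def case_prod_beta by (intro continuous_intros ballI 1 2) auto
  show "continuous_on (ball 0 1 \<times> sphere 0 1) (\<lambda>(x, \<zeta>). poisson_kernel_log1 \<theta> v x \<zeta>)"
    unfolding poisson_kernel_log1_def case_prod_beta by (intro continuous_intros ballI 1 2) auto
  show "continuous_on (ball 0 1 \<times> sphere 0 1) (\<lambda>(x, \<zeta>). poisson_kernel_log2 \<theta> v w x \<zeta>)"
    unfolding poisson_kernel_log2_def case_prod_beta by (intro continuous_intros ballI 1 2 3 4) auto
qed

text \<open>The equation \<open>L K = 0\<close> divided by \<open>K\<close>. With \<open>d = x - \<zeta>\<close>, \<open>y = 1 - |x|\<^sup>2\<close> and \<open>q = |d|\<^sup>2\<close>, the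
condition \<open>|\<zeta>| = 1\<close> gives \<open>2 x\<cdot>d = q - y\<close>. Everything is then a rational function of \<open>y\<close> and
\<open>q\<close> that vanishes identically.\<close>

lemma kernel_equation:
  fixes x \<zeta> :: "real ^ 'n::finite"
  assumes x: "x \<in> ball 0 1" and z: "\<zeta> \<in> sphere 0 1"
  shows "(1 - (norm x)\<^sup>2) / 4 * (\<Sum>j\<in>UNIV. poisson_kernel_log1 \<theta> (axis j 1) x \<zeta> * poisson_kernel_log1 \<theta> (axis j 1) x \<zeta>
            + poisson_kernel_log2 \<theta> (axis j 1) (axis j 1) x \<zeta>)
     + \<theta> * (\<Sum>j\<in>UNIV. x $ j * poisson_kernel_log1 \<theta> (axis j 1) x \<zeta>)
     + \<theta> * (real CARD('n) / 2 - 1 - \<theta>) = 0"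
proof -
  define d where "d = x - \<zeta>"
  define y q e n where "y = 1 - (norm x)\<^sup>2" and "q = (norm d)\<^sup>2" and "e = x \<bullet> d" and "n = real CARD('n)"
  define a m where "a = 1 + 2 * \<theta>" and "m = n / 2 + \<theta>"
  have y: "y \<noteq> 0" using norm_sq_less_1[OF x] by (simp add: y_def)
  have q: "q \<noteq> 0" using ball_sphere_neq[OF x z] by (simp add: q_def d_def)
  have xx: "x \<bullet> x = 1 - y" by (simp add: y_def power2_norm_eq_inner)
  have dd: "d \<bullet> d = q" by (simp add: q_def power2_norm_eq_inner)
  have "\<zeta> \<bullet> \<zeta> = 1" using z by (simp add: power2_norm_eq_inner[symmetric])
  then have "1 = (x - d) \<bullet> (x - d)" by (simp add: d_def)
  also have "\<dots> = (1 - y) - 2 * e + q" using xx dd by (simp add: inner_simps inner_commute e_def)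
  finally have e: "e = (q - y) / 2" by simp
  define \<alpha> \<beta> where "\<alpha> = - 2 * a / y" and "\<beta> = - 2 * m / q"
  have l1: "poisson_kernel_log1 \<theta> (axis j 1) x \<zeta> = \<alpha> * x $ j + \<beta> * d $ j" for j
  proof -
    have "poisson_kernel_log1 \<theta> (axis j 1) x \<zeta> = - 2 * a * x $ j / y - 2 * m * d $ j / q"
      unfolding poisson_kernel_log1_def a_def m_def n_def y_def q_def d_def
      by (simp only: inner_axis inner_real_def mult_1_right)
    then show ?thesis by (simp add: \<alpha>_def \<beta>_def)
  qed
  have ax: "axis j 1 \<bullet> (axis j 1 :: real ^ 'n) = 1" for j by (simp add: inner_axis_axis)
  have l2: "poisson_kernel_log2 \<theta> (axis j 1) (axis j 1) x \<zeta>
      = (\<alpha> + \<beta>) + (2 * \<alpha> / y) * (x $ j * x $ j) - (2 * \<beta> / q) * (d $ j * d $ j)" for j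
  proof -
    have "poisson_kernel_log2 \<theta> (axis j 1) (axis j 1) x \<zeta>
      = - 2 * a * (1 / y + 2 * x $ j * x $ j / y\<^sup>2) - 2 * m * (1 / q - 2 * d $ j * d $ j / q\<^sup>2)"
      unfolding poisson_kernel_log2_def a_def m_def n_def y_def q_def d_def ax by (simp add: inner_axis)
    then show ?thesis
      unfolding \<alpha>_def \<beta>_def by (simp add: algebra_simps power2_eq_square)
  qed
  have S1: "(\<Sum>j\<in>UNIV. x $ j * (\<alpha> * x $ j + \<beta> * d $ j)) = \<alpha> * (1 - y) + \<beta> * e"
  proof -
    have "(\<Sum>j\<in>UNIV. x $ j * (\<alpha> * x $ j + \<beta> * d $ j)) = \<alpha> * (\<Sum>j\<in>UNIV. x $ j * x $ j) + \<beta> * (\<Sum>j\<in>UNIV. x $ j * d $ j)"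
      by (simp add: sum_distrib_left sum.distrib[symmetric] algebra_simps)
    then show ?thesis unfolding sum_mult_nth_eq_inner xx e_def[symmetric] .
  qed
  have S2: "(\<Sum>j\<in>UNIV. (\<alpha> * x $ j + \<beta> * d $ j) * (\<alpha> * x $ j + \<beta> * d $ j)
        + ((\<alpha> + \<beta>) + (2 * \<alpha> / y) * (x $ j * x $ j) - (2 * \<beta> / q) * (d $ j * d $ j)))
      = (\<alpha>\<^sup>2 + 2 * \<alpha> / y) * (1 - y) + 2 * \<alpha> * \<beta> * e + (\<beta>\<^sup>2 - 2 * \<beta> / q) * q + n * (\<alpha> + \<beta>)"
  proof -
    have "(\<Sum>j\<in>UNIV. (\<alpha> * x $ j + \<beta> * d $ j) * (\<alpha> * x $ j + \<beta> * d $ j)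
        + ((\<alpha> + \<beta>) + (2 * \<alpha> / y) * (x $ j * x $ j) - (2 * \<beta> / q) * (d $ j * d $ j)))
      = (\<Sum>j\<in>UNIV. (\<alpha>\<^sup>2 + 2 * \<alpha> / y) * (x $ j * x $ j) + 2 * \<alpha> * \<beta> * (x $ j * d $ j)
          + (\<beta>\<^sup>2 - 2 * \<beta> / q) * (d $ j * d $ j) + (\<alpha> + \<beta>))"
      by (intro sum.cong refl) (simp add: algebra_simps power2_eq_square)
    also have "\<dots> = (\<alpha>\<^sup>2 + 2 * \<alpha> / y) * (\<Sum>j\<in>UNIV. x $ j * x $ j) + 2 * \<alpha> * \<beta> * (\<Sum>j\<in>UNIV. x $ j * d $ j)
          + (\<beta>\<^sup>2 - 2 * \<beta> / q) * (\<Sum>j\<in>UNIV. d $ j * d $ j) + n * (\<alpha> + \<beta>)"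
      by (simp only: sum.distrib sum_distrib_left[symmetric] sum_constant n_def) (simp only: distrib_left)
    finally show ?thesis unfolding sum_mult_nth_eq_inner xx dd e_def[symmetric] .
  qed
  have "y / 4 * ((\<alpha>\<^sup>2 + 2 * \<alpha> / y) * (1 - y) + 2 * \<alpha> * \<beta> * e + (\<beta>\<^sup>2 - 2 * \<beta> / q) * q + n * (\<alpha> + \<beta>))
     + \<theta> * (\<alpha> * (1 - y) + \<beta> * e) + \<theta> * (n / 2 - 1 - \<theta>) = 0"
    unfolding e \<alpha>_def \<beta>_def a_def m_def using y q
    by (simp add: divide_simps power2_eq_square) (simp add: algebra_simps)
  then show ?thesis unfolding l1 l2 S1 S2 y_def[symmetric] n_def[symmetric] by simp
qed

text \<open>Both summands of the logarithmic derivative are at most of the order of the inverse distance to the sphere.\<close>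

lemma poisson_kernel_log1_bound:
  fixes x \<zeta> v :: "real ^ 'n::finite"
  assumes x: "x \<in> ball 0 1" and z: "\<zeta> \<in> sphere 0 1" and th: "\<theta> > - 1 / 2" and n: "CARD('n) \<ge> 2"
  shows "\<bar>poisson_kernel_log1 \<theta> v x \<zeta>\<bar> \<le> (2 * (1 + 2 * \<theta>) + 4 * (real CARD('n) / 2 + \<theta>)) / (1 - (norm x)\<^sup>2) * norm v"
proof -
  define a m y p where "a = 1 + 2 * \<theta>" and "m = real CARD('n) / 2 + \<theta>"
    and "y = 1 - (norm x)\<^sup>2" and "p = norm (x - \<zeta>)"
  have am: "a > 0" "m > 0" using th n by (auto simp: a_def m_def)
  have nx: "norm x < 1" using x by simp
  have y: "y > 0" using norm_sq_less_1[OF x] by (simp add: y_def)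
  have yp: "y \<le> 2 * p" using one_minus_norm_sq_le_dist[OF nx, of \<zeta>] z by (simp add: y_def p_def)
  have p: "p > 0" using y yp by simp
  have "\<bar>x \<bullet> v\<bar> \<le> 1 * norm v"
    using Cauchy_Schwarz_ineq2[of x v] nx mult_right_mono[of "norm x" 1 "norm v"] by simp
  then have "2 * a * \<bar>x \<bullet> v\<bar> / y \<le> 2 * a * norm v / y"
    using am y by (intro divide_right_mono mult_left_mono) auto
  moreover have "2 * m * \<bar>(x - \<zeta>) \<bullet> v\<bar> / p\<^sup>2 \<le> 4 * m * norm v / y"
  proof -
    have "2 * m * \<bar>(x - \<zeta>) \<bullet> v\<bar> / p\<^sup>2 \<le> 2 * m * (p * norm v) / p\<^sup>2"
      using am Cauchy_Schwarz_ineq2[of "x - \<zeta>" v]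
      by (intro divide_right_mono mult_left_mono) (auto simp: p_def)
    also have "\<dots> = 2 * m * norm v * (1 / p)" using p by (simp add: power2_eq_square)
    also have "\<dots> \<le> 2 * m * norm v * (2 / y)"
      using am yp y p by (intro mult_left_mono) (auto simp: field_simps)
    finally show ?thesis by simp
  qed
  moreover have "\<bar>poisson_kernel_log1 \<theta> v x \<zeta>\<bar> \<le> 2 * a * \<bar>x \<bullet> v\<bar> / y + 2 * m * \<bar>(x - \<zeta>) \<bullet> v\<bar> / p\<^sup>2"
  proof -
    have "poisson_kernel_log1 \<theta> v x \<zeta> = - (2 * a * (x \<bullet> v) / y) - 2 * m * ((x - \<zeta>) \<bullet> v) / p\<^sup>2"
      unfolding poisson_kernel_log1_def a_def[symmetric] m_def[symmetric] y_def[symmetric] p_def[symmetric] by simp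
    also have "\<bar>\<dots>\<bar> \<le> \<bar>2 * a * (x \<bullet> v) / y\<bar> + \<bar>2 * m * ((x - \<zeta>) \<bullet> v) / p\<^sup>2\<bar>"
      using abs_triangle_ineq4[of "- (2 * a * (x \<bullet> v) / y)" "2 * m * ((x - \<zeta>) \<bullet> v) / p\<^sup>2"] by simp
    also have "\<dots> = 2 * a * \<bar>x \<bullet> v\<bar> / y + 2 * m * \<bar>(x - \<zeta>) \<bullet> v\<bar> / p\<^sup>2"
      using am y by (simp add: abs_mult)
    finally show ?thesis .
  qed
  ultimately have "\<bar>poisson_kernel_log1 \<theta> v x \<zeta>\<bar> \<le> 2 * a * norm v / y + 4 * m * norm v / y" by linarith
  also have "\<dots> = (2 * a + 4 * m) / y * norm v" by (simp add: algebra_simps add_divide_distrib)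
  finally show ?thesis unfolding a_def m_def y_def .
qed

context sphere_measure
begin

definition poisson :: "real \<Rightarrow> (real ^ 'n \<Rightarrow> real) \<Rightarrow> real ^ 'n \<Rightarrow> real" where
  "poisson \<theta> \<phi> x = (\<integral>\<zeta>. poisson_kernel \<theta> x \<zeta> * \<phi> \<zeta> \<partial>\<sigma>)"

lemma continuous_on_times_data:
  assumes "continuous_on (ball 0 1 \<times> sphere 0 1) (\<lambda>(x, \<zeta>). F x \<zeta>)" "continuous_on (sphere 0 1) \<phi>"
  shows "continuous_on (ball 0 1 \<times> sphere 0 1) (\<lambda>(x, \<zeta>). F x \<zeta> * \<phi> \<zeta> :: real)"
proof -
  have "continuous_on (ball 0 1 \<times> sphere 0 1) (\<lambda>p. \<phi> (snd p))"
    by (intro continuous_on_compose2[OF assms(2)] continuous_intros) auto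
  then show ?thesis using assms(1) unfolding case_prod_beta by (intro continuous_on_mult)
qed

lemma continuous_on_kernel1:
  "continuous_on (ball 0 1 \<times> sphere 0 1) (\<lambda>(x, \<zeta>). poisson_kernel \<theta> x \<zeta> * poisson_kernel_log1 \<theta> v x \<zeta>)"
  using continuous_on_mult[OF continuous_on_kernel(1) continuous_on_kernel(2)] by (simp add: case_prod_beta)

lemma continuous_on_kernel2:
  "continuous_on (ball 0 1 \<times> sphere 0 1)
    (\<lambda>(x, \<zeta>). poisson_kernel \<theta> x \<zeta> * (poisson_kernel_log1 \<theta> v x \<zeta> * poisson_kernel_log1 \<theta> w x \<zeta> + poisson_kernel_log2 \<theta> v w x \<zeta>))"
  using continuous_on_mult[OF continuous_on_kernel(1) continuous_on_add[OF continuous_on_mult[OF continuous_on_kernel(2) continuous_on_kernel(2)] continuous_on_kernel(3)]]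
  by (simp add: case_prod_beta)

lemma poisson_derivative_along_line:
  assumes \<phi>: "continuous_on (sphere 0 1) \<phi>" and x: "x \<in> ball 0 1"
  shows "((\<lambda>t. poisson \<theta> \<phi> (x + t *\<^sub>R v)) has_real_derivative
     (\<integral>\<zeta>. poisson_kernel \<theta> x \<zeta> * poisson_kernel_log1 \<theta> v x \<zeta> * \<phi> \<zeta> \<partial>\<sigma>)) (at 0)"
  unfolding poisson_def
  by (rule DERIV_integral_along_line[OF open_ball x continuous_on_times_data[OF continuous_on_kernel(1) \<phi>]
        continuous_on_times_data[OF continuous_on_kernel1 \<phi>] DERIV_cmult_right[OF DERIV_kernel]])

lemma poisson_jet:
  assumes \<phi>: "continuous_on (sphere 0 1) \<phi>"
  obtains u1 u2 where "C2_jet (ball 0 1) (poisson \<theta> \<phi>) u1 u2"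
    "\<And>x. x \<in> ball 0 1 \<Longrightarrow> L_jet \<theta> (poisson \<theta> \<phi>) u1 u2 x = 0"
proof -
  define k1 where "k1 = (\<lambda>(j :: 'n) x \<zeta>. poisson_kernel \<theta> x \<zeta> * poisson_kernel_log1 \<theta> (axis j 1) x \<zeta> * \<phi> \<zeta>)"
  define k2 where "k2 = (\<lambda>(j :: 'n) (k :: 'n) x \<zeta>. poisson_kernel \<theta> x \<zeta> *
      (poisson_kernel_log1 \<theta> (axis j 1) x \<zeta> * poisson_kernel_log1 \<theta> (axis k 1) x \<zeta> + poisson_kernel_log2 \<theta> (axis j 1) (axis k 1) x \<zeta>) * \<phi> \<zeta>)"
  have c0: "continuous_on (ball 0 1 \<times> sphere 0 1) (\<lambda>(x, \<zeta>). poisson_kernel \<theta> x \<zeta> * \<phi> \<zeta>)"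
    by (rule continuous_on_times_data[OF continuous_on_kernel(1) \<phi>])
  have c1: "continuous_on (ball 0 1 \<times> sphere 0 1) (\<lambda>(x, \<zeta>). k1 j x \<zeta>)" for j
    unfolding k1_def by (rule continuous_on_times_data[OF continuous_on_kernel1 \<phi>])
  have c2: "continuous_on (ball 0 1 \<times> sphere 0 1) (\<lambda>(x, \<zeta>). k2 j k x \<zeta>)" for j k
    unfolding k2_def by (rule continuous_on_times_data[OF continuous_on_kernel2 \<phi>])
  have J: "C2_jet (ball 0 1) (poisson \<theta> \<phi>) (\<lambda>j x. \<integral>\<zeta>. k1 j x \<zeta> \<partial>\<sigma>) (\<lambda>j k x. \<integral>\<zeta>. k2 j k x \<zeta> \<partial>\<sigma>)"
  proof (rule C2_jetI)
    show "continuous_on (ball 0 1) (poisson \<theta> \<phi>)"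
      using continuous_on_integral[OF c0] by (simp add: poisson_def[abs_def])
    show "continuous_on (ball 0 1) (\<lambda>x. \<integral>\<zeta>. k1 j x \<zeta> \<partial>\<sigma>)" for j by (rule continuous_on_integral[OF c1])
    show "continuous_on (ball 0 1) (\<lambda>x. \<integral>\<zeta>. k2 j k x \<zeta> \<partial>\<sigma>)" for j k by (rule continuous_on_integral[OF c2])
    fix x :: "real ^ 'n" assume x: "x \<in> ball 0 1"
    show "((\<lambda>t. poisson \<theta> \<phi> (x + t *\<^sub>R axis j 1)) has_real_derivative (\<integral>\<zeta>. k1 j x \<zeta> \<partial>\<sigma>)) (at 0)" for j
      unfolding k1_def by (rule poisson_derivative_along_line[OF \<phi> x])
    show "((\<lambda>t. \<integral>\<zeta>. k1 j (x + t *\<^sub>R axis k 1) \<zeta> \<partial>\<sigma>) has_real_derivative (\<integral>\<zeta>. k2 j k x \<zeta> \<partial>\<sigma>)) (at 0)" for j k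
    proof (rule DERIV_integral_along_line[OF open_ball x c1 c2])
      fix y \<zeta> :: "real ^ 'n" assume y: "y \<in> ball 0 1" and z: "\<zeta> \<in> sphere 0 1"
      have "((\<lambda>t. poisson_kernel \<theta> (y + t *\<^sub>R axis k 1) \<zeta> * poisson_kernel_log1 \<theta> (axis j 1) (y + t *\<^sub>R axis k 1) \<zeta>) has_real_derivative
          poisson_kernel \<theta> y \<zeta> * poisson_kernel_log1 \<theta> (axis k 1) y \<zeta> * poisson_kernel_log1 \<theta> (axis j 1) y \<zeta>
          + poisson_kernel_log2 \<theta> (axis j 1) (axis k 1) y \<zeta> * poisson_kernel \<theta> y \<zeta>) (at 0)"
        using DERIV_mult[OF DERIV_kernel[OF y z] DERIV_kernel_log1[OF y z]] by simp
      then have "((\<lambda>t. poisson_kernel \<theta> (y + t *\<^sub>R axis k 1) \<zeta> * poisson_kernel_log1 \<theta> (axis j 1) (y + t *\<^sub>R axis k 1) \<zeta> * \<phi> \<zeta>) has_real_derivative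
          (poisson_kernel \<theta> y \<zeta> * poisson_kernel_log1 \<theta> (axis k 1) y \<zeta> * poisson_kernel_log1 \<theta> (axis j 1) y \<zeta>
          + poisson_kernel_log2 \<theta> (axis j 1) (axis k 1) y \<zeta> * poisson_kernel \<theta> y \<zeta>) * \<phi> \<zeta>) (at 0)"
        by (rule DERIV_cmult_right)
      moreover have "(poisson_kernel \<theta> y \<zeta> * poisson_kernel_log1 \<theta> (axis k 1) y \<zeta> * poisson_kernel_log1 \<theta> (axis j 1) y \<zeta>
          + poisson_kernel_log2 \<theta> (axis j 1) (axis k 1) y \<zeta> * poisson_kernel \<theta> y \<zeta>) * \<phi> \<zeta> = k2 j k y \<zeta>"
        unfolding k2_def by (simp add: algebra_simps)
      ultimately show "((\<lambda>t. k1 j (y + t *\<^sub>R axis k 1) \<zeta>) has_real_derivative k2 j k y \<zeta>) (at 0)"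
        unfolding k1_def by simp
    qed
  qed
  show ?thesis
  proof (rule that[OF J])
    fix x :: "real ^ 'n" assume x: "x \<in> ball 0 1"
    have i0: "integrable \<sigma> (\<lambda>\<zeta>. poisson_kernel \<theta> x \<zeta> * \<phi> \<zeta>)"
      by (rule integrable_if_continuous[OF continuous_on_section[OF c0 x]])
    have i1: "integrable \<sigma> (k1 j x)" for j
      by (rule integrable_if_continuous[OF continuous_on_section[OF c1 x]])
    have i2: "integrable \<sigma> (k2 j k x)" for j k
      by (rule integrable_if_continuous[OF continuous_on_section[OF c2 x]])
    have "L_jet \<theta> (poisson \<theta> \<phi>) (\<lambda>j x. \<integral>\<zeta>. k1 j x \<zeta> \<partial>\<sigma>) (\<lambda>j k x. \<integral>\<zeta>. k2 j k x \<zeta> \<partial>\<sigma>) x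
      = (\<integral>\<zeta>. (1 - (norm x)\<^sup>2) / 4 * (\<Sum>j\<in>UNIV. k2 j j x \<zeta>) + \<theta> * (\<Sum>j\<in>UNIV. x $ j * k1 j x \<zeta>)
          + \<theta> * (real CARD('n) / 2 - 1 - \<theta>) * (poisson_kernel \<theta> x \<zeta> * \<phi> \<zeta>) \<partial>\<sigma>)"
      unfolding L_jet_def poisson_def using i0 i1 i2 by simp
    also have "\<dots> = (\<integral>\<zeta>. 0 \<partial>\<sigma>)"
    proof (rule Bochner_Integration.integral_cong[OF refl])
      fix \<zeta> assume "\<zeta> \<in> space \<sigma>"
      then have z: "\<zeta> \<in> sphere 0 1" by (simp add: space_eq)
      have "(\<Sum>j\<in>UNIV. k2 j j x \<zeta>) = (\<Sum>j\<in>UNIV. poisson_kernel_log1 \<theta> (axis j 1) x \<zeta> * poisson_kernel_log1 \<theta> (axis j 1) x \<zeta>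
            + poisson_kernel_log2 \<theta> (axis j 1) (axis j 1) x \<zeta>) * (poisson_kernel \<theta> x \<zeta> * \<phi> \<zeta>)"
        unfolding k2_def sum_distrib_right by (intro sum.cong refl) (simp add: algebra_simps)
      moreover have "(\<Sum>j\<in>UNIV. x $ j * k1 j x \<zeta>) = (\<Sum>j\<in>UNIV. x $ j * poisson_kernel_log1 \<theta> (axis j 1) x \<zeta>) * (poisson_kernel \<theta> x \<zeta> * \<phi> \<zeta>)"
        unfolding k1_def sum_distrib_right by (intro sum.cong refl) (simp add: algebra_simps)
      ultimately have "(1 - (norm x)\<^sup>2) / 4 * (\<Sum>j\<in>UNIV. k2 j j x \<zeta>) + \<theta> * (\<Sum>j\<in>UNIV. x $ j * k1 j x \<zeta>)
          + \<theta> * (real CARD('n) / 2 - 1 - \<theta>) * (poisson_kernel \<theta> x \<zeta> * \<phi> \<zeta>)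
        = ((1 - (norm x)\<^sup>2) / 4 * (\<Sum>j\<in>UNIV. poisson_kernel_log1 \<theta> (axis j 1) x \<zeta> * poisson_kernel_log1 \<theta> (axis j 1) x \<zeta>
            + poisson_kernel_log2 \<theta> (axis j 1) (axis j 1) x \<zeta>)
     + \<theta> * (\<Sum>j\<in>UNIV. x $ j * poisson_kernel_log1 \<theta> (axis j 1) x \<zeta>)
     + \<theta> * (real CARD('n) / 2 - 1 - \<theta>)) * (poisson_kernel \<theta> x \<zeta> * \<phi> \<zeta>)"
        by (simp only: distrib_right mult.assoc)
      then show "(1 - (norm x)\<^sup>2) / 4 * (\<Sum>j\<in>UNIV. k2 j j x \<zeta>) + \<theta> * (\<Sum>j\<in>UNIV. x $ j * k1 j x \<zeta>)
          + \<theta> * (real CARD('n) / 2 - 1 - \<theta>) * (poisson_kernel \<theta> x \<zeta> * \<phi> \<zeta>) = 0"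
        unfolding kernel_equation[OF x z] by simp
    qed
    finally show "L_jet \<theta> (poisson \<theta> \<phi>) (\<lambda>j x. \<integral>\<zeta>. k1 j x \<zeta> \<partial>\<sigma>) (\<lambda>j k x. \<integral>\<zeta>. k2 j k x \<zeta> \<partial>\<sigma>) x = 0"
      by simp
  qed
qed

end

section \<open>The Poisson integral solves the Dirichlet problem\<close>

context sphere_measure
begin

lemma continuous_on_kernel_section:
  "x \<in> ball 0 1 \<Longrightarrow> continuous_on (sphere 0 1) (poisson_kernel \<theta> x)"
  by (rule continuous_on_section[OF continuous_on_kernel(1)])

text \<open>For an orthogonal \<open>T\<close> the kernel satisfies \<open>K (T x, T \<zeta>) = K (x, \<zeta>)\<close>.\<close>

lemma poisson_one_radial:
  assumes x: "x \<in> ball 0 1" and eq: "norm x = norm y"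
  shows "poisson \<theta> (\<lambda>_. 1) x = poisson \<theta> (\<lambda>_. 1) y"
proof -
  obtain T where T: "orthogonal_transformation T" "T x = y"
    using orthogonal_transformation_exists[OF eq] .
  have y: "y \<in> ball 0 1" using x eq by simp
  have lin: "linear T" using T(1) by (rule orthogonal_transformation_linear)
  have "poisson_kernel \<theta> y (T \<zeta>) = poisson_kernel \<theta> x \<zeta>" for \<zeta>
  proof -
    have "norm (T x - T \<zeta>) = norm (T (x - \<zeta>))" using lin by (simp add: linear_diff)
    also have "\<dots> = norm (x - \<zeta>)" by (rule orthogonal_transformation_norm[OF T(1)])
    finally show ?thesis unfolding poisson_kernel_def using T(2) eq by simp
  qed
  then show ?thesis
    using rotation_invariant[OF T(1) continuous_on_kernel_section[OF y], of \<theta>]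
    unfolding poisson_def by (simp only: mult_1_right)
qed

lemma poisson_one_at_0: "poisson \<theta> (\<lambda>_. 1) 0 = 1"
proof -
  have "poisson \<theta> (\<lambda>_. 1) 0 = (\<integral>\<zeta>. 1 \<partial>\<sigma>)"
    unfolding poisson_def by (rule Bochner_Integration.integral_cong) (auto simp: poisson_kernel_def space_eq)
  then show ?thesis using total by simp
qed

text \<open>Both sides are radial solutions. On a ball of radius \<open>r < 1\<close> around the origin a multiple of
\<open>g (|x|\<^sup>2)\<close> agrees with the Poisson integral on the sphere of radius \<open>r\<close>, hence inside by comparison; the
values at the origin show that the multiple is one. On this smaller ball the power of \<open>1 - |x|\<^sup>2\<close> is positive
up to the boundary and serves as the supersolution.\<close>

lemma poisson_one:
  assumes P: "profile (real CARD('n) / 2) \<theta> \<gamma> g g1 g2" and x: "x \<in> ball 0 1"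
  shows "poisson \<theta> (\<lambda>_. 1) x = g ((norm x)\<^sup>2)"
proof -
  interpret profile "real CARD('n) / 2" \<theta> \<gamma> g g1 g2 by (fact P)
  obtain h1 and h2 :: "'n \<Rightarrow> 'n \<Rightarrow> real ^ 'n \<Rightarrow> real" where h:
    "C2_jet (ball 0 1) (\<lambda>x. g ((norm x)\<^sup>2)) h1 h2"
    "\<And>x. x \<in> ball 0 1 \<Longrightarrow> L_jet \<theta> (\<lambda>x. g ((norm x)\<^sup>2)) h1 h2 x = 0"
    using profile_jet[OF P] by blast
  obtain H1 and H2 :: "'n \<Rightarrow> 'n \<Rightarrow> real ^ 'n \<Rightarrow> real" where H:
    "C2_jet (ball 0 1) (\<lambda>x. (1 - (norm x)\<^sup>2) powr (\<theta> + 1 / 2)) H1 H2"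
    "\<And>x. x \<in> ball 0 1 \<Longrightarrow> L_jet \<theta> (\<lambda>x. (1 - (norm x)\<^sup>2) powr (\<theta> + 1 / 2)) H1 H2 x < 0"
    using strict_supersolution[OF \<theta>_gt] by blast
  obtain m1 m2 where m: "C2_jet (ball 0 1) (poisson \<theta> (\<lambda>_. 1)) m1 m2"
    "\<And>x. x \<in> ball 0 1 \<Longrightarrow> L_jet \<theta> (poisson \<theta> (\<lambda>_. 1)) m1 m2 x = 0"
    using poisson_jet[OF continuous_on_const] by blast
  \<comment> \<open>any radius between \<open>|x|\<close> and \<open>1\<close>\<close>
  define r where "r = (1 + norm x) / 2"
  have r: "0 < r" "r < 1" "norm x < r" using x by (auto simp: r_def add_pos_nonneg)
  obtain k :: 'n where True by simp
  define lam where "lam = poisson \<theta> (\<lambda>_. 1) (r *\<^sub>R axis k 1) / g (r\<^sup>2)"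
  have sub: "ball 0 r \<subseteq> ball (0 :: real ^ 'n) 1" "cball 0 r \<subseteq> ball (0 :: real ^ 'n) 1"
    using r by auto
  define w where "w = (\<lambda>b y. b * (poisson \<theta> (\<lambda>_. 1) y + (- lam) * g ((norm y)\<^sup>2)))"
  have J: "C2_jet (ball 0 1) (w b) (\<lambda>j x. b * (m1 j x + (- lam) * h1 j x)) (\<lambda>j k x. b * (m2 j k x + (- lam) * h2 j k x))" for b
    unfolding w_def by (intro C2_jet_cmult C2_jet_add m(1) h(1))
  have le: "w b y \<le> 0" if y: "y \<in> ball 0 r" for b y
  proof (rule comparison_principle[where r = r and W = "w b" and w = "w b" and G = "\<lambda>x. (1 - (norm x)\<^sup>2) powr (\<theta> + 1 / 2)"])
    show "C2_jet (ball 0 r) (w b) (\<lambda>j x. b * (m1 j x + (- lam) * h1 j x)) (\<lambda>j k x. b * (m2 j k x + (- lam) * h2 j k x))"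
      by (rule C2_jet_subset[OF J sub(1)])
    show "0 \<le> L_jet \<theta> (w b) (\<lambda>j x. b * (m1 j x + (- lam) * h1 j x)) (\<lambda>j k x. b * (m2 j k x + (- lam) * h2 j k x)) z"
      if "z \<in> ball 0 r" for z
    proof -
      have z: "z \<in> ball 0 1" using sub that by auto
      show ?thesis unfolding w_def L_jet_cmult L_jet_add m(2)[OF z] h(2)[OF z] by simp
    qed
    show "continuous_on (cball 0 r) (w b)"
      using J continuous_on_subset[OF _ sub(2)] unfolding C2_jet_def by blast
    show "w b z \<le> 0" if "z \<in> sphere 0 r" for z
    proof -
      have "poisson \<theta> (\<lambda>_. 1) z = poisson \<theta> (\<lambda>_. 1) (r *\<^sub>R axis k 1)"
        using that r by (intro poisson_one_radial) auto
      moreover have "r\<^sup>2 < 1" using r by (simp add: power_less_one_iff)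
      then have "g (r\<^sup>2) > 0" using r by (intro g_pos) auto
      ultimately show ?thesis using that by (simp add: w_def lam_def)
    qed
    show "C2_jet (ball 0 r) (\<lambda>x. (1 - (norm x)\<^sup>2) powr (\<theta> + 1 / 2)) H1 H2"
      by (rule C2_jet_subset[OF H(1) sub(1)])
    show "L_jet \<theta> (\<lambda>x. (1 - (norm x)\<^sup>2) powr (\<theta> + 1 / 2)) H1 H2 z < 0" if "z \<in> ball 0 r" for z
      using sub that by (intro H(2)) auto
    show "continuous_on (cball 0 r) (\<lambda>x :: real ^ 'n. (1 - (norm x)\<^sup>2) powr (\<theta> + 1 / 2))"
      by (rule continuous_on_subset[OF _ sub(2)]) (use H(1) C2_jet_def in blast)
    show "(1 - (norm z)\<^sup>2) powr (\<theta> + 1 / 2) > 0" if "z \<in> cball 0 r" for z :: "real ^ 'n"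
      using norm_sq_less_1[of z] sub(2) that by auto
  qed (use r y in auto)
  have eq: "poisson \<theta> (\<lambda>_. 1) y = lam * g ((norm y)\<^sup>2)" if "y \<in> ball 0 r" for y
    using le[OF that, of 1] le[OF that, of "- 1"] by (simp add: w_def)
  have "lam = 1" using eq[of 0] r poisson_one_at_0 g_0 by simp
  then show ?thesis using eq[of x] r by simp
qed

text \<open>Near \<open>\<eta>\<close> the data varies by at most \<open>\<epsilon>\<close>; away from \<open>\<eta>\<close> the kernel is small, since there
\<open>|x - \<zeta>| \<ge> \<delta> / 2\<close>.\<close>

lemma poisson_boundary_estimate:
  assumes P: "profile (real CARD('n) / 2) \<theta> \<gamma> g g1 g2"
    and \<phi>: "continuous_on (sphere 0 1) \<phi>" and \<eta>: "\<eta> \<in> sphere 0 1"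
    and M: "\<And>\<zeta>. \<zeta> \<in> sphere 0 1 \<Longrightarrow> \<bar>\<phi> \<zeta>\<bar> \<le> M"
    and near: "\<And>\<zeta>. \<zeta> \<in> sphere 0 1 \<Longrightarrow> norm (\<zeta> - \<eta>) < \<delta> \<Longrightarrow> \<bar>\<phi> \<zeta> - \<phi> \<eta>\<bar> \<le> \<epsilon>"
    and \<delta>: "\<delta> > 0" and \<epsilon>: "\<epsilon> > 0" and x: "x \<in> ball 0 1" "norm (x - \<eta>) < \<delta> / 2"
  shows "\<bar>poisson \<theta> \<phi> x - \<phi> \<eta> * g ((norm x)\<^sup>2)\<bar>
     \<le> \<epsilon> * g ((norm x)\<^sup>2) + 2 * M * ((\<delta> / 2)\<^sup>2) powr (- (real CARD('n) / 2 + \<theta>)) * (1 - (norm x)\<^sup>2) powr (1 + 2 * \<theta>)"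
proof -
  interpret profile "real CARD('n) / 2" \<theta> \<gamma> g g1 g2 by (fact P)
  define C where "C = 2 * M * ((\<delta> / 2)\<^sup>2) powr (- (real CARD('n) / 2 + \<theta>)) * (1 - (norm x)\<^sup>2) powr (1 + 2 * \<theta>)"
  have M0: "M \<ge> 0" using M[OF \<eta>] by simp
  have cK: "continuous_on (sphere 0 1) (poisson_kernel \<theta> x)" by (rule continuous_on_kernel_section[OF x(1)])
  have iK: "integrable \<sigma> (poisson_kernel \<theta> x)" by (rule integrable_if_continuous[OF cK])
  have i1: "integrable \<sigma> (\<lambda>\<zeta>. poisson_kernel \<theta> x \<zeta> * \<phi> \<zeta>)"
    by (intro integrable_if_continuous continuous_intros cK \<phi>)
  have i2: "integrable \<sigma> (\<lambda>\<zeta>. poisson_kernel \<theta> x \<zeta> * \<bar>\<phi> \<zeta> - \<phi> \<eta>\<bar>)"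
    by (intro integrable_if_continuous continuous_intros cK \<phi>)
  have g: "(\<integral>\<zeta>. poisson_kernel \<theta> x \<zeta> \<partial>\<sigma>) = g ((norm x)\<^sup>2)" using poisson_one[OF P x(1)] by (simp add: poisson_def)
  have "poisson \<theta> \<phi> x - \<phi> \<eta> * g ((norm x)\<^sup>2) = (\<integral>\<zeta>. poisson_kernel \<theta> x \<zeta> * \<phi> \<zeta> - poisson_kernel \<theta> x \<zeta> * \<phi> \<eta> \<partial>\<sigma>)"
    unfolding poisson_def g[symmetric] using i1 iK by simp
  also have "\<bar>\<dots>\<bar> \<le> (\<integral>\<zeta>. \<bar>poisson_kernel \<theta> x \<zeta> * \<phi> \<zeta> - poisson_kernel \<theta> x \<zeta> * \<phi> \<eta>\<bar> \<partial>\<sigma>)"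
    by (rule integral_abs_bound)
  also have "\<dots> = (\<integral>\<zeta>. poisson_kernel \<theta> x \<zeta> * \<bar>\<phi> \<zeta> - \<phi> \<eta>\<bar> \<partial>\<sigma>)"
  proof (rule Bochner_Integration.integral_cong[OF refl])
    fix \<zeta> assume "\<zeta> \<in> space \<sigma>"
    then have "poisson_kernel \<theta> x \<zeta> > 0" using kernel_pos[OF x(1)] by (simp add: space_eq)
    then show "\<bar>poisson_kernel \<theta> x \<zeta> * \<phi> \<zeta> - poisson_kernel \<theta> x \<zeta> * \<phi> \<eta>\<bar> = poisson_kernel \<theta> x \<zeta> * \<bar>\<phi> \<zeta> - \<phi> \<eta>\<bar>"
      unfolding right_diff_distrib[symmetric] abs_mult by simp
  qed
  also have "\<dots> \<le> (\<integral>\<zeta>. \<epsilon> * poisson_kernel \<theta> x \<zeta> + C \<partial>\<sigma>)"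
  proof (rule integral_mono[OF i2])
    show "integrable \<sigma> (\<lambda>\<zeta>. \<epsilon> * poisson_kernel \<theta> x \<zeta> + C)"
      using iK by simp
    fix \<zeta> assume "\<zeta> \<in> space \<sigma>"
    then have z: "\<zeta> \<in> sphere 0 1" by (simp add: space_eq)
    have K: "poisson_kernel \<theta> x \<zeta> > 0" by (rule kernel_pos[OF x(1) z])
    show "poisson_kernel \<theta> x \<zeta> * \<bar>\<phi> \<zeta> - \<phi> \<eta>\<bar> \<le> \<epsilon> * poisson_kernel \<theta> x \<zeta> + C"
    proof (cases "norm (\<zeta> - \<eta>) < \<delta>")
      case True
      have "poisson_kernel \<theta> x \<zeta> * \<bar>\<phi> \<zeta> - \<phi> \<eta>\<bar> \<le> poisson_kernel \<theta> x \<zeta> * \<epsilon>"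
        using near[OF z True] K by (intro mult_left_mono) auto
      moreover have "C \<ge> 0" using M0 by (simp add: C_def)
      ultimately show ?thesis by (simp add: mult.commute)
    next
      case False
      have "\<delta> / 2 \<le> norm (x - \<zeta>)"
        using False x(2) norm_triangle_ineq[of "\<zeta> - x" "x - \<eta>"] by (simp add: norm_minus_commute)
      then have "(\<delta> / 2)\<^sup>2 \<le> (norm (x - \<zeta>))\<^sup>2" using \<delta> by (intro power_mono) auto
      moreover have "real CARD('n) / 2 + \<theta> > 0" using N_ge \<theta>_gt by simp
      ultimately have "((norm (x - \<zeta>))\<^sup>2) powr (- (real CARD('n) / 2 + \<theta>)) \<le> ((\<delta> / 2)\<^sup>2) powr (- (real CARD('n) / 2 + \<theta>))"
        using \<delta> by (intro powr_mono2') auto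
      then have "poisson_kernel \<theta> x \<zeta> \<le> (1 - (norm x)\<^sup>2) powr (1 + 2 * \<theta>) * ((\<delta> / 2)\<^sup>2) powr (- (real CARD('n) / 2 + \<theta>))"
        unfolding poisson_kernel_def by (intro mult_left_mono) auto
      moreover have "\<bar>\<phi> \<zeta> - \<phi> \<eta>\<bar> \<le> 2 * M" using M[OF z] M[OF \<eta>] by linarith
      ultimately have "poisson_kernel \<theta> x \<zeta> * \<bar>\<phi> \<zeta> - \<phi> \<eta>\<bar>
          \<le> (1 - (norm x)\<^sup>2) powr (1 + 2 * \<theta>) * ((\<delta> / 2)\<^sup>2) powr (- (real CARD('n) / 2 + \<theta>)) * (2 * M)"
        using K by (intro mult_mono) auto
      also have "\<dots> = C" by (simp add: C_def)
      also have "C \<le> \<epsilon> * poisson_kernel \<theta> x \<zeta> + C" using K \<epsilon> by simp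
      finally show ?thesis .
    qed
  qed
  also have "\<dots> = \<epsilon> * g ((norm x)\<^sup>2) + C" using iK g total by simp
  finally show ?thesis unfolding C_def .
qed

text \<open>As \<open>x\<close> tends to \<open>\<eta>\<close> the total mass \<open>g (|x|\<^sup>2)\<close> of the kernel tends to \<open>\<gamma>\<close>, so after division
by \<open>\<gamma>\<close> the preceding estimate gives the boundary values.\<close>

lemma poisson_solves_dirichlet:
  assumes P: "profile (real CARD('n) / 2) \<theta> \<gamma> g g1 g2"
    and \<phi>: "continuous_on (sphere 0 1) \<phi>"
  shows "dirichlet_solution \<theta> \<phi> (\<lambda>x. (1 / \<gamma>) * poisson \<theta> \<phi> x)"
proof -
  interpret profile "real CARD('n) / 2" \<theta> \<gamma> g g1 g2 by (fact P)
  obtain u1 u2 where u: "C2_jet (ball 0 1) (poisson \<theta> \<phi>) u1 u2"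
    "\<And>x. x \<in> ball 0 1 \<Longrightarrow> L_jet \<theta> (poisson \<theta> \<phi>) u1 u2 x = 0"
    using poisson_jet[OF \<phi>] by blast
  define U where "U = (\<lambda>x. if norm x < 1 then (1 / \<gamma>) * poisson \<theta> \<phi> x else \<phi> x)"
  have "compact (\<phi> ` sphere 0 1)" using \<phi> by (intro compact_continuous_image compact_sphere)
  then obtain M where M: "\<And>\<zeta>. \<zeta> \<in> sphere 0 1 \<Longrightarrow> \<bar>\<phi> \<zeta>\<bar> \<le> M"
    using compact_imp_bounded bounded_pos by (metis imageI real_norm_def)
  have Un: "cball (0 :: real ^ 'n) 1 = ball 0 1 \<union> sphere 0 1" by auto
  have "continuous_on (cball 0 1) U"
  proof (rule continuous_on_eq_continuous_within[THEN iffD2], intro ballI)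
    fix \<eta> :: "real ^ 'n" assume "\<eta> \<in> cball 0 1"
    show "continuous (at \<eta> within cball 0 1) U"
    proof (cases "\<eta> \<in> ball 0 1")
      case True
      have "continuous_on (ball 0 1) (\<lambda>x. (1 / \<gamma>) * poisson \<theta> \<phi> x)"
        using u(1) unfolding C2_jet_def by (intro continuous_intros) auto
      then have "continuous_on (ball 0 1) U"
        by (rule continuous_on_eq) (simp add: U_def)
      then have "isCont U \<eta>" using True continuous_on_eq_continuous_at[OF open_ball] by blast
      then show ?thesis by (rule continuous_at_imp_continuous_at_within)
    next
      case False
      then have \<eta>: "\<eta> \<in> sphere 0 1" using \<open>\<eta> \<in> cball 0 1\<close> by auto
      have "(\<phi> \<longlongrightarrow> \<phi> \<eta>) (at \<eta> within sphere 0 1)"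
        using \<phi> \<eta> by (simp add: continuous_on_def)
      moreover have "\<forall>\<^sub>F x in at \<eta> within sphere 0 1. \<phi> x = U x"
        by (auto simp: U_def eventually_at_filter)
      ultimately have l2: "(U \<longlongrightarrow> \<phi> \<eta>) (at \<eta> within sphere 0 1)" by (rule Lim_transform_eventually)
      have gl: "((\<lambda>x. gbar ((norm x)\<^sup>2)) \<longlongrightarrow> \<gamma>) (at \<eta> within ball 0 1)"
      proof -
        have "((\<lambda>x. gbar ((norm x)\<^sup>2)) \<longlongrightarrow> gbar ((norm \<eta>)\<^sup>2)) (at \<eta> within cball 0 1)"
          using continuous_on_gbar_norm_sq[OF P] \<open>\<eta> \<in> cball 0 1\<close> by (auto simp: continuous_on_def)
        then show ?thesis
          using \<eta> tendsto_within_subset[of _ _ \<eta> "cball 0 1" "ball 0 1"] by (auto simp: gbar_def)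
      qed
      have l1: "(U \<longlongrightarrow> \<phi> \<eta>) (at \<eta> within ball 0 1)"
      proof (rule tendstoI)
        fix e :: real assume e: "e > 0"
        \<comment> \<open>the error bound below tends to \<open>\<epsilon>\<close>, so any value smaller than \<open>e\<close> works\<close>
        define \<epsilon> where "\<epsilon> = e / 4"
        have \<epsilon>: "\<epsilon> > 0" using e by (simp add: \<epsilon>_def)
        obtain \<delta> where \<delta>: "\<delta> > 0" "\<And>\<zeta>. \<zeta> \<in> sphere 0 1 \<Longrightarrow> norm (\<zeta> - \<eta>) < \<delta> \<Longrightarrow> \<bar>\<phi> \<zeta> - \<phi> \<eta>\<bar> \<le> \<epsilon>"
        proof -
          obtain d where d: "d > 0" "\<And>\<zeta>. \<zeta> \<in> sphere 0 1 \<Longrightarrow> dist \<zeta> \<eta> < d \<Longrightarrow> dist (\<phi> \<zeta>) (\<phi> \<eta>) < \<epsilon>"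
            using \<phi>[unfolded continuous_on_iff, rule_format, OF \<eta> \<epsilon>] by blast
          show ?thesis
          proof (rule that[OF d(1)])
            fix \<zeta> :: "real ^ 'n" assume "\<zeta> \<in> sphere 0 1" "norm (\<zeta> - \<eta>) < d"
            then show "\<bar>\<phi> \<zeta> - \<phi> \<eta>\<bar> \<le> \<epsilon>" using d(2)[of \<zeta>] by (simp add: dist_norm)
          qed
        qed
        define Q where "Q = 2 * M * ((\<delta> / 2)\<^sup>2) powr (- (real CARD('n) / 2 + \<theta>))"
        define bound where "bound = (\<lambda>x :: real ^ 'n. (1 / \<gamma>) * (\<epsilon> * gbar ((norm x)\<^sup>2) + Q * (1 - (norm x)\<^sup>2) powr (1 + 2 * \<theta>))
            + \<bar>\<phi> \<eta>\<bar> * \<bar>(1 / \<gamma>) * gbar ((norm x)\<^sup>2) - 1\<bar>)"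
        have "((\<lambda>x. (1 - (norm x)\<^sup>2) powr (1 + 2 * \<theta>)) \<longlongrightarrow> (1 - (norm \<eta>)\<^sup>2) powr (1 + 2 * \<theta>)) (at \<eta> within cball 0 1)"
          using continuous_on_defect_power[of "1 + 2 * \<theta>"] \<theta>_gt \<open>\<eta> \<in> cball 0 1\<close> by (auto simp: continuous_on_def)
        then have pl: "((\<lambda>x. (1 - (norm x)\<^sup>2) powr (1 + 2 * \<theta>)) \<longlongrightarrow> 0) (at \<eta> within ball 0 1)"
          using \<eta> tendsto_within_subset[of _ _ \<eta> "cball 0 1" "ball 0 1"] by auto
        have "(bound \<longlongrightarrow> (1 / \<gamma>) * (\<epsilon> * \<gamma> + Q * 0) + \<bar>\<phi> \<eta>\<bar> * \<bar>(1 / \<gamma>) * \<gamma> - 1\<bar>) (at \<eta> within ball 0 1)"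
          unfolding bound_def by (intro tendsto_intros gl pl)
        then have "(bound \<longlongrightarrow> \<epsilon>) (at \<eta> within ball 0 1)" using \<gamma>_pos by simp
        then have "\<forall>\<^sub>F x in at \<eta> within ball 0 1. bound x < e"
          by (rule order_tendstoD(2)) (use e in \<open>simp add: \<epsilon>_def\<close>)
        moreover have "\<forall>\<^sub>F x in at \<eta> within ball 0 1. x \<in> ball 0 1 \<and> norm (x - \<eta>) < \<delta> / 2"
          unfolding eventually_at using \<delta>(1) by (intro exI[of _ "\<delta> / 2"]) (auto simp: dist_norm)
        ultimately show "\<forall>\<^sub>F x in at \<eta> within ball 0 1. dist (U x) (\<phi> \<eta>) < e"
        proof eventually_elim
          case (elim x)
          then have x: "x \<in> ball 0 1" "norm (x - \<eta>) < \<delta> / 2" by auto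
          have gb: "gbar ((norm x)\<^sup>2) = g ((norm x)\<^sup>2)" using norm_sq_less_1[OF x(1)] by (simp add: gbar_def)
          have est: "\<bar>poisson \<theta> \<phi> x - \<phi> \<eta> * gbar ((norm x)\<^sup>2)\<bar>
              \<le> \<epsilon> * gbar ((norm x)\<^sup>2) + Q * (1 - (norm x)\<^sup>2) powr (1 + 2 * \<theta>)"
            using poisson_boundary_estimate[OF P \<phi> \<eta> M \<delta>(2) \<delta>(1) \<epsilon> x] unfolding gb Q_def .
          have "U x - \<phi> \<eta> = (1 / \<gamma>) * (poisson \<theta> \<phi> x - \<phi> \<eta> * gbar ((norm x)\<^sup>2))
              + \<phi> \<eta> * ((1 / \<gamma>) * gbar ((norm x)\<^sup>2) - 1)"
            using x(1) by (simp add: U_def diff_divide_distrib right_diff_distrib)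
          also have "\<bar>\<dots>\<bar> \<le> (1 / \<gamma>) * \<bar>poisson \<theta> \<phi> x - \<phi> \<eta> * gbar ((norm x)\<^sup>2)\<bar>
              + \<bar>\<phi> \<eta>\<bar> * \<bar>(1 / \<gamma>) * gbar ((norm x)\<^sup>2) - 1\<bar>"
            using \<gamma>_pos by (intro order_trans[OF abs_triangle_ineq]) (simp add: abs_mult)
          also have "\<dots> \<le> bound x"
            unfolding bound_def using est \<gamma>_pos by (intro add_right_mono mult_left_mono) auto
          finally show ?case using elim(1) by (simp add: dist_real_def)
        qed
      qed
      have "(U \<longlongrightarrow> \<phi> \<eta>) (at \<eta> within cball 0 1)"
        unfolding Un using l1 l2 by (rule Lim_Un)
      then show ?thesis using \<eta> by (simp add: continuous_within U_def)
    qed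
  qed
  moreover have "L_jet \<theta> (\<lambda>x. (1 / \<gamma>) * poisson \<theta> \<phi> x) (\<lambda>j x. (1 / \<gamma>) * u1 j x) (\<lambda>j k x. (1 / \<gamma>) * u2 j k x) x = 0"
    if "x \<in> ball 0 1" for x
    unfolding L_jet_cmult u(2)[OF that] by simp
  ultimately show ?thesis
    by (intro dirichlet_solutionI[OF C2_jet_cmult[OF u(1)], where U = U]) (auto simp: U_def)
qed

end

section \<open>Positive parameters: barrier and gradient bound\<close>

text \<open>The distance to a boundary point need not be a supersolution, but \<open>L\<close> of it is bounded above: the
Laplacian is \<open>(n - 1) / |x - \<eta>|\<close>, and the factor \<open>1 - |x|\<^sup>2\<close> in front of it is at most
\<open>2 |x - \<eta>|\<close>.\<close>

lemma distance_jet: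
  fixes \<eta> :: "real ^ 'n::finite"
  assumes \<eta>: "\<eta> \<in> sphere 0 1" and th: "\<theta> > 0"
  obtains u1 u2 where "C2_jet (ball 0 1) (\<lambda>x. norm (x - \<eta>)) u1 u2"
    "\<And>x. x \<in> ball 0 1 \<Longrightarrow> L_jet \<theta> (\<lambda>x. norm (x - \<eta>)) u1 u2 x
       \<le> real CARD('n) / 2 + \<theta> + 2 * \<bar>\<theta> * (real CARD('n) / 2 - 1 - \<theta>)\<bar>"
proof -
  define f1 f2 where "f1 = (\<lambda>q :: real. 1 / (2 * sqrt q))" and "f2 = (\<lambda>q :: real. - (1 / (4 * q * sqrt q)))"
  have q: "(norm (x - \<eta>))\<^sup>2 > 0" if "x \<in> ball 0 1" for x :: "real ^ 'n"
    using ball_sphere_neq[OF that \<eta>] by simp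
  have d: "(sqrt has_real_derivative f1 q) (at q)" "(f1 has_real_derivative f2 q) (at q)" "isCont f2 q" if "q > 0" for q
    using that unfolding f1_def f2_def
    by (auto intro!: derivative_eq_intros continuous_intros simp: field_simps)
  note J = C2_jet_fun_sqdist[of "ball (0 :: real ^ 'n) 1" sqrt f1 \<eta> f2, OF d(1)[OF q] d(2)[OF q] d(3)[OF q]]
  show ?thesis
  proof (rule that)
    show "C2_jet (ball 0 1) (\<lambda>x. norm (x - \<eta>)) (sqdist_jet1 \<eta> f1) (sqdist_jet2 \<eta> f1 f2)"
      by (rule C2_jet_cong[OF J]) simp_all
  next
    fix x :: "real ^ 'n" assume x: "x \<in> ball 0 1"
    define p n c where "p = norm (x - \<eta>)" and "n = real CARD('n)" and "c = \<theta> * (real CARD('n) / 2 - 1 - \<theta>)"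
    have p: "p > 0" using ball_sphere_neq[OF x \<eta>] by (simp add: p_def)
    have nx: "norm x < 1" using x by simp
    have y: "0 < 1 - (norm x)\<^sup>2" "1 - (norm x)\<^sup>2 \<le> 2 * p"
      using norm_sq_less_1[OF x] one_minus_norm_sq_le_dist[OF nx, of \<eta>] \<eta> by (auto simp: p_def)
    have n1: "n \<ge> 1" by (simp add: n_def Suc_leI)
    have p2: "p \<le> 2" using norm_triangle_ineq4[of x \<eta>] nx \<eta> by (simp add: p_def)
    have f: "f1 (p\<^sup>2) = 1 / (2 * p)" "f2 (p\<^sup>2) = - (1 / (4 * p\<^sup>2 * p))" using p by (simp_all add: f1_def f2_def)
    have "L_jet \<theta> (\<lambda>x. norm (x - \<eta>)) (sqdist_jet1 \<eta> f1) (sqdist_jet2 \<eta> f1 f2) x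
      = (1 - (norm x)\<^sup>2) / 4 * (2 * n * f1 (p\<^sup>2) + 4 * p\<^sup>2 * f2 (p\<^sup>2))
        + 2 * \<theta> * (x \<bullet> (x - \<eta>)) * f1 (p\<^sup>2) + c * p"
      unfolding L_jet_fun_sqdist p_def n_def c_def ..
    also have "\<dots> = (1 - (norm x)\<^sup>2) * (n - 1) / (4 * p) + \<theta> * (x \<bullet> (x - \<eta>)) / p + c * p"
    proof -
      have "2 * n * f1 (p\<^sup>2) + 4 * p\<^sup>2 * f2 (p\<^sup>2) = (n - 1) / p"
        unfolding f using p by (simp add: field_simps)
      moreover have "2 * \<theta> * (x \<bullet> (x - \<eta>)) * f1 (p\<^sup>2) = \<theta> * (x \<bullet> (x - \<eta>)) / p"
        unfolding f by simp
      ultimately show ?thesis by simp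
    qed
    also have "\<dots> \<le> n / 2 + \<theta> + 2 * \<bar>c\<bar>"
    proof (intro add_mono)
      have "(1 - (norm x)\<^sup>2) * (n - 1) / (4 * p) \<le> (2 * p) * n / (4 * p)"
        using y n1 p by (intro divide_right_mono mult_mono) auto
      then show "(1 - (norm x)\<^sup>2) * (n - 1) / (4 * p) \<le> n / 2" using p by simp
      have "x \<bullet> (x - \<eta>) \<le> norm x * p" unfolding p_def by (rule norm_cauchy_schwarz)
      also have "\<dots> \<le> 1 * p" using nx p by (intro mult_right_mono) auto
      finally have "\<theta> * (x \<bullet> (x - \<eta>)) \<le> \<theta> * p" using th by simp
      then show "\<theta> * (x \<bullet> (x - \<eta>)) / p \<le> \<theta>" using p by (simp add: divide_le_eq)
      have "c * p \<le> \<bar>c\<bar> * p" using p by (intro mult_right_mono) auto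
      also have "\<dots> \<le> \<bar>c\<bar> * 2" using p2 by (intro mult_left_mono) auto
      finally show "c * p \<le> 2 * \<bar>c\<bar>" by simp
    qed
    finally show "L_jet \<theta> (\<lambda>x. norm (x - \<eta>)) (sqdist_jet1 \<eta> f1) (sqdist_jet2 \<eta> f1 f2) x
      \<le> real CARD('n) / 2 + \<theta> + 2 * \<bar>\<theta> * (real CARD('n) / 2 - 1 - \<theta>)\<bar>"
      unfolding n_def c_def .
  qed
qed

text \<open>The comparison function is \<open>w = |y - \<eta>| + A (1 - |y|\<^sup>2) + B (1 - |y|\<^sup>2) powr (1 + \<theta>)\<close>, which has the
same boundary values as \<open>v\<close> and on the ray through \<open>\<eta>\<close> is at most a constant times \<open>1 - |y|\<^sup>2\<close>. For
\<open>L w \<le> 0\<close>, the constant \<open>A\<close> is chosen so that the second term beats the upper bound \<open>C0\<close> for the first one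
near the sphere, where it contributes \<open>- 2 \<theta> A\<close>. The third term is a strict supersolution throughout the
interior, and \<open>B\<close> makes it outweigh the error \<open>D (1 - |y|\<^sup>2)\<close> left by the second.\<close>

lemma barrier:
  fixes \<theta> :: real
  assumes n: "CARD('n::finite) \<ge> 2" and th: "\<theta> > 0"
  obtains C where "C \<ge> 0" "\<And>(\<eta> :: real ^ 'n) v x. \<eta> \<in> sphere 0 1 \<Longrightarrow>
      dirichlet_solution \<theta> (\<lambda>\<zeta>. norm (\<zeta> - \<eta>)) v \<Longrightarrow> x \<in> ball 0 1 \<Longrightarrow> x = norm x *\<^sub>R \<eta> \<Longrightarrow>
      v x \<le> C * (1 - (norm x)\<^sup>2)"
proof -
  define N c where "N = real CARD('n) / 2" and "c = \<theta> * (real CARD('n) / 2 - 1 - \<theta>)"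
  define C0 where "C0 = N + \<theta> + 2 * \<bar>c\<bar>"
  have N: "N \<ge> 1" using n by (simp add: N_def)
  define A where "A = (C0 + 1) / (2 * \<theta>)"
  define D where "D = A * (2 * \<theta> + \<bar>c\<bar>)"
  have C0: "C0 > 0" using N th by (simp add: C0_def)
  have A: "A > 0" using C0 th by (simp add: A_def)
  have D: "D > 0" using A th by (simp add: D_def)
  \<comment> \<open>the smaller of the two coefficients in \<open>defect_power_jet\<close> for \<open>\<beta> = 1 + \<theta>\<close>\<close>
  define \<delta> where "\<delta> = min ((1 + \<theta>) * \<theta>) (N * (1 + \<theta>) - c)"
  have "N * (1 + \<theta>) - c = N + \<theta> + \<theta> * \<theta>" by (simp add: c_def N_def algebra_simps)
  moreover have "N + \<theta> + \<theta> * \<theta> > 0" using N th by (simp add: add_pos_pos)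
  ultimately have "N * (1 + \<theta>) - c > 0" by simp
  then have \<delta>: "\<delta> > 0" using th by (simp add: \<delta>_def)
  \<comment> \<open>only depths \<open>y > 1 / D\<close> need the third term, and there \<open>y powr \<theta>\<close> is at least \<open>(1 / D) powr \<theta>\<close>\<close>
  define B where "B = D / (\<delta> * (1 / D) powr \<theta>)"
  have B: "B > 0" using D \<delta> by (simp add: B_def)
  have beat: "D * y - 1 \<le> B * \<delta> * y powr \<theta>" if y: "0 < y" "y \<le> 1" for y
  proof (cases "D * y \<le> 1")
    case True
    moreover have "B * \<delta> * y powr \<theta> \<ge> 0" using B \<delta> by simp
    ultimately show ?thesis by linarith
  next
    case False
    then have "1 / D \<le> y" using D by (simp add: field_simps)
    then have "(1 / D) powr \<theta> \<le> y powr \<theta>" using D th by (intro powr_mono2) auto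
    then have "B * \<delta> * (1 / D) powr \<theta> \<le> B * \<delta> * y powr \<theta>" using B \<delta> by (intro mult_left_mono) auto
    moreover have "B * \<delta> * (1 / D) powr \<theta> = D" using \<delta> D by (simp add: B_def)
    moreover have "D * y \<le> D" using D y by simp
    ultimately show ?thesis by linarith
  qed
  obtain a1 and a2 :: "'n \<Rightarrow> 'n \<Rightarrow> real ^ 'n \<Rightarrow> real" where a:
    "C2_jet (ball 0 1) (\<lambda>x. (1 - (norm x)\<^sup>2) powr 1) a1 a2"
    "\<And>x. x \<in> ball 0 1 \<Longrightarrow> L_jet \<theta> (\<lambda>x. (1 - (norm x)\<^sup>2) powr 1) a1 a2 x
       = - ((1 - (norm x)\<^sup>2) powr (1 - 1) * (1 * (1 + 2 * \<theta> - 1) * (norm x)\<^sup>2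
            + (real CARD('n) / 2 * 1 - \<theta> * (real CARD('n) / 2 - 1 - \<theta>)) * (1 - (norm x)\<^sup>2)))"
    using defect_power_jet[of 1 \<theta>] by blast
  obtain b1 and b2 :: "'n \<Rightarrow> 'n \<Rightarrow> real ^ 'n \<Rightarrow> real" where b:
    "C2_jet (ball 0 1) (\<lambda>x. (1 - (norm x)\<^sup>2) powr (1 + \<theta>)) b1 b2"
    "\<And>x. x \<in> ball 0 1 \<Longrightarrow> L_jet \<theta> (\<lambda>x. (1 - (norm x)\<^sup>2) powr (1 + \<theta>)) b1 b2 x
       = - ((1 - (norm x)\<^sup>2) powr (1 + \<theta> - 1) * ((1 + \<theta>) * (1 + 2 * \<theta> - (1 + \<theta>)) * (norm x)\<^sup>2
            + (real CARD('n) / 2 * (1 + \<theta>) - \<theta> * (real CARD('n) / 2 - 1 - \<theta>)) * (1 - (norm x)\<^sup>2)))"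
    using defect_power_jet[of "1 + \<theta>" \<theta>] by blast
  show ?thesis
  proof (rule that[of "1 + A + B"])
    show "1 + A + B \<ge> 0" using A B by simp
    fix \<eta> x :: "real ^ 'n" and v
    assume \<eta>: "\<eta> \<in> sphere 0 1" and v: "dirichlet_solution \<theta> (\<lambda>\<zeta>. norm (\<zeta> - \<eta>)) v"
      and x: "x \<in> ball 0 1" and x\<eta>: "x = norm x *\<^sub>R \<eta>"
    obtain v1 v2 V where V: "C2_jet (ball 0 1) v v1 v2" "\<And>x. x \<in> ball 0 1 \<Longrightarrow> L_jet \<theta> v v1 v2 x = 0"
      "continuous_on (cball 0 1) V" "\<And>x. x \<in> ball 0 1 \<Longrightarrow> V x = v x"
      "\<And>\<zeta>. \<zeta> \<in> sphere 0 1 \<Longrightarrow> V \<zeta> = norm (\<zeta> - \<eta>)"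
      using dirichlet_solution_jet[OF v] by blast
    obtain p1 p2 where p: "C2_jet (ball 0 1) (\<lambda>x. norm (x - \<eta>)) p1 p2"
      "\<And>x. x \<in> ball 0 1 \<Longrightarrow> L_jet \<theta> (\<lambda>x. norm (x - \<eta>)) p1 p2 x \<le> C0"
      using distance_jet[OF \<eta> th] unfolding C0_def N_def c_def by blast
    define w where "w = (\<lambda>y :: real ^ 'n. norm (y - \<eta>) + (A * (1 - (norm y)\<^sup>2) powr 1 + B * (1 - (norm y)\<^sup>2) powr (1 + \<theta>)))"
    define w1 where "w1 = (\<lambda>j y. p1 j y + (A * a1 j y + B * b1 j y))"
    define w2 where "w2 = (\<lambda>j k y. p2 j k y + (A * a2 j k y + B * b2 j k y))"
    have Jw: "C2_jet (ball 0 1) w w1 w2"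
      unfolding w_def w1_def w2_def by (intro C2_jet_add C2_jet_cmult p(1) a(1) b(1))
    have Lw: "L_jet \<theta> w w1 w2 y \<le> 0" if y: "y \<in> ball 0 1" for y
    proof -
      define s where "s = (norm y)\<^sup>2"
      have s: "0 \<le> s" "s < 1" using norm_sq_less_1[OF y] by (auto simp: s_def)
      have La: "L_jet \<theta> (\<lambda>x. (1 - (norm x)\<^sup>2) powr 1) a1 a2 y \<le> - 2 * \<theta> + (2 * \<theta> + \<bar>c\<bar>) * (1 - s)"
      proof -
        have "L_jet \<theta> (\<lambda>x. (1 - (norm x)\<^sup>2) powr 1) a1 a2 y = - (2 * \<theta> * s + (N - c) * (1 - s))"
          unfolding a(2)[OF y] s_def[symmetric] N_def c_def using s by simp
        also have "\<dots> = - 2 * \<theta> + (2 * \<theta> - N + c) * (1 - s)" by (simp add: algebra_simps)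
        also have "\<dots> \<le> - 2 * \<theta> + (2 * \<theta> + \<bar>c\<bar>) * (1 - s)"
          using s N by (intro add_left_mono mult_right_mono) auto
        finally show ?thesis .
      qed
      have Lb: "L_jet \<theta> (\<lambda>x. (1 - (norm x)\<^sup>2) powr (1 + \<theta>)) b1 b2 y \<le> - (\<delta> * (1 - s) powr \<theta>)"
      proof -
        have "\<delta> = \<delta> * s + \<delta> * (1 - s)" by (simp add: algebra_simps)
        also have "\<dots> \<le> (1 + \<theta>) * \<theta> * s + (N * (1 + \<theta>) - c) * (1 - s)"
          using s by (intro add_mono mult_right_mono) (auto simp: \<delta>_def)
        finally have "(1 - s) powr \<theta> * \<delta> \<le> (1 - s) powr \<theta> * ((1 + \<theta>) * \<theta> * s + (N * (1 + \<theta>) - c) * (1 - s))"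
          by (intro mult_left_mono) auto
        then show ?thesis unfolding b(2)[OF y] s_def[symmetric] N_def c_def by (simp add: mult_ac)
      qed
      have "L_jet \<theta> w w1 w2 y = L_jet \<theta> (\<lambda>x. norm (x - \<eta>)) p1 p2 y
          + (A * L_jet \<theta> (\<lambda>x. (1 - (norm x)\<^sup>2) powr 1) a1 a2 y
             + B * L_jet \<theta> (\<lambda>x. (1 - (norm x)\<^sup>2) powr (1 + \<theta>)) b1 b2 y)"
        unfolding w_def w1_def w2_def L_jet_add L_jet_cmult ..
      also have "\<dots> \<le> C0 + (A * (- 2 * \<theta> + (2 * \<theta> + \<bar>c\<bar>) * (1 - s)) + B * (- (\<delta> * (1 - s) powr \<theta>)))"
        using A B by (intro add_mono mult_left_mono p(2)[OF y] La Lb) auto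
      also have "\<dots> = D * (1 - s) - 1 - B * \<delta> * (1 - s) powr \<theta>"
      proof -
        have "A * (2 * \<theta>) = C0 + 1" using th by (simp add: A_def)
        moreover have "A * (- 2 * \<theta> + (2 * \<theta> + \<bar>c\<bar>) * (1 - s)) = - (A * (2 * \<theta>)) + D * (1 - s)"
          by (simp add: D_def algebra_simps)
        ultimately show ?thesis by simp
      qed
      also have "\<dots> \<le> 0" using beat[of "1 - s"] s by simp
      finally show ?thesis .
    qed
    have "v x + (- 1) * w x \<le> 0"
    proof (rule maximum_principle[OF n _ C2_jet_add[OF V(1) C2_jet_cmult[OF Jw, of "- 1"]]])
      show "\<theta> > - 1 / 2" using th by simp
      show "0 \<le> L_jet \<theta> (\<lambda>x. v x + - 1 * w x) (\<lambda>j x. v1 j x + - 1 * w1 j x) (\<lambda>j k x. v2 j k x + - 1 * w2 j k x) y"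
        if "y \<in> ball 0 1" for y
        unfolding L_jet_add L_jet_cmult V(2)[OF that] using Lw[OF that] by simp
      show "continuous_on (cball 0 1) (\<lambda>y. V y + (- 1) * w y)"
        unfolding w_def using th by (intro continuous_intros V(3) continuous_on_defect_power) auto
      show "V y + (- 1) * w y = v y + (- 1) * w y" if "y \<in> ball 0 1" for y
        using V(4)[OF that] by simp
      show "V y + (- 1) * w y \<le> 0" if "y \<in> sphere 0 1" for y
        using V(5)[OF that] that by (simp add: w_def)
    qed (rule x)
    then have "v x \<le> w x" by simp
    also have "w x \<le> (1 + A + B) * (1 - (norm x)\<^sup>2)"
    proof -
      define y where "y = 1 - (norm x)\<^sup>2"
      have y: "0 < y" "y \<le> 1" using norm_sq_less_1[OF x] by (auto simp: y_def)
      have nx: "norm x < 1" using x by simp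
      have "norm (x - \<eta>) = norm ((norm x - 1) *\<^sub>R \<eta>)" using x\<eta> by (metis scaleR_left_diff_distrib scaleR_one)
      also have "\<dots> = 1 - norm x" using \<eta> nx by simp
      also have "\<dots> \<le> y" unfolding y_def using nx mult_right_le_one_le[of "norm x" "norm x"]
        by (simp add: power2_eq_square)
      finally have 1: "norm (x - \<eta>) \<le> y" .
      have "y powr (1 + \<theta>) \<le> y powr 1" using y th by (intro powr_mono') auto
      then have "B * y powr (1 + \<theta>) \<le> B * y" using B y by (intro mult_left_mono) auto
      then show ?thesis unfolding w_def y_def[symmetric] using 1 y by (simp add: algebra_simps)
    qed
    finally show "v x \<le> (1 + A + B) * (1 - (norm x)\<^sup>2)" .
  qed
qed

text \<open>The mean value theorem along the segment between two points, which stays in the ball by convexity.\<close>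

lemma lipschitz_on_ball_if_line_derivative_bound:
  fixes u :: "real ^ 'n::finite \<Rightarrow> real"
  assumes d: "\<And>x v. x \<in> ball 0 1 \<Longrightarrow> \<exists>D. ((\<lambda>t. u (x + t *\<^sub>R v)) has_real_derivative D) (at 0) \<and> \<bar>D\<bar> \<le> C * norm v"
    and "C \<ge> 0"
  shows "C-lipschitz_on (ball 0 1) u"
proof (rule lipschitz_onI[OF _ \<open>C \<ge> 0\<close>])
  fix x y :: "real ^ 'n" assume x: "x \<in> ball 0 1" and y: "y \<in> ball 0 1"
  define v where "v = y - x"
  obtain D where D: "\<And>z. z \<in> ball 0 1 \<Longrightarrow> ((\<lambda>t. u (z + t *\<^sub>R v)) has_real_derivative D z) (at 0) \<and> \<bar>D z\<bar> \<le> C * norm v"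
    using d[of _ v] by metis
  have "norm (u (x + 0 *\<^sub>R v) - u (x + 1 *\<^sub>R v)) \<le> C * norm v * norm (0 - 1 :: real)"
  proof (rule field_differentiable_bound[where S = "{0..1 :: real}"])
    fix t :: real assume t: "t \<in> {0..1}"
    have "x + t *\<^sub>R v = (1 - t) *\<^sub>R x + t *\<^sub>R y" by (simp add: v_def algebra_simps)
    then have z: "x + t *\<^sub>R v \<in> ball 0 1"
      using convexD_alt[OF convex_ball x y, of t] t by auto
    show "((\<lambda>s. u (x + s *\<^sub>R v)) has_field_derivative D (x + t *\<^sub>R v)) (at t within {0..1})"
      using has_derivative_along_line_shift[OF conjunct1[OF D[OF z]]] by (rule has_field_derivative_at_within)
    show "norm (D (x + t *\<^sub>R v)) \<le> C * norm v" using D[OF z] by simp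
  qed auto
  then show "dist (u x) (u y) \<le> C * dist x y" by (simp add: v_def dist_norm norm_minus_commute)
qed

context sphere_measure
begin

text \<open>The key estimate: the mean distance to \<open>\<eta>\<close>, weighted by the kernel at a point below \<open>\<eta>\<close>, is of the
order of the distance to the sphere. This fails for \<open>\<theta> = 0\<close>, where a logarithm appears.\<close>

lemma poisson_dist_bound:
  assumes P: "profile (real CARD('n) / 2) \<theta> \<gamma> g g1 g2" and n: "CARD('n) \<ge> 2" and th: "\<theta> > 0"
  obtains C where "C \<ge> 0" "\<And>\<eta> x. \<eta> \<in> sphere 0 1 \<Longrightarrow> x \<in> ball 0 1 \<Longrightarrow> x = norm x *\<^sub>R \<eta> \<Longrightarrow>
      poisson \<theta> (\<lambda>\<zeta>. norm (\<zeta> - \<eta>)) x \<le> C * (1 - (norm x)\<^sup>2)"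
proof -
  interpret profile "real CARD('n) / 2" \<theta> \<gamma> g g1 g2 by (fact P)
  obtain C where C: "C \<ge> 0" "\<And>(\<eta> :: real ^ 'n) v x. \<eta> \<in> sphere 0 1 \<Longrightarrow>
      dirichlet_solution \<theta> (\<lambda>\<zeta>. norm (\<zeta> - \<eta>)) v \<Longrightarrow> x \<in> ball 0 1 \<Longrightarrow> x = norm x *\<^sub>R \<eta> \<Longrightarrow>
      v x \<le> C * (1 - (norm x)\<^sup>2)"
    using barrier[OF n th] by blast
  show ?thesis
  proof (rule that[of "\<gamma> * C"])
    show "\<gamma> * C \<ge> 0" using C(1) \<gamma>_pos by simp
    fix \<eta> x :: "real ^ 'n" assume \<eta>: "\<eta> \<in> sphere 0 1" and x: "x \<in> ball 0 1" "x = norm x *\<^sub>R \<eta>"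
    have "dirichlet_solution \<theta> (\<lambda>\<zeta>. norm (\<zeta> - \<eta>)) (\<lambda>x. (1 / \<gamma>) * poisson \<theta> (\<lambda>\<zeta>. norm (\<zeta> - \<eta>)) x)"
      by (intro poisson_solves_dirichlet[OF P] continuous_intros)
    from C(2)[OF \<eta> this x] show "poisson \<theta> (\<lambda>\<zeta>. norm (\<zeta> - \<eta>)) x \<le> \<gamma> * C * (1 - (norm x)\<^sup>2)"
      using \<gamma>_pos by (simp add: divide_le_eq mult_ac)
  qed
qed

text \<open>The derivative along \<open>v\<close> is the integral of \<open>k k1 \<phi>\<close> with the logarithmic derivative \<open>k1\<close>.
Subtracting \<open>\<phi> \<eta>\<close> from \<open>\<phi>\<close> leaves a multiple of the derivative of the radial solution, and a
remainder in which \<open>k1\<close> costs a factor \<open>1 / y\<close> that the key estimate regains.\<close>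

lemma poisson_lipschitz:
  assumes P: "profile (real CARD('n) / 2) \<theta> \<gamma> g g1 g2" and n: "CARD('n) \<ge> 2" and th: "\<theta> > 0"
    and \<phi>: "L-lipschitz_on (sphere 0 1) \<phi>"
  shows "lipschitz_continuous_on (ball 0 1) (poisson \<theta> \<phi>)"
proof -
  interpret profile "real CARD('n) / 2" \<theta> \<gamma> g g1 g2 by (fact P)
  have L: "L \<ge> 0" using \<phi> by (rule lipschitz_on_nonneg)
  have c\<phi>: "continuous_on (sphere 0 1) \<phi>" using \<phi> by (rule lipschitz_on_continuous_on)
  obtain B where B: "\<And>s. 0 \<le> s \<Longrightarrow> s < 1 \<Longrightarrow> \<bar>g1 s\<bar> \<le> B" using g1_bounded[OF th] by blast
  have B0: "B \<ge> 0" using B[of 0] by simp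
  have "compact (\<phi> ` sphere 0 1)" using c\<phi> by (intro compact_continuous_image compact_sphere)
  then obtain M where M: "M > 0" "\<And>\<zeta>. \<zeta> \<in> sphere 0 1 \<Longrightarrow> \<bar>\<phi> \<zeta>\<bar> \<le> M"
    using compact_imp_bounded bounded_pos by (metis imageI real_norm_def)
  obtain C where C: "C \<ge> 0" "\<And>\<eta> x. \<eta> \<in> sphere 0 1 \<Longrightarrow> x \<in> ball 0 1 \<Longrightarrow> x = norm x *\<^sub>R \<eta> \<Longrightarrow>
      poisson \<theta> (\<lambda>\<zeta>. norm (\<zeta> - \<eta>)) x \<le> C * (1 - (norm x)\<^sup>2)"
    using poisson_dist_bound[OF P n th] by blast
  define E where "E = 2 * (1 + 2 * \<theta>) + 4 * (real CARD('n) / 2 + \<theta>)"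
  have E: "E \<ge> 0" using th by (simp add: E_def)
  \<comment> \<open>the two summands bound the oscillation part and the constant part of the data\<close>
  define K where "K = E * L * C + M * (2 * B)"
  have K0: "K \<ge> 0" using E L C M B0 by (simp add: K_def)
  have "K-lipschitz_on (ball 0 1) (poisson \<theta> \<phi>)"
  proof (rule lipschitz_on_ball_if_line_derivative_bound[OF _ K0])
    fix x v :: "real ^ 'n" assume x: "x \<in> ball 0 1"
    define y where "y = 1 - (norm x)\<^sup>2"
    have y: "y > 0" using norm_sq_less_1[OF x] by (simp add: y_def)
    obtain \<eta> where \<eta>: "\<eta> \<in> sphere 0 1" "x = norm x *\<^sub>R \<eta>"
    proof (cases "x = 0")
      case True
      obtain k :: 'n where Tr: True by simp
      show ?thesis using that[of "axis k 1"] True by simp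
    next
      case False
      then show ?thesis using that[of "x /\<^sub>R norm x"] by simp
    qed
    define k k1 where "k = poisson_kernel \<theta> x" and "k1 = poisson_kernel_log1 \<theta> v x"
    have ck: "continuous_on (sphere 0 1) k" unfolding k_def by (rule continuous_on_kernel_section[OF x])
    have ck1: "continuous_on (sphere 0 1) k1"
      unfolding k1_def by (rule continuous_on_section[OF continuous_on_kernel(2) x])
    have deriv: "((\<lambda>t. poisson \<theta> \<psi> (x + t *\<^sub>R v)) has_real_derivative (\<integral>\<zeta>. k \<zeta> * k1 \<zeta> * \<psi> \<zeta> \<partial>\<sigma>)) (at 0)"
      if "continuous_on (sphere 0 1) \<psi>" for \<psi>
      unfolding k_def k1_def by (rule poisson_derivative_along_line[OF that x])
    have one: "(\<integral>\<zeta>. k \<zeta> * k1 \<zeta> \<partial>\<sigma>) = 2 * (x \<bullet> v) * g1 ((norm x)\<^sup>2)"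
    proof (rule DERIV_unique)
      show "((\<lambda>t. poisson \<theta> (\<lambda>_. 1) (x + t *\<^sub>R v)) has_real_derivative (\<integral>\<zeta>. k \<zeta> * k1 \<zeta> \<partial>\<sigma>)) (at 0)"
        using deriv[of "\<lambda>_. 1"] by simp
      have "(g has_real_derivative g1 ((norm (x - 0))\<^sup>2)) (at ((norm (x - 0))\<^sup>2))"
        using norm_sq_less_1[OF x] by (intro g_deriv) simp
      from fun_sqdist_has_derivative_along_line[OF this, of v]
      have "((\<lambda>t. g ((norm (x + t *\<^sub>R v))\<^sup>2)) has_real_derivative 2 * (x \<bullet> v) * g1 ((norm x)\<^sup>2)) (at 0)" by simp
      then show "((\<lambda>t. poisson \<theta> (\<lambda>_. 1) (x + t *\<^sub>R v)) has_real_derivative 2 * (x \<bullet> v) * g1 ((norm x)\<^sup>2)) (at 0)"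
        by (rule has_derivative_along_line_cong[OF open_ball x, of "\<lambda>x. g ((norm x)\<^sup>2)", rotated])
           (simp add: poisson_one[OF P])
    qed
    have i1: "integrable \<sigma> (\<lambda>\<zeta>. k \<zeta> * k1 \<zeta> * \<phi> \<zeta>)" "integrable \<sigma> (\<lambda>\<zeta>. k \<zeta> * k1 \<zeta>)"
      by (intro integrable_if_continuous continuous_intros ck ck1 c\<phi>)+
    have i2: "integrable \<sigma> (\<lambda>\<zeta>. \<bar>k \<zeta> * k1 \<zeta> * (\<phi> \<zeta> - \<phi> \<eta>)\<bar>)" "integrable \<sigma> (\<lambda>\<zeta>. E / y * norm v * L * (k \<zeta> * norm (\<zeta> - \<eta>)))"
      by (intro integrable_if_continuous continuous_intros ck ck1 c\<phi>)+
    have split: "(\<integral>\<zeta>. k \<zeta> * k1 \<zeta> * \<phi> \<zeta> \<partial>\<sigma>)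
        = (\<integral>\<zeta>. k \<zeta> * k1 \<zeta> * (\<phi> \<zeta> - \<phi> \<eta>) \<partial>\<sigma>) + (2 * (x \<bullet> v) * g1 ((norm x)\<^sup>2)) * \<phi> \<eta>"
      unfolding one[symmetric] right_diff_distrib using i1 by simp
    have "\<bar>\<integral>\<zeta>. k \<zeta> * k1 \<zeta> * (\<phi> \<zeta> - \<phi> \<eta>) \<partial>\<sigma>\<bar> \<le> (\<integral>\<zeta>. \<bar>k \<zeta> * k1 \<zeta> * (\<phi> \<zeta> - \<phi> \<eta>)\<bar> \<partial>\<sigma>)"
      by (rule integral_abs_bound)
    also have "\<dots> \<le> (\<integral>\<zeta>. E / y * norm v * L * (k \<zeta> * norm (\<zeta> - \<eta>)) \<partial>\<sigma>)"
    proof (rule integral_mono[OF i2])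
      fix \<zeta> assume "\<zeta> \<in> space \<sigma>"
      then have z: "\<zeta> \<in> sphere 0 1" by (simp add: space_eq)
      have k: "k \<zeta> > 0" unfolding k_def by (rule kernel_pos[OF x z])
      have 1: "\<bar>k1 \<zeta>\<bar> \<le> E / y * norm v"
        unfolding k1_def E_def y_def using th by (intro poisson_kernel_log1_bound x z n) auto
      have 2: "\<bar>\<phi> \<zeta> - \<phi> \<eta>\<bar> \<le> L * norm (\<zeta> - \<eta>)"
        using lipschitz_onD[OF \<phi> z \<eta>(1)] by (simp add: dist_norm)
      have "\<bar>k \<zeta> * k1 \<zeta> * (\<phi> \<zeta> - \<phi> \<eta>)\<bar> = k \<zeta> * (\<bar>k1 \<zeta>\<bar> * \<bar>\<phi> \<zeta> - \<phi> \<eta>\<bar>)"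
        using k by (simp add: abs_mult)
      also have "\<dots> \<le> k \<zeta> * ((E / y * norm v) * (L * norm (\<zeta> - \<eta>)))"
        using k 1 2 E y by (intro mult_left_mono mult_mono) auto
      finally show "\<bar>k \<zeta> * k1 \<zeta> * (\<phi> \<zeta> - \<phi> \<eta>)\<bar> \<le> E / y * norm v * L * (k \<zeta> * norm (\<zeta> - \<eta>))"
        by (simp add: mult_ac)
    qed
    also have "\<dots> = E / y * norm v * L * poisson \<theta> (\<lambda>\<zeta>. norm (\<zeta> - \<eta>)) x"
      unfolding poisson_def k_def by simp
    also have "\<dots> \<le> E / y * norm v * L * (C * y)"
      using C(2)[OF \<eta>(1) x \<eta>(2)] E y L unfolding y_def by (intro mult_left_mono) auto
    also have "\<dots> = E * L * C * norm v" using y by simp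
    finally have b1: "\<bar>\<integral>\<zeta>. k \<zeta> * k1 \<zeta> * (\<phi> \<zeta> - \<phi> \<eta>) \<partial>\<sigma>\<bar> \<le> E * L * C * norm v" .
    have "\<bar>x \<bullet> v\<bar> \<le> norm x * norm v" by (rule Cauchy_Schwarz_ineq2)
    also have "\<dots> \<le> 1 * norm v" using x by (intro mult_right_mono) auto
    finally have xv: "\<bar>x \<bullet> v\<bar> \<le> norm v" by simp
    have "\<bar>(2 * (x \<bullet> v) * g1 ((norm x)\<^sup>2)) * \<phi> \<eta>\<bar> = 2 * \<bar>x \<bullet> v\<bar> * \<bar>g1 ((norm x)\<^sup>2)\<bar> * \<bar>\<phi> \<eta>\<bar>"
      by (simp add: abs_mult)
    also have "\<dots> \<le> 2 * norm v * B * M"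
      using xv B[of "(norm x)\<^sup>2"] norm_sq_less_1[OF x] M(2)[OF \<eta>(1)] B0 by (intro mult_mono) auto
    finally have b2: "\<bar>(2 * (x \<bullet> v) * g1 ((norm x)\<^sup>2)) * \<phi> \<eta>\<bar> \<le> M * (2 * B) * norm v" by (simp add: mult_ac)
    have "\<bar>\<integral>\<zeta>. k \<zeta> * k1 \<zeta> * \<phi> \<zeta> \<partial>\<sigma>\<bar> \<le> K * norm v"
      unfolding split K_def distrib_right by (rule order_trans[OF abs_triangle_ineq add_mono[OF b1 b2]])
    then show "\<exists>D. ((\<lambda>t. poisson \<theta> \<phi> (x + t *\<^sub>R v)) has_real_derivative D) (at 0) \<and> \<bar>D\<bar> \<le> K * norm v"
      using deriv[OF c\<phi>] by blast
  qed
  then show ?thesis unfolding lipschitz_continuous_on_def by blast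
qed

end

lemma lipschitz_data_lipschitz_solution:
  fixes \<phi> :: "real ^ 'n::finite \<Rightarrow> real"
  assumes n: "CARD('n) \<ge> 2" and th: "\<theta> > 0" and \<phi>: "lipschitz_continuous_on (sphere 0 1) \<phi>"
  shows "\<exists>u. dirichlet_solution \<theta> \<phi> u"
    and "dirichlet_solution \<theta> \<phi> u \<Longrightarrow> lipschitz_continuous_on (ball 0 1) u"
proof -
  have th': "\<theta> > - 1 / 2" using th by simp
  have N: "real CARD('n) / 2 \<ge> 1" using n by simp
  obtain \<gamma> g g1 g2 where P: "profile (real CARD('n) / 2) \<theta> \<gamma> g g1 g2"
    using profile_exists[OF th' N] by blast
  obtain \<sigma> :: "(real ^ 'n) measure" where "sphere_measure \<sigma>" using sphere_measure_exists by blast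
  then interpret sphere_measure \<sigma> .
  obtain L where L: "L-lipschitz_on (sphere 0 1) \<phi>" using \<phi> unfolding lipschitz_continuous_on_def by blast
  have sol: "dirichlet_solution \<theta> \<phi> (\<lambda>x. (1 / \<gamma>) * poisson \<theta> \<phi> x)"
    by (rule poisson_solves_dirichlet[OF P lipschitz_on_continuous_on[OF L]])
  then show "\<exists>u. dirichlet_solution \<theta> \<phi> u" by blast
  assume u: "dirichlet_solution \<theta> \<phi> u"
  obtain K where "K-lipschitz_on (ball 0 1) (poisson \<theta> \<phi>)"
    using poisson_lipschitz[OF P n th L] unfolding lipschitz_continuous_on_def by blast
  then have "(\<bar>1 / \<gamma>\<bar> * K)-lipschitz_on (ball 0 1) (\<lambda>x. (1 / \<gamma>) * poisson \<theta> \<phi> x)"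
    by (rule lipschitz_on_cmult_real)
  then have "(\<bar>1 / \<gamma>\<bar> * K)-lipschitz_on (ball 0 1) u"
    by (rule lipschitz_on_transform) (rule dirichlet_solution_unique[OF n th' u sol])
  then show "lipschitz_continuous_on (ball 0 1) u" unfolding lipschitz_continuous_on_def by blast
qed

theorem theorem1p1:
  fixes \<theta> :: real
  assumes "CARD('n::finite) \<ge> 2" and "\<theta> > - 1 / 2"
  shows "(\<theta> \<le> 0 \<longrightarrow>
            (\<exists>\<phi> :: real ^ 'n \<Rightarrow> real. lipschitz_continuous_on (sphere 0 1) \<phi> \<and>
               (\<exists>u. dirichlet_solution \<theta> \<phi> u) \<and>
               (\<forall>u. dirichlet_solution \<theta> \<phi> u \<longrightarrow> \<not> lipschitz_continuous_on (ball 0 1) u)))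
       \<and> (\<theta> > 0 \<longrightarrow>
            (\<forall>\<phi> :: real ^ 'n \<Rightarrow> real. lipschitz_continuous_on (sphere 0 1) \<phi> \<longrightarrow>
               (\<exists>u. dirichlet_solution \<theta> \<phi> u) \<and>
               (\<forall>u. dirichlet_solution \<theta> \<phi> u \<longrightarrow> lipschitz_continuous_on (ball 0 1) u)))"
proof (intro conjI impI)
  assume "\<theta> \<le> 0"
  show "\<exists>\<phi> :: real ^ 'n \<Rightarrow> real. lipschitz_continuous_on (sphere 0 1) \<phi> \<and>
               (\<exists>u. dirichlet_solution \<theta> \<phi> u) \<and>
               (\<forall>u. dirichlet_solution \<theta> \<phi> u \<longrightarrow> \<not> lipschitz_continuous_on (ball 0 1) u)"
  proof (cases "\<theta> = 0")
    case True
    then show ?thesis using harmonic_lipschitz_failure[OF assms(1)] by metis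
  next
    case False
    then have "\<theta> < 0" using \<open>\<theta> \<le> 0\<close> by simp
    have "lipschitz_continuous_on (sphere 0 1) (\<lambda>_ :: real ^ 'n. 1)"
      unfolding lipschitz_continuous_on_def by (intro exI[of _ 0] lipschitz_onI) auto
    then show ?thesis
      using constant_data_not_lipschitz[OF assms \<open>\<theta> < 0\<close>] by blast
  qed
next
  assume "\<theta> > 0"
  then show "\<forall>\<phi> :: real ^ 'n \<Rightarrow> real. lipschitz_continuous_on (sphere 0 1) \<phi> \<longrightarrow>
               (\<exists>u. dirichlet_solution \<theta> \<phi> u) \<and>
               (\<forall>u. dirichlet_solution \<theta> \<phi> u \<longrightarrow> lipschitz_continuous_on (ball 0 1) u)"
    using lipschitz_data_lipschitz_solution[OF assms(1)] by blast
qed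

end
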